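(* Let $\Omega\subset\mathbb{R}^N$ ($N\ge 1$) be a bounded and smooth domain and let $1<p<r<\infty$. Let $h:[0,\infty)\to[0,\infty)$ be continuous and nondecreasing, with $h(t)\le C(1+t^{\frac rp-1})$ for some $C>0$ and all $t\ge0$. Let $X=W^{1,r}(\Omega)$ or $X=W_0^{1,r}(\Omega)$, let $g:\Omega\times\mathbb{R}\to\mathbb{R}$ be a Carath\'eodory function, and let $I:X\to\mathbb{R}$ be given by $$I(u)=\int_\Omega\left(\frac1p H(|\nabla u|^p)-G(x,u)\right)dx,\qquad H(t)=\int_0^t h(s)\,ds,\quad G(x,t)=\int_0^t g(x,s)\,ds.$$ Assume that: (i) there are $C,\sigma>0$ with $\sigma(N-r)\le (r-1)N+r$ such that $|g(x,t)|\le C(1+|t|^{\sigma})$ for all $(x,t)\in\Omega\times\mathbb{R}$; (ii) for every $x\in\Omega$ the map $t\mapsto\frac{g(x,t)}{t^{p-1}}$ is nonincreasing in $(0,\infty)$; (iii) any nonnegative critical point of $I$ is continuous on $\overline\Omega$, and for any two nonnegative critical points $u,v\not\equiv0$ of $I$ there is $\delta\in(0,1)$ such that $0<\delta v\le u\le\delta^{-1}v$ in $\Omega$. Let $A$ be the set of nontrivial nonnegative critical points of $I$ in $X$. Then: (1) If $h>0$ in $(0,\infty)$ and $A\neq\emptyset$, then $A\subset\{\alpha u_0:\alpha\ge0\}$ for some $u_0\in A$. (2) If the map in (ii) is decreasing in $(0,\infty)$ (for every $x\in\Omega$), then $A$ has at most one element. (3) If $h$ is increasing and $A$ contains a nonconstant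 element, then $A$ is a singleton.
   Context: Under the stated growth assumptions on $h$ and $g$, $I$ is a $C^1$ functional on $X$; a critical point of $I$ is $u\in X$ with $I'(u)=0$ in the dual of $X$. A critical point is nontrivial if it is not identically zero. Inequalities between measurable functions are understood almost everywhere; a function $u\in C(\overline\Omega)$ is nonnegative if $u(x)\ge0$ for all $x\in\Omega$. "Nondecreasing" means $f(t)\le f(s)$ whenever $t<s$, "increasing" means $f(t)<f(s)$ whenever $t<s$; "nonincreasing" and "decreasing" mean $f(t)\ge f(s)$, respectively $f(t)>f(s)$, whenever $t<s$. *)

theory Defs
  imports "HOL-Analysis.Analysis"
begin

primrec Ck :: "nat \<Rightarrow> ('a::euclidean_space \<Rightarrow> real) \<Rightarrow> bool" where
  "Ck 0 f \<longleftrightarrow> continuous_on UNIV f"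
| "Ck (Suc k) f \<longleftrightarrow> (\<forall>x. f differentiable (at x)) \<and>
     (\<forall>v. Ck k (\<lambda>x. frechet_derivative f (at x) v))"

definition smooth_fun :: "('a::euclidean_space \<Rightarrow> real) \<Rightarrow> bool" where
  "smooth_fun f \<longleftrightarrow> (\<forall>k. Ck k f)"

text \<open>Near each boundary point the domain is, after a rotation, the open region on one side of
  the graph of a smooth function: the unit vector \<open>e\<close> plays the role of the last coordinate axis,
  and only the values of \<open>\<gamma>\<close> on the hyperplane orthogonal to \<open>e\<close> matter.\<close>

definition smooth_bounded_domain :: "'a::euclidean_space set \<Rightarrow> bool" where
  "smooth_bounded_domain \<Omega> \<longleftrightarrow>
     \<Omega> \<noteq> {} \<and> open \<Omega> \<and> connected \<Omega> \<and> bounded \<Omega> \<and>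
     (\<forall>x\<in>frontier \<Omega>. \<exists>\<rho>>0. \<exists>e \<gamma>. norm e = 1 \<and> smooth_fun \<gamma> \<and>
        \<Omega> \<inter> ball x \<rho> = {y \<in> ball x \<rho>. \<gamma> (y - (y \<bullet> e) *\<^sub>R e) < y \<bullet> e})"

definition test_functions :: "'a::euclidean_space set \<Rightarrow> ('a \<Rightarrow> real) set" where
  "test_functions \<Omega> = {\<phi>. smooth_fun \<phi> \<and>
     compact (closure {x. \<phi> x \<noteq> 0}) \<and> closure {x. \<phi> x \<noteq> 0} \<subseteq> \<Omega>}"

definition loc_integrable ::
    "'a::euclidean_space set \<Rightarrow> ('a \<Rightarrow> 'b::euclidean_space) \<Rightarrow> bool" where
  "loc_integrable \<Omega> f \<longleftrightarrow> (\<forall>K. compact K \<and> K \<subseteq> \<Omega> \<longrightarrow> integrable (lebesgue_on K) f)"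

definition in_Lp :: "'a::euclidean_space set \<Rightarrow> real \<Rightarrow> ('a \<Rightarrow> 'b::euclidean_space) \<Rightarrow> bool" where
  "in_Lp \<Omega> r f \<longleftrightarrow> f \<in> borel_measurable (lebesgue_on \<Omega>) \<and>
     integrable (lebesgue_on \<Omega>) (\<lambda>x. norm (f x) powr r)"

definition is_weak_gradient ::
    "'a::euclidean_space set \<Rightarrow> ('a \<Rightarrow> real) \<Rightarrow> ('a \<Rightarrow> 'a) \<Rightarrow> bool" where
  "is_weak_gradient \<Omega> u V \<longleftrightarrow> loc_integrable \<Omega> u \<and> loc_integrable \<Omega> V \<and>
     (\<forall>\<phi>\<in>test_functions \<Omega>. \<forall>i\<in>Basis.
        (LINT x|lebesgue_on \<Omega>. u x * frechet_derivative \<phi> (at x) i) =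
        - (LINT x|lebesgue_on \<Omega>. (V x \<bullet> i) * \<phi> x))"

text \<open>The weak gradient is unique up to a Lebesgue null set; an arbitrary representative is
  chosen.\<close>

definition weak_gradient :: "'a::euclidean_space set \<Rightarrow> ('a \<Rightarrow> real) \<Rightarrow> 'a \<Rightarrow> 'a" where
  "weak_gradient \<Omega> u = (SOME V. is_weak_gradient \<Omega> u V)"

text \<open>Elements of the Sobolev spaces are represented by functions on the whole space whose values
  outside \<open>\<Omega>\<close> are irrelevant. Functions that agree almost everywhere in \<open>\<Omega>\<close> represent the same
  element, so identity of elements is \<open>ae_eq\<close> and \<open>sobolev_norm\<close> is a norm only up to \<open>ae_eq\<close>.\<close>

definition ae_eq :: "'a::euclidean_space set \<Rightarrow> ('a \<Rightarrow> real) \<Rightarrow> ('a \<Rightarrow> real) \<Rightarrow> bool" where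
  "ae_eq \<Omega> u v \<longleftrightarrow> (AE x in lebesgue_on \<Omega>. u x = v x)"

definition W1 :: "'a::euclidean_space set \<Rightarrow> real \<Rightarrow> ('a \<Rightarrow> real) set" where
  "W1 \<Omega> r = {u. in_Lp \<Omega> r u \<and> (\<exists>V. is_weak_gradient \<Omega> u V \<and> in_Lp \<Omega> r V)}"

definition sobolev_norm :: "'a::euclidean_space set \<Rightarrow> real \<Rightarrow> ('a \<Rightarrow> real) \<Rightarrow> real" where
  "sobolev_norm \<Omega> r u =
     (LINT x|lebesgue_on \<Omega>. \<bar>u x\<bar> powr r + norm (weak_gradient \<Omega> u x) powr r) powr (1 / r)"

definition W1_0 :: "'a::euclidean_space set \<Rightarrow> real \<Rightarrow> ('a \<Rightarrow> real) set" where
  "W1_0 \<Omega> r = {u \<in> W1 \<Omega> r.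
     \<forall>\<epsilon>>0. \<exists>\<phi>\<in>test_functions \<Omega>. sobolev_norm \<Omega> r (\<lambda>x. u x - \<phi> x) < \<epsilon>}"

text \<open>\<open>L\<close> is the Frechet derivative at \<open>u\<close> of the functional \<open>I\<close> on the function space \<open>X\<close> with
  (semi)norm \<open>N\<close>; in particular \<open>L\<close> belongs to the dual of \<open>X\<close>.\<close>

definition has_frechet_derivative_on ::
    "('a \<Rightarrow> real) set \<Rightarrow> (('a \<Rightarrow> real) \<Rightarrow> real) \<Rightarrow> (('a \<Rightarrow> real) \<Rightarrow> real) \<Rightarrow>
     ('a \<Rightarrow> real) \<Rightarrow> (('a \<Rightarrow> real) \<Rightarrow> real) \<Rightarrow> bool" where
  "has_frechet_derivative_on X N I u L \<longleftrightarrow>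
     (\<forall>v\<in>X. \<forall>w\<in>X. L (\<lambda>x. v x + w x) = L v + L w) \<and>
     (\<forall>v\<in>X. \<forall>c. L (\<lambda>x. c * v x) = c * L v) \<and>
     (\<exists>K. \<forall>v\<in>X. \<bar>L v\<bar> \<le> K * N v) \<and>
     (\<forall>\<epsilon>>0. \<exists>\<delta>>0. \<forall>v\<in>X. N v < \<delta> \<longrightarrow> \<bar>I (\<lambda>x. u x + v x) - I u - L v\<bar> \<le> \<epsilon> * N v)"

definition critical_point ::
    "'a::euclidean_space set \<Rightarrow> real \<Rightarrow> ('a \<Rightarrow> real) set \<Rightarrow> (('a \<Rightarrow> real) \<Rightarrow> real) \<Rightarrow>
     ('a \<Rightarrow> real) \<Rightarrow> bool" where
  "critical_point \<Omega> r X I u \<longleftrightarrow>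
     u \<in> X \<and> has_frechet_derivative_on X (sobolev_norm \<Omega> r) I u (\<lambda>_. 0)"

definition ae_nonneg :: "'a::euclidean_space set \<Rightarrow> ('a \<Rightarrow> real) \<Rightarrow> bool" where
  "ae_nonneg \<Omega> u \<longleftrightarrow> (AE x in lebesgue_on \<Omega>. 0 \<le> u x)"

definition caratheodory :: "'a::euclidean_space set \<Rightarrow> ('a \<Rightarrow> real \<Rightarrow> real) \<Rightarrow> bool" where
  "caratheodory \<Omega> g \<longleftrightarrow>
     (\<forall>t. (\<lambda>x. g x t) \<in> borel_measurable (lebesgue_on \<Omega>)) \<and>
     (AE x in lebesgue_on \<Omega>. continuous_on UNIV (g x))"

end

theory Submission
  imports Defs
begin

text \<open>For two positive critical points \<open>u\<close>, \<open>v\<close> join them by the curve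
  \<open>\<gamma>\<^sub>t = ((1 - t) u\<^sup>p + t v\<^sup>p)\<^sup>1\<^sup>/\<^sup>p\<close>. By Picone's inequality \<open>|\<nabla>\<gamma>\<^sub>t|\<^sup>p \<le> (1 - t) |\<nabla>u|\<^sup>p + t |\<nabla>v|\<^sup>p\<close>, and since
  \<open>H\<close> is convex and nondecreasing while \<open>s \<mapsto> G (x, s\<^sup>1\<^sup>/\<^sup>p)\<close> is concave by (ii), \<open>t \<mapsto> I (\<gamma>\<^sub>t)\<close> is convex. The
  two-sided comparison in (iii) gives \<open>\<parallel>\<gamma>\<^sub>t - u\<parallel> \<le> K t\<close> in \<open>X\<close>, so \<open>I (\<gamma>\<^sub>t) - I u = o(t)\<close> because \<open>u\<close> is critical,
  and likewise at \<open>v\<close>. Hence \<open>I\<close> is constant along the curve and all the pointwise inequalities are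
  equalities almost everywhere. Equality in Picone's inequality means \<open>\<nabla>u / u = \<nabla>v / v\<close>, that is
  \<open>\<nabla>(ln u - ln v) = 0\<close>, so \<open>u\<close> and \<open>v\<close> are proportional; equality for \<open>G\<close> gives \<open>u = v\<close> when \<open>G\<close> is strictly
  concave in this sense; equality for a strictly convex \<open>H\<close> gives \<open>|\<nabla>u| = |\<nabla>v|\<close>.\<close>

section \<open>Smooth functions\<close>

text \<open>Two obstacles shape the proof. The derivative of \<open>I\<close> vanishes against
  increments in \<open>X\<close>, and near t = 0 the increment \<open>\<gamma>\<^sub>t - u\<close>
  behaves like t (v^p - u^p) / (p u^(p-1)). This quotient can be controlled only because u and v are
  comparable: it is then bounded by a multiple of u, and its gradient by the gradients of u and v.
  For \<open>W1_0\<close> the increments must moreover be limits of test functions again, although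
  the power curve is not smooth where its arguments vanish; a regularised curve with uniformly
  bounded slopes mediates. The curve is evaluated at two parameters: t = 1 yields I u = I v, and t =
  1/2 turns the pointwise inequalities into equalities. Working with continuous representatives has
  two benefits. They are bounded on the compact closure, so G is integrable along the curve; and
  their mollifications converge uniformly on compact sets, which gives the chain rule for weak
  gradients, first for C^1 functions and then, by positivity, for powers and the logarithm.\<close>

lemma CkI:
  assumes "\<And>x. (f has_derivative f' x) (at x)" and "\<And>v. Ck k (\<lambda>x. f' x v)"
  shows "Ck (Suc k) f"
proof -
  have "frechet_derivative f (at x) = f' x" for x
    using frechet_derivative_at[OF assms(1)] by simp
  then show ?thesis
    using assms by (auto simp: differentiable_def)
qed

lemma Ck_Suc_has_derivative:
  "Ck (Suc k) f \<Longrightarrow> (f has_derivative frechet_derivative f (at x)) (at x)"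
  by (simp add: frechet_derivative_works)

lemma Ck_SucD: "Ck (Suc k) f \<Longrightarrow> Ck k f"
proof (induction k arbitrary: f)
  case 0
  then show ?case
    by (simp add: continuous_on_eq_continuous_at differentiable_imp_continuous_within)
next
  case (Suc k)
  then show ?case by (metis Ck.simps(2))
qed

lemma Ck_const: "Ck k (\<lambda>x. c)"
proof (induction k arbitrary: c)
  case (Suc k)
  show ?case by (rule CkI[where f'="\<lambda>x v. 0"]) (auto intro: Suc)
qed simp

lemma Ck_add: "Ck k f \<Longrightarrow> Ck k g \<Longrightarrow> Ck k (\<lambda>x. f x + g x)"
proof (induction k arbitrary: f g)
  case 0
  then show ?case by (auto intro: continuous_intros)
next
  case (Suc k)
  show ?case
    by (rule CkI, rule has_derivative_add[OF Ck_Suc_has_derivative[OF Suc.prems(1)]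
          Ck_Suc_has_derivative[OF Suc.prems(2)]]) (use Suc in auto)
qed

lemma Ck_mult: "Ck k f \<Longrightarrow> Ck k g \<Longrightarrow> Ck k (\<lambda>x. f x * g x)"
proof (induction k arbitrary: f g)
  case 0
  then show ?case by (auto intro: continuous_intros)
next
  case (Suc k)
  show ?case
    by (rule CkI, rule has_derivative_mult[OF Ck_Suc_has_derivative[OF Suc.prems(1)]
          Ck_Suc_has_derivative[OF Suc.prems(2)]], intro Ck_add Suc.IH)
       (use Suc.prems Ck_SucD[OF Suc.prems(1)] Ck_SucD[OF Suc.prems(2)] in auto)
qed

lemma Ck_inner: "Ck k (\<lambda>x::'a::euclidean_space. x \<bullet> v)"
proof (cases k)
  case 0
  then show ?thesis by (auto intro!: continuous_intros)
next
  case (Suc m)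
  show ?thesis unfolding Suc
    by (rule CkI[where f'="\<lambda>x h. h \<bullet> v"]) (auto intro: Ck_const derivative_eq_intros)
qed

lemma Ck_translation: "Ck k f \<Longrightarrow> Ck k (\<lambda>x. f (x - a))"
proof (induction k arbitrary: f)
  case 0
  then show ?case
    by (auto intro!: continuous_on_compose2[of UNIV f] continuous_intros)
next
  case (Suc k)
  have "((\<lambda>x. f (x - a)) has_derivative frechet_derivative f (at (x - a))) (at x)" for x
    by (rule has_derivative_compose[of "\<lambda>x. x - a" "\<lambda>h. h" x UNIV f,
        OF _ Ck_Suc_has_derivative[OF Suc.prems]]) (auto intro!: derivative_eq_intros)
  then show ?case
    by (rule CkI) (use Suc in auto)
qed

lemma smooth_funD:
  assumes "smooth_fun f"
  shows "continuous_on UNIV f" "(f has_derivative frechet_derivative f (at x)) (at x)"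
    "continuous_on UNIV (\<lambda>x. frechet_derivative f (at x) v)"
    "smooth_fun (\<lambda>x. frechet_derivative f (at x) v)"
proof -
  have "Ck k f" for k using assms by (simp add: smooth_fun_def)
  from this[of 0] this[of "Suc 0"] this[of "Suc _"] Ck_Suc_has_derivative[OF this]
  show "continuous_on UNIV f" "(f has_derivative frechet_derivative f (at x)) (at x)"
    "continuous_on UNIV (\<lambda>x. frechet_derivative f (at x) v)"
    "smooth_fun (\<lambda>x. frechet_derivative f (at x) v)"
    by (auto simp: smooth_fun_def)
qed

section \<open>A smooth bump from exp(-1/t)\<close>

text \<open>One term of the exponential series is at most the whole sum.\<close>

lemma power_le_fact_exp:
  fixes x :: real
  assumes "0 \<le> x"
  shows "x ^ n \<le> fact n * exp x"
proof -
  have s: "summable (\<lambda>k. x ^ k /\<^sub>R fact k)" and e: "(\<Sum>k. x ^ k /\<^sub>R fact k) = exp x"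
    using exp_converges[of x] by (auto simp: sums_iff)
  have "(\<Sum>k\<in>{n}. x ^ k /\<^sub>R fact k) \<le> exp x"
    unfolding e[symmetric] by (rule sum_le_suminf[OF s]) (use assms in auto)
  then show ?thesis by (simp add: field_simps)
qed

text \<open>The family is closed under differentiation up to linear combinations, so smoothness of all its members
  follows by one induction.\<close>

definition flat_exp :: "nat \<Rightarrow> real \<Rightarrow> real" where
  "flat_exp n t = (if t > 0 then exp (- inverse t) * inverse t ^ n else 0)"

text \<open>A power of 1/t is absorbed by exp(1/t). The exponent \<open>n + 2\<close> is absorbed
  instead of \<open>n\<close>, which leaves t^2, so that the difference quotient at 0 is still
  O(t).\<close>

lemma flat_exp_le:
  "\<bar>flat_exp n t\<bar> \<le> fact (n + 2) * t\<^sup>2"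
proof (cases "t > 0")
  case True
  have "inverse t ^ (n + 2) \<le> fact (n + 2) * exp (inverse t)"
    using True by (intro power_le_fact_exp) auto
  from mult_left_mono[OF this, of "exp (- inverse t)"]
  have "exp (- inverse t) * inverse t ^ (n + 2) \<le> fact (n + 2) * (exp (- inverse t) * exp (inverse t))"
    by (simp only: exp_ge_zero mult.left_commute simp_thms)
  then have "exp (- inverse t) * inverse t ^ (n + 2) * t\<^sup>2 \<le> fact (n + 2) * t\<^sup>2"
    by (intro mult_right_mono) (simp_all add: exp_minus del: fact_Suc)
  moreover have "inverse t ^ (n + 2) * t\<^sup>2 = inverse t ^ n"
    using True by (simp add: power2_eq_square field_simps)
  ultimately have "exp (- inverse t) * inverse t ^ n \<le> fact (n + 2) * t\<^sup>2"
    by (simp only: mult.assoc)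
  then show ?thesis
    using True by (simp add: flat_exp_def del: fact_Suc)
qed (simp add: flat_exp_def)

lemma has_derivative_flat_exp:
  "(flat_exp n has_real_derivative flat_exp (n + 2) t - real n * flat_exp (n + 1) t) (at t)"
proof -
  consider "t > 0" | "t < 0" | "t = 0" by linarith
  then show ?thesis
  proof cases
    case 1
    have "((\<lambda>t. exp (- inverse t) * inverse t ^ n) has_real_derivative
        flat_exp (n + 2) t - real n * flat_exp (n + 1) t) (at t)"
    proof (rule DERIV_cong)
      show "((\<lambda>t. exp (- inverse t) * inverse t ^ n) has_real_derivative
        exp (- inverse t) * inverse t ^ 2 * inverse t ^ n
        + exp (- inverse t) * (real n * (inverse t ^ (n - 1) * - (inverse t ^ 2)))) (at t)"
        using 1 by (auto intro!: derivative_eq_intros simp: power2_eq_square)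
      show "exp (- inverse t) * inverse t ^ 2 * inverse t ^ n
        + exp (- inverse t) * (real n * (inverse t ^ (n - 1) * - (inverse t ^ 2)))
        = flat_exp (n + 2) t - real n * flat_exp (n + 1) t"
        \<comment> \<open>For n = 0 the truncated \<open>n - 1\<close> is harmless, because its term
          carries the factor \<open>real n\<close>.\<close>
        using 1 by (cases n) (simp_all add: flat_exp_def power2_eq_square algebra_simps)
    qed
    then show ?thesis
      by (rule has_field_derivative_transform_within_open[of _ _ _ "{0<..}"])
         (use 1 in \<open>auto simp: flat_exp_def\<close>)
  next
    case 2
    have "((\<lambda>t. 0) has_real_derivative flat_exp (n + 2) t - real n * flat_exp (n + 1) t) (at t)"
      using 2 by (auto simp: flat_exp_def)
    then show ?thesis
      by (rule has_field_derivative_transform_within_open[of _ _ _ "{..<0}"])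
         (use 2 in \<open>auto simp: flat_exp_def\<close>)
  next
    case 3
    \<comment> \<open>At 0 both terms of the derivative formula vanish, so the difference quotient
      has to tend to 0.\<close>
    have "(\<lambda>h. flat_exp n h / h) \<midarrow>0\<rightarrow> 0"
    proof (rule Lim_null_comparison[OF always_eventually])
      show "\<forall>h. norm (flat_exp n h / h) \<le> fact (n + 2) * \<bar>h\<bar>"
      proof
        fix h :: real
        have "\<bar>flat_exp n h\<bar> / \<bar>h\<bar> \<le> fact (n + 2) * (\<bar>h\<bar> * \<bar>h\<bar>) / \<bar>h\<bar>"
          using flat_exp_le[of n h] by (intro divide_right_mono) (simp_all add: power2_eq_square del: fact_Suc)
        then show "norm (flat_exp n h / h) \<le> fact (n + 2) * \<bar>h\<bar>"
          by (cases "h = 0") (simp_all add: abs_mult_self_eq[of h, symmetric] del: fact_Suc abs_mult_self_eq)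
      qed
      show "(\<lambda>h. fact (n + 2) * \<bar>h\<bar>) \<midarrow>0\<rightarrow> (0::real)"
        by (auto intro!: tendsto_eq_intros)
    qed
    then show ?thesis
      using 3 by (simp add: DERIV_def flat_exp_def)
  qed
qed

text \<open>The induction runs over all \<open>n\<close> at once, because a derivative of the member
  \<open>n\<close> is a combination of the members \<open>n + 1\<close> and \<open>n + 2\<close>
  with coefficients that are linear in \<open>x\<close>.\<close>

lemma Ck_flat_exp_ball: "Ck k (\<lambda>x::'a::euclidean_space. flat_exp n (c - x \<bullet> x))"
proof (induction k arbitrary: n)
  case 0
  have "continuous_on UNIV (flat_exp n)"
    by (meson has_derivative_flat_exp DERIV_isCont continuous_at_imp_continuous_on)
  then show ?case
    by (auto intro!: continuous_on_compose2[of UNIV "flat_exp n"] continuous_intros)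
next
  case (Suc k)
  let ?d = "\<lambda>x. flat_exp (n + 2) (c - x \<bullet> x) - real n * flat_exp (n + 1) (c - x \<bullet> x)"
  have "((\<lambda>x. flat_exp n (c - x \<bullet> x)) has_derivative (\<lambda>v. (-2 * (x \<bullet> v)) * ?d x)) (at x)" for x :: 'a
    by (rule has_derivative_eq_rhs, rule has_derivative_compose[of _ _ _ _ "flat_exp n",
          OF _ has_derivative_flat_exp[unfolded has_field_derivative_def]])
       (auto intro!: derivative_eq_intros simp: inner_commute fun_eq_iff)
  then show ?case
  proof (rule CkI)
    show "Ck k (\<lambda>x. (-2 * (x \<bullet> v)) * ?d x)" for v :: 'a
      using Ck_mult[OF Ck_mult[OF Ck_const[of k "-2"] Ck_inner[of k v]] 
          Ck_add[OF Suc[of "n+2"] Ck_mult[OF Ck_const[of k "- real n"] Suc[of "n+1"]]]]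
      by simp
  qed
qed

section \<open>Mollification\<close>

definition Cc :: "('a::euclidean_space \<Rightarrow> real) \<Rightarrow> bool" where
  "Cc f \<longleftrightarrow> continuous_on UNIV f \<and> bounded {x. f x \<noteq> 0}"

text \<open>The whole space is traded for a box around the support, where continuity alone gives
  integrability, differentiation under the integral and exchange of the order of
  integration.\<close>

lemma integral_UNIV_eq_cbox:
  fixes f :: "'a::euclidean_space \<Rightarrow> 'b::banach"
  assumes "\<And>x. x \<notin> cbox a b \<Longrightarrow> f x = 0"
  shows "integral UNIV f = integral (cbox a b) f"
proof -
  have "integral UNIV f = integral UNIV (\<lambda>x. if x \<in> cbox a b then f x else 0)"
    by (rule arg_cong[where f="integral UNIV"]) (use assms in auto)
  then show ?thesis
    by (simp add: Henstock_Kurzweil_Integration.integral_restrict_UNIV)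
qed

lemma integrable_UNIV_iff_cbox:
  fixes f :: "'a::euclidean_space \<Rightarrow> 'b::banach"
  assumes "\<And>x. x \<notin> cbox a b \<Longrightarrow> f x = 0"
  shows "f integrable_on UNIV \<longleftrightarrow> f integrable_on cbox a b"
proof -
  have "f integrable_on UNIV \<longleftrightarrow> (\<lambda>x. if x \<in> cbox a b then f x else 0) integrable_on UNIV"
    by (rule arg_cong2[where f="(integrable_on)", OF _ refl]) (use assms in auto)
  also have "\<dots> \<longleftrightarrow> f integrable_on cbox a b"
    by (rule Henstock_Kurzweil_Integration.integrable_restrict_UNIV)
  finally show ?thesis .
qed

lemma bounded_support_cbox:
  fixes f :: "'a::euclidean_space \<Rightarrow> real"
  assumes "bounded {x. f x \<noteq> 0}"
  obtains a where "\<And>x. x \<notin> cbox (- a) a \<Longrightarrow> f x = 0"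
proof -
  obtain a where "{x. f x \<noteq> 0} \<subseteq> cbox (- a) a"
    using bounded_subset_cbox_symmetric[OF assms] by metis
  then show ?thesis by (intro that[of a]) auto
qed

lemma Cc_cbox:
  assumes "Cc f"
  obtains a where "\<And>x. x \<notin> cbox (- a) a \<Longrightarrow> f x = 0"
  by (rule bounded_support_cbox[of f]) (use assms that in \<open>auto simp: Cc_def\<close>)

lemma Cc_mult_left:
  assumes "Cc f" "continuous_on UNIV g" shows "Cc (\<lambda>x. f x * g x)"
proof -
  have "{x. f x * g x \<noteq> 0} \<subseteq> {x. f x \<noteq> 0}" by auto
  then show ?thesis
    using assms bounded_subset unfolding Cc_def by (auto intro!: continuous_on_mult)
qed

lemma Cc_mult_right: "Cc f \<Longrightarrow> continuous_on UNIV g \<Longrightarrow> Cc (\<lambda>x. g x * f x)"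
  using Cc_mult_left[of f g] by (simp add: mult.commute)

lemma Cc_integrable:
  assumes "Cc f" shows "f integrable_on UNIV"
proof -
  obtain a where a: "\<And>x. x \<notin> cbox (- a) a \<Longrightarrow> f x = 0" using Cc_cbox[OF assms] by metis
  have "f integrable_on cbox (- a) a"
    by (intro integrable_continuous) (use assms in \<open>auto simp: Cc_def intro: continuous_on_subset\<close>)
  then show ?thesis
    using integrable_UNIV_iff_cbox[of "- a" a f] a by blast
qed

lemma integral_UNIV_shift:
  fixes f :: "'a::euclidean_space \<Rightarrow> real"
  assumes "bounded {x. f x \<noteq> 0}"
  shows "integral UNIV (\<lambda>x. f (x + c)) = integral UNIV f"
proof -
  obtain a where a: "\<And>x. x \<notin> cbox (- a) a \<Longrightarrow> f x = 0"
    using bounded_support_cbox[OF assms] by metis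
  have "f (x + c) = 0" if "x \<notin> cbox (- a - c) (a - c)" for x
    using that by (intro a) (auto simp: mem_box algebra_simps)
  then have "integral UNIV (\<lambda>x. f (x + c)) = integral (cbox (- a - c) (a - c)) (\<lambda>x. f (x + c))"
    by (rule integral_UNIV_eq_cbox)
  moreover have "integral UNIV f = integral (cbox (- a) a) f"
    by (rule integral_UNIV_eq_cbox) (rule a)
  ultimately show ?thesis by (simp add: integral_shift_cbox)
qed

text \<open>By translation invariance the integral of f(y + s e) over y does not depend on s;
  differentiating under the integral at s = 0 gives the claim without splitting off a
  coordinate.\<close>

lemma integral_directional_derivative_zero:
  fixes f :: "'a::euclidean_space \<Rightarrow> real"
  assumes f: "\<And>x. (f has_derivative f' x) (at x)" and c: "continuous_on UNIV (\<lambda>x. f' x e)"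
    and "bounded {x. f x \<noteq> 0}"
  shows "integral UNIV (\<lambda>x. f' x e) = 0"
proof -
  have cf: "continuous_on UNIV f"
    by (meson f continuous_at_imp_continuous_on has_derivative_continuous)
  \<comment> \<open>Sweeping the support along the segment from -e to e gives one bounded set, hence
    one box, containing the supports of all translates with |s| \<le> 1.\<close>
  define S where "S = (\<Union>x\<in>{x. f x \<noteq> 0}. \<Union>y\<in>(\<lambda>s. s *\<^sub>R e) ` {-1..1::real}. {x + y})"
  have "bounded ((\<lambda>s. s *\<^sub>R e) ` {-1..1::real})"
    by (intro compact_imp_bounded[OF compact_continuous_image]) (auto intro!: continuous_intros)
  with assms(3) have "bounded S"
    unfolding S_def by (rule bounded_sums)
  then obtain a where a: "S \<subseteq> cbox (- a) a" using bounded_subset_cbox_symmetric by metis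
  have z: "f (y + s *\<^sub>R e) = 0" if "y \<notin> cbox (- a) a" "s \<in> {-1..1}" for y s
  proof (rule ccontr)
    assume "f (y + s *\<^sub>R e) \<noteq> 0"
    then have "(y + s *\<^sub>R e) + (- s) *\<^sub>R e \<in> S"
      unfolding S_def using that(2) by (intro UN_I[of "y + s *\<^sub>R e"] UN_I[of "(- s) *\<^sub>R e"] imageI) auto
    then show False using a that(1) by auto
  qed
  have deriv: "((\<lambda>s. f (y + s *\<^sub>R e)) has_field_derivative f' (y + s *\<^sub>R e) e) (at s within T)" for y s T
  proof -
    have "((\<lambda>s. f (y + s *\<^sub>R e)) has_derivative (\<lambda>h. f' (y + s *\<^sub>R e) (h *\<^sub>R e))) (at s within T)"
      by (rule has_derivative_compose[OF _ f]) (auto intro!: derivative_eq_intros)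
    then show ?thesis
      unfolding has_field_derivative_def
      by (rule has_derivative_eq_rhs)
        (use linear_scale[OF has_derivative_linear[OF f]] in \<open>auto simp: mult.commute\<close>)
  qed
  have d: "((\<lambda>s. integral (cbox (- a) a) (\<lambda>y. f (y + s *\<^sub>R e))) has_field_derivative
      integral (cbox (- a) a) (\<lambda>y. f' (y + 0 *\<^sub>R e) e)) (at 0 within {-1..1::real})"
    by (rule leibniz_rule_field_derivative[where fx="\<lambda>s y. f' (y + s *\<^sub>R e) e"])
       (auto intro!: deriv integrable_continuous continuous_on_compose2[OF cf]
          continuous_on_compose2[OF c] continuous_intros simp: split_beta)
  have i: "integral (cbox (- a) a) (\<lambda>y. f (y + s *\<^sub>R e)) = integral UNIV f"
    if "s \<in> {-1..1}" for s
  proof -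
    have 1: "integral UNIV (\<lambda>y. f (y + s *\<^sub>R e)) = integral (cbox (- a) a) (\<lambda>y. f (y + s *\<^sub>R e))"
      by (rule integral_UNIV_eq_cbox) (erule z[OF _ that])
    have 2: "integral UNIV (\<lambda>y. f (y + s *\<^sub>R e)) = integral UNIV f"
      by (rule integral_UNIV_shift[OF assms(3)])
    show ?thesis by (rule trans[OF 1[symmetric] 2])
  qed
  have "((\<lambda>s. integral UNIV f) has_field_derivative
      integral (cbox (- a) a) (\<lambda>y. f' (y + 0 *\<^sub>R e) e)) (at 0 within {-1..1::real})"
    unfolding has_field_derivative_def
    by (rule has_derivative_transform[OF _ i[symmetric] d[unfolded has_field_derivative_def]]) auto
  moreover have "at 0 within {-1..1::real} = at 0"
    by (rule at_within_interior) auto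
  ultimately have "integral (cbox (- a) a) (\<lambda>y. f' y e) = 0"
    using DERIV_unique[OF _ DERIV_const] by auto
  \<comment> \<open>Off the box f vanishes along a whole segment through \<open>y\<close> in
    direction \<open>e\<close>, so the integral over the box is the integral over the space.\<close>
  moreover have "f' y e = 0" if "y \<notin> cbox (- a) a" for y
  proof -
    have "((\<lambda>s. 0) has_field_derivative f' (y + 0 *\<^sub>R e) e) (at 0 within {-1..1::real})"
      unfolding has_field_derivative_def
      by (rule has_derivative_transform[OF _ _ deriv[of y 0 "{-1..1}", unfolded has_field_derivative_def]])
         (use z[OF that] in auto)
    then show ?thesis
      using DERIV_unique[OF _ DERIV_const] \<open>at 0 within {-1..1::real} = at 0\<close> by auto
  qed
  ultimately show ?thesis
    using integral_UNIV_eq_cbox[of "- a" a "\<lambda>y. f' y e"] by simp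
qed

section \<open>Convolution and mollifiers\<close>

definition conv :: "('a::euclidean_space \<Rightarrow> real) \<Rightarrow> ('a \<Rightarrow> real) \<Rightarrow> 'a \<Rightarrow> real" where
  "conv f \<rho> x = integral UNIV (\<lambda>y. f y * \<rho> (x - y))"

lemma continuous_on_diff_arg:
  "continuous_on UNIV \<rho> \<Longrightarrow> continuous_on UNIV (\<lambda>y::'a::euclidean_space. \<rho> (x - y))"
  by (rule continuous_on_compose2[of UNIV \<rho>]) (auto intro!: continuous_intros)

lemma Cc_conv_integrand:
  "Cc f \<Longrightarrow> continuous_on UNIV \<rho> \<Longrightarrow> Cc (\<lambda>y. f y * \<rho> (x - y))"
  by (intro Cc_mult_left continuous_on_diff_arg)

lemma continuous_on_conv:
  assumes "Cc f" "continuous_on UNIV \<rho>"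
  shows "continuous_on UNIV (conv f \<rho>)"
proof -
  obtain a where a: "\<And>x. x \<notin> cbox (- a) a \<Longrightarrow> f x = 0"
    using Cc_cbox[OF assms(1)] by metis
  have "continuous_on UNIV (\<lambda>x. integral (cbox (- a) a) (\<lambda>y. f y * \<rho> (x - y)))"
    using assms unfolding Cc_def
    by (intro integral_continuous_on_param)
       (auto intro!: continuous_on_compose2[of UNIV f] continuous_on_compose2[of UNIV \<rho>] continuous_intros
         simp: split_beta)
  moreover have "conv f \<rho> = (\<lambda>x. integral (cbox (- a) a) (\<lambda>y. f y * \<rho> (x - y)))"
    unfolding conv_def by (intro ext integral_UNIV_eq_cbox) (simp add: a)
  ultimately show ?thesis by simp
qed

lemma has_derivative_conv:
  fixes f \<rho> :: "'a::euclidean_space \<Rightarrow> real"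
  assumes f: "Cc f" and r: "\<And>z. (\<rho> has_derivative \<rho>' z) (at z)"
    and c: "\<And>v. continuous_on UNIV (\<lambda>z. \<rho>' z v)"
  shows "(conv f \<rho> has_derivative (\<lambda>v. conv f (\<lambda>z. \<rho>' z v) x)) (at x)"
proof -
  obtain a where a: "\<And>x. x \<notin> cbox (- a) a \<Longrightarrow> f x = 0"
    using Cc_cbox[OF f] by metis
  have cf: "continuous_on UNIV f" using f by (simp add: Cc_def)
  have cr: "continuous_on UNIV \<rho>"
    by (meson r continuous_at_imp_continuous_on has_derivative_continuous)
  \<comment> \<open>The Leibniz rule for total derivatives wants them as a continuous map into the
    bounded linear operators; in finite dimension this follows from continuity of each directional
    derivative.\<close>
  define D where "D z = Blinfun (\<rho>' z)" for z
  have D: "blinfun_apply (D z) = \<rho>' z" for z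
    unfolding D_def using bounded_linear_Blinfun_apply[OF has_derivative_bounded_linear[OF r]] .
  have cD: "continuous_on UNIV D"
    by (rule continuous_on_blinfun_componentwise) (simp add: D c)
  have e: "conv f h = (\<lambda>x. integral (cbox (- a) a) (\<lambda>y. f y * h (x - y)))" for h
    unfolding conv_def by (intro ext integral_UNIV_eq_cbox) (simp add: a)
  have cont: "continuous_on (UNIV \<times> cbox (- a) a) (\<lambda>(x, y). f y *\<^sub>R D (x - y))"
    by (auto intro!: continuous_on_compose2[OF cf] continuous_on_compose2[OF cD] continuous_intros
         simp: split_beta)
  have 1: "((\<lambda>x. integral (cbox (- a) a) (\<lambda>y. f y * \<rho> (x - y))) has_derivative
      blinfun_apply (integral (cbox (- a) a) (\<lambda>y. f y *\<^sub>R D (x - y)))) (at x within UNIV)"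
  proof (rule leibniz_rule[OF _ _ cont])
    fix x y :: 'a
    have "((\<lambda>x. \<rho> (x - y)) has_derivative \<rho>' (x - y)) (at x)"
      by (rule has_derivative_compose[of "\<lambda>x. x - y" "\<lambda>h. h", OF _ r])
         (auto intro!: derivative_eq_intros)
    then show "((\<lambda>x. f y * \<rho> (x - y)) has_derivative blinfun_apply (f y *\<^sub>R D (x - y))) (at x within UNIV)"
      by (auto intro!: derivative_eq_intros simp: D blinfun.scaleR_left fun_eq_iff)
  next
    show "(\<lambda>y. f y * \<rho> (x - y)) integrable_on cbox (- a) a" for x
      by (intro integrable_continuous continuous_on_mult continuous_on_subset[OF cf]
          continuous_on_subset[OF continuous_on_diff_arg[OF cr]]) auto
  qed auto
  have 2: "blinfun_apply (integral (cbox (- a) a) (\<lambda>y. f y *\<^sub>R D (x - y))) v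
      = conv f (\<lambda>z. \<rho>' z v) x" for v
  proof -
    have "(\<lambda>y. f y *\<^sub>R D (x - y)) integrable_on cbox (- a) a"
      by (intro integrable_continuous) (auto intro!: continuous_on_compose2[OF cf]
          continuous_on_compose2[OF cD] continuous_intros)
    from integral_linear[OF this blinfun.bounded_linear_left[of v]]
    show ?thesis by (simp add: e o_def blinfun.scaleR_left D)
  qed
  show ?thesis
    unfolding e[of \<rho>] by (rule has_derivative_eq_rhs) (use 1 2 in \<open>auto simp: fun_eq_iff\<close>)
qed

text \<open>Every derivative is taken on the kernel, so a merely continuous \<open>f\<close> becomes
  as smooth as \<open>\<rho>\<close>.\<close>

lemma Ck_conv:
  assumes "Cc f" "Ck k \<rho>"
  shows "Ck k (conv f \<rho>)"
  using assms(2)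
proof (induction k arbitrary: \<rho>)
  case 0
  then show ?case using continuous_on_conv[OF assms(1)] by simp
next
  case (Suc k)
  have "continuous_on UNIV (\<lambda>x. frechet_derivative \<rho> (at x) v)" for v
  proof -
    have "Ck k g \<Longrightarrow> continuous_on UNIV g" for g :: "'a \<Rightarrow> real"
      by (induction k) (auto dest: Ck_SucD simp del: Ck.simps(2))
    then show ?thesis using Suc.prems by simp
  qed
  then show ?case
    by (intro CkI[OF has_derivative_conv[OF assms(1) Ck_Suc_has_derivative[OF Suc.prems]]])
       (use Suc in auto)
qed

lemma conv_eq_0:
  assumes "\<And>z. \<epsilon> \<le> norm z \<Longrightarrow> \<rho> z = 0" "\<And>y. f y \<noteq> 0 \<Longrightarrow> \<epsilon> \<le> dist x y"
  shows "conv f \<rho> x = 0"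
proof -
  have "(\<lambda>y. f y * \<rho> (x - y)) = (\<lambda>y. 0)"
    using assms by (auto simp: fun_eq_iff dist_norm)
  then show ?thesis by (simp add: conv_def)
qed

text \<open>Exchanging the order of integration moves the kernel to the other factor, with its
  argument reflected. Both supports are bounded, so everything happens on a product of two
  boxes.\<close>

lemma integral_conv_swap:
  assumes "Cc \<psi>" "Cc f" "continuous_on UNIV \<sigma>"
  shows "integral UNIV (\<lambda>x. \<psi> x * conv f \<sigma> x) = integral UNIV (\<lambda>y. f y * integral UNIV (\<lambda>x. \<psi> x * \<sigma> (x - y)))"
proof -
  obtain a where a: "\<And>x. x \<notin> cbox (- a) a \<Longrightarrow> f x = 0"
    using Cc_cbox[OF assms(2)] by metis
  obtain b where b: "\<And>x. x \<notin> cbox (- b) b \<Longrightarrow> \<psi> x = 0"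
    using Cc_cbox[OF assms(1)] by metis
  have "integral UNIV (\<lambda>x. \<psi> x * conv f \<sigma> x) =
      integral (cbox (- b) b) (\<lambda>x. integral (cbox (- a) a) (\<lambda>y. \<psi> x * (f y * \<sigma> (x - y))))"
    by (subst integral_UNIV_eq_cbox[of "- b" b])
       (auto simp: b a conv_def integral_UNIV_eq_cbox[of "- a" a]
        Henstock_Kurzweil_Integration.integral_mult_right[symmetric]
        simp del: Henstock_Kurzweil_Integration.integral_mult_right)
  also have "\<dots> = integral (cbox (- a) a) (\<lambda>y. integral (cbox (- b) b) (\<lambda>x. \<psi> x * (f y * \<sigma> (x - y))))"
    using assms unfolding Cc_def
    by (intro integral_swap_continuous)
       (auto intro!: continuous_on_compose2[of UNIV f] continuous_on_compose2[of UNIV \<psi>]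
          continuous_on_compose2[of UNIV \<sigma>] continuous_intros simp: split_beta)
  also have "\<dots> = integral (cbox (- a) a) (\<lambda>y. f y * integral (cbox (- b) b) (\<lambda>x. \<psi> x * \<sigma> (x - y)))"
    by (simp flip: Henstock_Kurzweil_Integration.integral_mult_right add: mult.left_commute)
  also have "\<dots> = integral UNIV (\<lambda>y. f y * integral UNIV (\<lambda>x. \<psi> x * \<sigma> (x - y)))"
    by (subst integral_UNIV_eq_cbox[of "- a" a])
       (auto simp: b a integral_UNIV_eq_cbox[of "- b" b])
  finally show ?thesis .
qed

text \<open>The directional derivative of the product integrates to zero. Bounded support is asked
  of \<open>f\<close> alone; the partner \<open>g\<close> may be a translated kernel or a function
  of a mollification.\<close>

lemma integral_by_parts_directional:
  fixes f g :: "'a::euclidean_space \<Rightarrow> real"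
  assumes f: "\<And>x. (f has_derivative f' x) (at x)" "continuous_on UNIV (\<lambda>x. f' x e)"
    and g: "\<And>x. (g has_derivative g' x) (at x)" "continuous_on UNIV (\<lambda>x. g' x e)"
    and b: "bounded {x. f x \<noteq> 0}" "bounded {x. f' x e \<noteq> 0}"
  shows "integral UNIV (\<lambda>x. f' x e * g x) = - integral UNIV (\<lambda>x. f x * g' x e)"
proof -
  have c: "continuous_on UNIV f" "continuous_on UNIV g"
    by (meson f g continuous_at_imp_continuous_on has_derivative_continuous)+
  have "integral UNIV (\<lambda>x. (\<lambda>v. f x * g' x v + f' x v * g x) e) = 0"
  proof (rule integral_directional_derivative_zero)
    show "((\<lambda>x. f x * g x) has_derivative (\<lambda>v. f x * g' x v + f' x v * g x)) (at x)" for x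
      by (rule has_derivative_mult[OF f(1) g(1)])
    show "bounded {x. f x * g x \<noteq> 0}"
      by (rule bounded_subset[OF b(1)]) auto
  qed (intro continuous_intros c f g)
  moreover have "integral UNIV (\<lambda>x. f x * g' x e + f' x e * g x)
      = integral UNIV (\<lambda>x. f x * g' x e) + integral UNIV (\<lambda>x. f' x e * g x)"
    by (intro Henstock_Kurzweil_Integration.integral_add Cc_integrable Cc_mult_left)
       (use b c f g in \<open>auto simp: Cc_def\<close>)
  ultimately show ?thesis by simp
qed

text \<open>Evenness is built in because it turns the reflected kernel of
  \<open>integral_conv_swap\<close> back into a convolution; the derivative of the kernel is then
  odd, which accounts for exactly one change of sign.\<close>

definition mollifier :: "real \<Rightarrow> ('a::euclidean_space \<Rightarrow> real) \<Rightarrow> bool" where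
  "mollifier \<epsilon> \<rho> \<longleftrightarrow> smooth_fun \<rho> \<and> (\<forall>x. 0 \<le> \<rho> x) \<and> (\<forall>x. \<rho> (- x) = \<rho> x) \<and>
     (\<forall>x. \<epsilon> \<le> norm x \<longrightarrow> \<rho> x = 0) \<and> integral UNIV \<rho> = 1"

lemma support_subset_cball_diff:
  fixes \<rho> :: "'a::euclidean_space \<Rightarrow> real"
  assumes "\<And>x. \<epsilon> \<le> norm x \<Longrightarrow> \<rho> x = 0"
  shows "{y. \<rho> (x - y) \<noteq> 0} \<subseteq> cball x \<epsilon>"
proof
  fix y assume "y \<in> {y. \<rho> (x - y) \<noteq> 0}"
  then have "\<not> \<epsilon> \<le> norm (x - y)" using assms[of "x - y"] by blast
  then show "y \<in> cball x \<epsilon>" by (simp add: dist_norm)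
qed

lemma support_subset_cball:
  fixes \<rho> :: "'a::euclidean_space \<Rightarrow> real"
  assumes "\<And>x. \<epsilon> \<le> norm x \<Longrightarrow> \<rho> x = 0"
  shows "{x. \<rho> x \<noteq> 0} \<subseteq> cball 0 \<epsilon>"
proof
  fix y assume "y \<in> {x. \<rho> x \<noteq> 0}"
  then have "\<not> \<epsilon> \<le> norm y" using assms[of y] by blast
  then show "y \<in> cball 0 \<epsilon>" by simp
qed

lemma mollifier_imp_Cc: "mollifier \<epsilon> \<rho> \<Longrightarrow> Cc \<rho>"
proof -
  assume r: "mollifier \<epsilon> \<rho>"
  have "{x. \<rho> x \<noteq> 0} \<subseteq> cball 0 \<epsilon>"
    by (rule support_subset_cball) (use r in \<open>auto simp: mollifier_def\<close>)
  then show "Cc \<rho>"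
    using r bounded_subset[OF bounded_cball] smooth_funD(1)[of \<rho>] by (auto simp: Cc_def mollifier_def)
qed

lemma mollifier_exists:
  assumes "0 < \<epsilon>"
  shows "\<exists>\<rho>::'a::euclidean_space \<Rightarrow> real. mollifier \<epsilon> \<rho>"
proof -
  define b where "b x = flat_exp 0 (\<epsilon>\<^sup>2 - x \<bullet> x)" for x :: 'a
  have Ckb: "Ck k b" for k
    unfolding b_def[abs_def] by (rule Ck_flat_exp_ball)
  have b0: "b x = 0" if "\<epsilon> \<le> norm x" for x
    using power_mono[OF that, of 2] assms by (simp add: b_def flat_exp_def power2_norm_eq_inner)
  have pos: "0 \<le> b x" for x by (simp add: b_def flat_exp_def)
  have "{x. b x \<noteq> 0} \<subseteq> cball 0 \<epsilon>"
    by (rule support_subset_cball) (rule b0)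
  then have "Cc b"
    using Ckb[of 0] bounded_subset[OF bounded_cball] by (auto simp: Cc_def)
  \<comment> \<open>A continuous nonnegative function with zero integral over a nondegenerate box
    vanishes on it, whereas \<open>b 0\<close> is positive.\<close>
  have "integral UNIV b > 0"
  proof (rule ccontr)
    assume "\<not> integral UNIV b > 0"
    moreover have "integral UNIV b \<ge> 0"
      by (rule Henstock_Kurzweil_Integration.integral_nonneg[OF Cc_integrable[OF \<open>Cc b\<close>]]) (use pos in auto)
    ultimately have i0: "integral UNIV b = 0" by simp
    \<comment> \<open>The radius serves two purposes: \<open>\<epsilon>\<close> encloses the support
      of \<open>b\<close>, and 1 encloses the basis vectors, which makes the box
      nondegenerate.\<close>
    obtain a where a: "cball 0 (max 1 \<epsilon>) \<subseteq> cbox (- a) (a::'a)"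
      using bounded_subset_cbox_symmetric[OF bounded_cball] by metis
    have z: "b x = 0" if "x \<notin> cbox (- a) a" for x
      using that a by (intro b0) (auto simp: subset_iff not_le less_max_iff_disj intro: ccontr)
    have int: "(b has_integral 0) (cbox (- a) a)"
      using i0 integral_UNIV_eq_cbox[of "- a" a b] z Cc_integrable[OF \<open>Cc b\<close>]
        integrable_UNIV_iff_cbox[of "- a" a b]
      by (metis Henstock_Kurzweil_Integration.integrable_integral)
    have "box (- a) a \<noteq> {}"
    proof -
      have "0 < a \<bullet> i" if "i \<in> Basis" for i
      proof -
        have "i \<in> cball 0 (max 1 \<epsilon>)" using that by simp
        then have "i \<in> cbox (- a) a" using a by blast
        then show ?thesis using that by (force simp: mem_box)
      qed
      then show ?thesis by (simp add: box_ne_empty)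
    qed
    then have "b 0 = 0"
    proof -
      have "(0::'a) \<in> cbox (- a) a" using a by auto
      moreover have "continuous_on (cbox (- a) a) b"
        using Ckb[of 0] by (auto intro: continuous_on_subset)
      ultimately show ?thesis
        using has_integral_0_cbox_imp_0[OF _ _ int \<open>box (- a) a \<noteq> {}\<close>] pos by blast
    qed
    then show False using assms by (simp add: b_def flat_exp_def)
  qed
  moreover have "b (- x) = b x" for x by (simp add: b_def)
  ultimately have "mollifier \<epsilon> (\<lambda>x. inverse (integral UNIV b) * b x)"
    unfolding mollifier_def smooth_fun_def
    using Ck_mult[OF Ck_const Ckb] pos b0 by auto
  then show ?thesis by blast
qed

lemma mollifier_integral_diff:
  assumes "mollifier \<epsilon> \<rho>" shows "integral UNIV (\<lambda>y. \<rho> (x - y)) = 1"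
proof -
  have "\<rho> (x - y) = \<rho> (y + (- x))" for y
    using assms unfolding mollifier_def by (metis add_uminus_conv_diff minus_diff_eq)
  then show ?thesis
    using integral_UNIV_shift[of \<rho> "- x"] mollifier_imp_Cc[OF assms] assms
    by (simp add: Cc_def mollifier_def)
qed

text \<open>Convolution with a mollifier is a weighted mean of the values of \<open>f\<close> within
  distance \<open>\<epsilon>\<close>. The constant \<open>c\<close> is left free:
  \<open>c = f x\<close> gives convergence, \<open>c = 0\<close> a bound on the supremum, and the
  chain rule takes for \<open>c\<close> the value of a limit while \<open>f\<close> varies.\<close>

lemma conv_approx:
  assumes f: "Cc f" and r: "mollifier \<epsilon> \<rho>"
    and e: "\<And>y. dist x y < \<epsilon> \<Longrightarrow> \<bar>f y - c\<bar> \<le> e" "0 \<le> e"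
  shows "\<bar>conv f \<rho> x - c\<bar> \<le> e"
proof -
  have cr: "continuous_on UNIV \<rho>" using mollifier_imp_Cc[OF r] by (simp add: Cc_def)
  have i1: "(\<lambda>y. f y * \<rho> (x - y)) integrable_on UNIV"
    by (intro Cc_integrable Cc_conv_integrand f cr)
  have "Cc (\<lambda>y. \<rho> (x - y))"
  proof -
    have "{y. \<rho> (x - y) \<noteq> 0} \<subseteq> cball x \<epsilon>"
      by (rule support_subset_cball_diff) (use r in \<open>auto simp: mollifier_def\<close>)
    then show ?thesis
      using continuous_on_diff_arg[OF cr] bounded_subset[OF bounded_cball] by (auto simp: Cc_def)
  qed
  then have i2: "(\<lambda>y. \<rho> (x - y)) integrable_on UNIV" by (rule Cc_integrable)
  have "conv f \<rho> x - c = integral UNIV (\<lambda>y. f y * \<rho> (x - y)) - integral UNIV (\<lambda>y. c * \<rho> (x - y))"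
    by (simp add: conv_def mollifier_integral_diff[OF r])
  also have "\<dots> = integral UNIV (\<lambda>y. f y * \<rho> (x - y) - c * \<rho> (x - y))"
    by (rule Henstock_Kurzweil_Integration.integral_diff[symmetric, OF i1 integrable_on_mult_right[OF i2]])
  also have "norm \<dots> \<le> integral UNIV (\<lambda>y. e * \<rho> (x - y))"
  proof (rule Henstock_Kurzweil_Integration.integral_norm_bound_integral)
    show "(\<lambda>y. f y * \<rho> (x - y) - c * \<rho> (x - y)) integrable_on UNIV"
      by (rule Henstock_Kurzweil_Integration.integrable_diff[OF i1 integrable_on_mult_right[OF i2]])
    show "(\<lambda>y. e * \<rho> (x - y)) integrable_on UNIV"
      by (rule integrable_on_mult_right[OF i2])
    show "norm (f y * \<rho> (x - y) - c * \<rho> (x - y)) \<le> e * \<rho> (x - y)" for y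
    proof (cases "dist x y < \<epsilon>")
      case True
      then show ?thesis
        using mult_right_mono[OF e(1)[OF True], of "\<rho> (x - y)"] r
        by (simp add: mollifier_def abs_mult left_diff_distrib[symmetric])
    next
      case False
      then have "\<rho> (x - y) = 0" using r by (simp add: mollifier_def dist_norm)
      then show ?thesis by simp
    qed
  qed
  also have "\<dots> = e" by (simp add: mollifier_integral_diff[OF r])
  finally show ?thesis by simp
qed

text \<open>Two minus signs cancel, one from the integration by parts and one from the argument
  \<open>x - y\<close> of the kernel.\<close>

lemma conv_derivative_swap:
  fixes f \<rho> :: "'a::euclidean_space \<Rightarrow> real"
  assumes f: "\<And>x. (f has_derivative f' x) (at x)" "continuous_on UNIV (\<lambda>x. f' x v)"
    and r: "\<And>x. (\<rho> has_derivative \<rho>' x) (at x)" "continuous_on UNIV (\<lambda>x. \<rho>' x v)"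
    and b: "bounded {x. f x \<noteq> 0}" "bounded {x. f' x v \<noteq> 0}"
  shows "conv f (\<lambda>z. \<rho>' z v) x = conv (\<lambda>y. f' y v) \<rho> x"
proof -
  have "((\<lambda>y. \<rho> (x - y)) has_derivative (\<lambda>h. \<rho>' (x - y) (- h))) (at y)" for y
    by (rule has_derivative_compose[of "\<lambda>y. x - y" "\<lambda>h. - h", OF _ r(1)])
       (auto intro!: derivative_eq_intros)
  moreover have "\<rho>' z (- h) = - \<rho>' z h" for z h
    using linear_neg[OF has_derivative_linear[OF r(1)]] .
  ultimately have d: "((\<lambda>y. \<rho> (x - y)) has_derivative (\<lambda>h. - \<rho>' (x - y) h)) (at y)" for y
    by simp
  show ?thesis
    using integral_by_parts_directional[OF f d _ b] continuous_on_diff_arg[OF r(2)]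
    by (simp add: conv_def continuous_on_minus)
qed

section \<open>Test functions and the fundamental lemma\<close>

text \<open>A compact witness \<open>K\<close> in place of the closure of the support is easy to
  enlarge: a derivative vanishes off the same \<open>K\<close>, a convolution off a closed
  neighbourhood of it.\<close>

definition Cc_in :: "'a::euclidean_space set \<Rightarrow> ('a \<Rightarrow> real) \<Rightarrow> bool" where
  "Cc_in \<Omega> f \<longleftrightarrow> continuous_on UNIV f \<and> (\<exists>K. compact K \<and> K \<subseteq> \<Omega> \<and> (\<forall>x. x \<notin> K \<longrightarrow> f x = 0))"

lemma Cc_inI:
  "continuous_on UNIV f \<Longrightarrow> compact K \<Longrightarrow> K \<subseteq> \<Omega> \<Longrightarrow> (\<And>x. x \<notin> K \<Longrightarrow> f x = 0) \<Longrightarrow> Cc_in \<Omega> f"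
  unfolding Cc_in_def by blast

lemma Cc_inE:
  assumes "Cc_in \<Omega> f"
  obtains K where "compact K" "K \<subseteq> \<Omega>" "\<And>x. x \<notin> K \<Longrightarrow> f x = 0"
  using assms unfolding Cc_in_def by metis

lemma Cc_in_imp_Cc:
  assumes "Cc_in \<Omega> f" shows "Cc f"
proof -
  obtain K where K: "compact K" "K \<subseteq> \<Omega>" "\<And>x. x \<notin> K \<Longrightarrow> f x = 0"
    using Cc_inE[OF assms] by metis
  have "{x. f x \<noteq> 0} \<subseteq> K" using K(3) by auto
  then show ?thesis
    using assms bounded_subset[OF compact_imp_bounded[OF K(1)]] by (simp add: Cc_def Cc_in_def)
qed

lemma Cc_in_outside: "Cc_in \<Omega> f \<Longrightarrow> x \<notin> \<Omega> \<Longrightarrow> f x = 0"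
  unfolding Cc_in_def by blast

lemma test_functions_iff: "\<phi> \<in> test_functions \<Omega> \<longleftrightarrow> smooth_fun \<phi> \<and> Cc_in \<Omega> \<phi>"
proof
  assume p: "\<phi> \<in> test_functions \<Omega>"
  have "\<phi> x = 0" if "x \<notin> closure {x. \<phi> x \<noteq> 0}" for x
    using that closure_subset[of "{x. \<phi> x \<noteq> 0}"] by auto
  moreover have "smooth_fun \<phi>" "compact (closure {x. \<phi> x \<noteq> 0})" "closure {x. \<phi> x \<noteq> 0} \<subseteq> \<Omega>"
    using p by (simp_all add: test_functions_def)
  ultimately show "smooth_fun \<phi> \<and> Cc_in \<Omega> \<phi>"
    using Cc_inI[OF smooth_funD(1)] by blast
next
  assume p: "smooth_fun \<phi> \<and> Cc_in \<Omega> \<phi>"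
  then obtain K where K: "compact K" "K \<subseteq> \<Omega>" "\<And>x. x \<notin> K \<Longrightarrow> \<phi> x = 0"
    using Cc_inE[of \<Omega> \<phi>] by metis
  have "closure {x. \<phi> x \<noteq> 0} \<subseteq> K"
    using K by (intro closure_minimal compact_imp_closed) auto
  moreover from this have "compact (closure {x. \<phi> x \<noteq> 0})"
    using bounded_subset[OF compact_imp_bounded[OF K(1)]] by (simp add: compact_eq_bounded_closed)
  ultimately show "\<phi> \<in> test_functions \<Omega>"
    using p K(2) by (simp add: test_functions_def subset_trans)
qed

lemma has_derivative_zero_outside:
  assumes "(f has_derivative f') (at x)" "closed K" "x \<notin> K" "\<And>y. y \<notin> K \<Longrightarrow> f y = 0"
  shows "f' = (\<lambda>v. 0)"
proof -
  have "((\<lambda>x. 0) has_derivative f') (at x)"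
    by (rule has_derivative_transform_within_open[OF assms(1), of "- K"]) (use assms in auto)
  then show ?thesis
    using has_derivative_unique[OF _ has_derivative_const] by blast
qed

lemma frechet_derivative_zero_outside:
  assumes "(f has_derivative frechet_derivative f (at x)) (at x)" "compact K" "x \<notin> K" "\<And>y. y \<notin> K \<Longrightarrow> f y = 0"
  shows "frechet_derivative f (at x) = (\<lambda>v. 0)"
  by (rule has_derivative_zero_outside[OF assms(1) compact_imp_closed[OF assms(2)] assms(3)]) (rule assms(4))

lemma Cc_in_derivative:
  assumes "Cc_in \<Omega> f" "\<And>x. (f has_derivative f' x) (at x)" "continuous_on UNIV (\<lambda>x. f' x v)"
  shows "Cc_in \<Omega> (\<lambda>x. f' x v)"
proof -
  obtain K where K: "compact K" "K \<subseteq> \<Omega>" "\<And>x. x \<notin> K \<Longrightarrow> f x = 0"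
    using Cc_inE[OF assms(1)] by metis
  show ?thesis
    by (rule Cc_inI[OF assms(3) K(1,2)])
       (use has_derivative_zero_outside[OF assms(2) compact_imp_closed[OF K(1)] _ K(3)] in simp)
qed

lemma test_functionsD:
  assumes "\<phi> \<in> test_functions \<Omega>"
  shows "Cc_in \<Omega> \<phi>" "(\<phi> has_derivative frechet_derivative \<phi> (at x)) (at x)"
    "continuous_on UNIV (\<lambda>x. frechet_derivative \<phi> (at x) v)"
    "Cc_in \<Omega> (\<lambda>x. frechet_derivative \<phi> (at x) v)"
  using assms smooth_funD[of \<phi>] Cc_in_derivative[of \<Omega> \<phi> "\<lambda>x. frechet_derivative \<phi> (at x)" v]
  by (auto simp: test_functions_iff)

text \<open>The neighbourhood is the image of \<open>K\<close> times a ball under addition.\<close>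

lemma compact_nbhd:
  fixes K :: "'a::euclidean_space set"
  assumes "compact K" shows "compact (\<Union>x\<in>K. cball x d)"
proof -
  have "(\<Union>x\<in>K. cball x d) = (\<lambda>(x, y). x + y) ` (K \<times> cball 0 d)"
  proof (intro equalityI subsetI)
    fix z assume "z \<in> (\<Union>x\<in>K. cball x d)"
    then obtain x where "x \<in> K" "dist x z \<le> d" by auto
    then show "z \<in> (\<lambda>(x, y). x + y) ` (K \<times> cball 0 d)"
      by (intro image_eqI[of _ _ "(x, z - x)"]) (auto simp: dist_norm norm_minus_commute)
  next
    fix z assume "z \<in> (\<lambda>(x, y). x + y) ` (K \<times> cball 0 d)"
    then obtain a b where "a \<in> K" "norm b \<le> d" "z = a + b" by auto
    then show "z \<in> (\<Union>x\<in>K. cball x d)" by (intro UN_I[of a]) (auto simp: dist_norm)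
  qed
  moreover have "compact ((\<lambda>(x, y). x + y) ` (K \<times> cball 0 d))"
    by (intro compact_continuous_image compact_Times assms compact_cball)
       (auto intro!: continuous_intros simp: split_beta)
  ultimately show ?thesis by simp
qed

lemma Cc_in_conv:
  assumes f: "Cc f" "\<And>x. x \<notin> K \<Longrightarrow> f x = 0" and K: "compact K" "(\<Union>x\<in>K. cball x \<epsilon>) \<subseteq> \<Omega>"
    and r: "mollifier \<epsilon> \<rho>"
  shows "conv f \<rho> \<in> test_functions \<Omega>" "\<And>x. x \<notin> (\<Union>x\<in>K. cball x \<epsilon>) \<Longrightarrow> conv f \<rho> x = 0"
proof -
  have *: "conv f \<rho> x = 0" if "x \<notin> (\<Union>x\<in>K. cball x \<epsilon>)" for x
  proof (rule conv_eq_0)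
    show "\<epsilon> \<le> norm z \<Longrightarrow> \<rho> z = 0" for z using r by (simp add: mollifier_def)
    show "\<epsilon> \<le> dist x y" if "f y \<noteq> 0" for y
    proof -
      have "y \<in> K" using f(2) that by blast
      then show ?thesis using \<open>x \<notin> _\<close> by (auto simp: dist_commute)
    qed
  qed
  then show "\<And>x. x \<notin> (\<Union>x\<in>K. cball x \<epsilon>) \<Longrightarrow> conv f \<rho> x = 0" .
  have "smooth_fun (conv f \<rho>)"
    using r Ck_conv[OF f(1)] by (simp add: smooth_fun_def mollifier_def)
  moreover have "Cc_in \<Omega> (conv f \<rho>)"
    using smooth_funD(1)[OF calculation] compact_nbhd[OF K(1)] K(2) * by (rule Cc_inI)
  ultimately show "conv f \<rho> \<in> test_functions \<Omega>" by (simp add: test_functions_iff)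
qed

section \<open>Lebesgue integrals against compactly supported functions\<close>

lemma Cc_integrable_lebesgue:
  assumes "Cc f" shows "integrable lebesgue f" "(LINT x|lebesgue. f x) = integral UNIV f"
proof -
  obtain a where a: "\<And>x. x \<notin> cbox (- a) a \<Longrightarrow> f x = 0"
    using Cc_cbox[OF assms] by metis
  have "f absolutely_integrable_on cbox (- a) a"
    using assms unfolding Cc_def by (intro absolutely_integrable_continuous) (auto intro: continuous_on_subset)
  moreover have "(\<lambda>x. indicat_real (cbox (- a) a) x *\<^sub>R f x) = f"
    using a by (auto simp: fun_eq_iff indicator_def)
  ultimately show "integrable lebesgue f" by (simp add: set_integrable_def)
  then show "(LINT x|lebesgue. f x) = integral UNIV f"
    by (rule integral_lebesgue[symmetric])
qed

lemma LINT_lebesgue_on_eq_integral: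
  assumes "Cc f" "\<And>x. x \<notin> \<Omega> \<Longrightarrow> f x = 0" "\<Omega> \<in> sets lebesgue"
  shows "(LINT x|lebesgue_on \<Omega>. f x) = integral UNIV f"
proof -
  have "(\<lambda>x. indicat_real \<Omega> x *\<^sub>R f x) = f"
    using assms(2) by (auto simp: fun_eq_iff indicator_def)
  then show ?thesis
    using Cc_integrable_lebesgue(2)[OF assms(1)] assms(3)
    by (simp add: integral_restrict_space)
qed

lemma Cc_bounded:
  assumes "Cc f" obtains M where "0 \<le> M" "\<And>x. \<bar>f x\<bar> \<le> M"
proof -
  obtain a where a: "\<And>x. x \<notin> cbox (- a) a \<Longrightarrow> f x = 0"
    using Cc_cbox[OF assms] by metis
  have "bounded (f ` cbox (- a) a)"
    using assms unfolding Cc_def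
    by (intro compact_imp_bounded compact_continuous_image) (auto intro: continuous_on_subset)
  then obtain M where "\<forall>x\<in>cbox (- a) a. \<bar>f x\<bar> \<le> M" "0 < M"
    unfolding bounded_pos by auto
  then show ?thesis using a by (intro that[of M]) (metis abs_zero less_imp_le)+
qed

lemma Cc_uniformly_continuous:
  fixes f :: "'a::euclidean_space \<Rightarrow> real"
  assumes "Cc f" "0 < e"
  obtains d where "0 < d" "\<And>x y. dist x y < d \<Longrightarrow> \<bar>f y - f x\<bar> < e"
proof -
  obtain B where "\<forall>x\<in>{x. f x \<noteq> 0}. norm x \<le> B"
    using assms(1) unfolding Cc_def bounded_iff by metis
  then have B: "{x. f x \<noteq> 0} \<subseteq> cball 0 B" by auto
  \<comment> \<open>Two points at distance below 1 either both lie in the ball of radius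
    \<open>B + 1\<close> or both lie outside the support.\<close>
  have "uniformly_continuous_on (cball 0 (B + 1)) f"
    using assms unfolding Cc_def
    by (intro compact_uniformly_continuous) (auto intro: continuous_on_subset)
  then obtain d where d: "0 < d" "\<And>x y. \<lbrakk>x \<in> cball 0 (B + 1); y \<in> cball 0 (B + 1); dist y x < d\<rbrakk> \<Longrightarrow> \<bar>f y - f x\<bar> < e"
    using assms(2) unfolding uniformly_continuous_on_def dist_real_def by metis
  show ?thesis
  proof
    show "0 < min d 1" using d by simp
    fix x y :: 'a assume xy: "dist x y < min d 1"
    have z: "f z = 0" if "\<not> norm z \<le> B" for z
      using that B by auto
    have n: "norm x \<le> norm y + dist x y" "norm y \<le> norm x + dist x y"
      by (smt (verit) dist_norm norm_triangle_sub norm_minus_commute)+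
    show "\<bar>f y - f x\<bar> < e"
    proof (cases "norm x \<le> B \<or> norm y \<le> B")
      case True
      then show ?thesis using n xy by (intro d(2)) (auto simp: dist_commute)
    next
      case False
      then show ?thesis using z assms(2) by auto
    qed
  qed
qed

lemma integrable_Cc_in_mult:
  fixes u :: "'a::euclidean_space \<Rightarrow> 'b::euclidean_space"
  assumes u: "loc_integrable \<Omega> u" and f: "Cc_in \<Omega> f" and "open \<Omega>"
  shows "integrable (lebesgue_on \<Omega>) (\<lambda>x. f x *\<^sub>R u x)"
proof -
  obtain K where K: "compact K" "K \<subseteq> \<Omega>" "\<And>x. x \<notin> K \<Longrightarrow> f x = 0"
    using Cc_inE[OF f] by metis
  obtain M where M: "0 \<le> M" "\<And>x. \<bar>f x\<bar> \<le> M" using Cc_bounded[OF Cc_in_imp_Cc[OF f]] by metis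
  have u': "integrable (lebesgue_on K) u" using u K by (simp add: loc_integrable_def)
  have cf: "continuous_on UNIV f" using f by (simp add: Cc_in_def)
  have sK: "K \<in> sets lebesgue" and sO: "\<Omega> \<in> sets lebesgue"
    using borel_compact[OF K(1)] borel_open[OF \<open>open \<Omega>\<close>] by simp_all
  have mf: "f \<in> borel_measurable (lebesgue_on K)"
    using cf sK by (intro continuous_imp_measurable_on_sets_lebesgue) (auto intro: continuous_on_subset)
  have "integrable (lebesgue_on K) (\<lambda>x. f x *\<^sub>R u x)"
  proof (rule Bochner_Integration.integrable_bound)
    show "integrable (lebesgue_on K) (\<lambda>x. M *\<^sub>R u x)" using u' by simp
    show "(\<lambda>x. f x *\<^sub>R u x) \<in> borel_measurable (lebesgue_on K)"
      using borel_measurable_integrable[OF u'] mf by (rule borel_measurable_scaleR[rotated])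
    show "AE x in lebesgue_on K. norm (f x *\<^sub>R u x) \<le> norm (M *\<^sub>R u x)"
      using M by (auto intro!: AE_I2 mult_right_mono)
  qed
  moreover have "(\<lambda>x. indicat_real K x *\<^sub>R f x *\<^sub>R u x) = (\<lambda>x. indicat_real \<Omega> x *\<^sub>R f x *\<^sub>R u x)"
    using K by (auto simp: fun_eq_iff indicator_def)
  ultimately show ?thesis using sK sO by (simp add: integrable_restrict_space)
qed

lemma cutoff_exists:
  fixes K :: "'a::euclidean_space set"
  assumes K: "compact K" "(\<Union>x\<in>K. cball x d) \<subseteq> \<Omega>" and "0 < d"
  obtains \<eta> where "Cc_in \<Omega> \<eta>" "\<And>x. 0 \<le> \<eta> x \<and> \<eta> x \<le> 1"
    "\<And>x y. x \<in> K \<Longrightarrow> dist x y \<le> d / 2 \<Longrightarrow> \<eta> y = 1"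
    "\<And>x. x \<notin> (\<Union>x\<in>K. cball x d) \<Longrightarrow> \<eta> x = 0"
proof (cases "K = {}")
  case True
  then show ?thesis by (intro that[of "\<lambda>x. 0"]) (auto simp: Cc_in_def)
next
  case False
  \<comment> \<open>As a function of the distance s to \<open>K\<close>, the value 2 - 2 s / d
    passes 1 at s = d / 2 and 0 at s = d; it is truncated to the unit interval.\<close>
  define \<eta> where "\<eta> x = max 0 (min 1 (2 - 2 * infdist x K / d))" for x
  have 0: "\<eta> x = 0" if "x \<notin> (\<Union>x\<in>K. cball x d)" for x
  proof -
    obtain y where "y \<in> K" "infdist x K = dist x y"
      using infdist_attains_inf[OF compact_imp_closed[OF K(1)] False] by metis
    then have "d \<le> infdist x K" using that by (auto simp: dist_commute)
    then show ?thesis using \<open>0 < d\<close> by (auto simp: \<eta>_def field_simps)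
  qed
  show ?thesis
  proof
    show "Cc_in \<Omega> \<eta>"
      by (rule Cc_inI[OF _ compact_nbhd[OF K(1)] K(2) 0])
         (use \<open>0 < d\<close> in \<open>auto simp: \<eta>_def[abs_def] intro!: continuous_intros\<close>)
    show "\<eta> y = 1" if "x \<in> K" "dist x y \<le> d / 2" for x y
      using infdist_le[OF that(1), of y] that(2) \<open>0 < d\<close> by (simp add: \<eta>_def dist_commute field_simps)
  qed (use 0 in \<open>auto simp: \<eta>_def\<close>)
qed

lemma sets_lebesgue_compact: "compact (K::'a::euclidean_space set) \<Longrightarrow> K \<in> sets lebesgue"
  by (simp add: borel_compact)

lemma sets_lebesgue_open: "open (K::'a::euclidean_space set) \<Longrightarrow> K \<in> sets lebesgue"
  by (simp add: borel_open)

lemma borel_measurable_lebesgue_on_continuous: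
  fixes f :: "'a::euclidean_space \<Rightarrow> real"
  assumes "continuous_on UNIV f" "S \<in> sets lebesgue"
  shows "f \<in> borel_measurable (lebesgue_on S)"
  using assms by (intro continuous_imp_measurable_on_sets_lebesgue) (auto intro: continuous_on_subset)

lemma integrable_indicator_loc_integrable:
  fixes u :: "'a::euclidean_space \<Rightarrow> real"
  assumes u: "loc_integrable \<Omega> u" and K: "compact K" "K \<subseteq> \<Omega>" and "open \<Omega>"
  shows "integrable (lebesgue_on \<Omega>) (\<lambda>x. indicat_real K x * u x)"
proof -
  have "integrable (lebesgue_on K) u" using u K by (simp add: loc_integrable_def)
  moreover have "(\<lambda>x. indicat_real \<Omega> x *\<^sub>R (indicat_real K x * u x)) = (\<lambda>x. indicat_real K x *\<^sub>R u x)"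
    using K by (auto simp: fun_eq_iff indicator_def)
  ultimately show ?thesis
    using sets_lebesgue_compact[OF K(1)] sets_lebesgue_open[OF \<open>open \<Omega>\<close>]
    by (simp add: integrable_restrict_space)
qed

text \<open>The dominating function is \<open>M\<close> times |u| on \<open>K\<close>. The limit
  \<open>g\<close> is merely a pointwise limit, so that indicators of compact sets are covered; its
  measurability, support and bound are inherited from the sequence.\<close>

lemma loc_integrable_dominated_convergence:
  fixes u :: "'a::euclidean_space \<Rightarrow> real"
  assumes u: "loc_integrable \<Omega> u" and K: "compact K" "K \<subseteq> \<Omega>" and "open \<Omega>"
    and f: "\<And>n. continuous_on UNIV (f n)" "\<And>n x. x \<notin> K \<Longrightarrow> f n x = 0"
    and M: "\<And>n x. \<bar>f n x\<bar> \<le> M" and l: "\<And>x. (\<lambda>n. f n x) \<longlonglongrightarrow> g x"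
  shows "(\<lambda>n. LINT x|lebesgue_on \<Omega>. f n x * u x) \<longlonglongrightarrow> (LINT x|lebesgue_on \<Omega>. g x * u x)"
    "integrable (lebesgue_on \<Omega>) (\<lambda>x. g x * u x)"
proof -
  have mf: "f n \<in> borel_measurable (lebesgue_on \<Omega>)" for n
    using f(1) sets_lebesgue_open[OF \<open>open \<Omega>\<close>] by (rule borel_measurable_lebesgue_on_continuous)
  have mg: "g \<in> borel_measurable (lebesgue_on \<Omega>)"
    using l mf by (rule borel_measurable_LIMSEQ_real)
  have i: "integrable (lebesgue_on \<Omega>) (\<lambda>x. f n x *\<^sub>R u x)" for n
    using f K by (intro integrable_Cc_in_mult[OF u _ \<open>open \<Omega>\<close>]) (blast intro: Cc_inI)
  have gK: "g x = 0" if "x \<notin> K" for x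
    using LIMSEQ_unique[OF l[of x]] f(2)[OF that] by auto
  have gM: "\<bar>g x\<bar> \<le> M" for x
    by (rule LIMSEQ_le_const2[OF tendsto_rabs[OF l]]) (use M in auto)
  have w: "integrable (lebesgue_on \<Omega>) (\<lambda>x. M * \<bar>indicat_real K x * u x\<bar>)"
    using integrable_indicator_loc_integrable[OF u K \<open>open \<Omega>\<close>] by (intro integrable_mult_right integrable_abs)
  have m: "(\<lambda>x. g x * u x) \<in> borel_measurable (lebesgue_on \<Omega>)"
  proof -
    have "(\<lambda>x. g x * (indicat_real K x * u x)) \<in> borel_measurable (lebesgue_on \<Omega>)"
      using borel_measurable_integrable[OF integrable_indicator_loc_integrable[OF u K \<open>open \<Omega>\<close>]] mg
      by (rule borel_measurable_times[rotated])
    moreover have "(\<lambda>x. g x * (indicat_real K x * u x)) = (\<lambda>x. g x * u x)"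
      using gK by (auto simp: fun_eq_iff indicator_def)
    ultimately show ?thesis by simp
  qed
  have b: "norm (c * u x) \<le> M * \<bar>indicat_real K x * u x\<bar>" if "x \<notin> K \<Longrightarrow> c = 0" "\<bar>c\<bar> \<le> M" for c x
    using that by (cases "x \<in> K") (auto simp: abs_mult intro: mult_right_mono)
  show "(\<lambda>n. LINT x|lebesgue_on \<Omega>. f n x * u x) \<longlonglongrightarrow> (LINT x|lebesgue_on \<Omega>. g x * u x)"
  proof (rule integral_dominated_convergence[OF m _ w])
    show "(\<lambda>x. f n x * u x) \<in> borel_measurable (lebesgue_on \<Omega>)" for n
      using borel_measurable_integrable[OF i] by simp
    show "AE x in lebesgue_on \<Omega>. (\<lambda>n. f n x * u x) \<longlonglongrightarrow> g x * u x"
      by (intro AE_I2 tendsto_mult l tendsto_const)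
    show "AE x in lebesgue_on \<Omega>. norm (f n x * u x) \<le> M * \<bar>indicat_real K x * u x\<bar>" for n
      by (intro AE_I2 b f(2) M)
  qed
  show "integrable (lebesgue_on \<Omega>) (\<lambda>x. g x * u x)"
  proof (rule Bochner_Integration.integrable_bound[OF w m], intro AE_I2)
    fix x
    have "norm (g x * u x) \<le> M * \<bar>indicat_real K x * u x\<bar>" by (intro b gK gM)
    then show "norm (g x * u x) \<le> norm (M * \<bar>indicat_real K x * u x\<bar>)" by simp
  qed
qed

section \<open>Uniform approximation by test functions\<close>

text \<open>The margin \<open>d\<close> is fixed once for the compact set. Radii below
  \<open>d / 4\<close> keep mollified supports inside the \<open>d\<close>-neighbourhood, and keep
  all points met by the kernel within distance \<open>d / 2\<close>, where the cutoff of
  \<open>cutoff_exists\<close> equals 1.\<close>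

lemma mollification_sequence:
  fixes \<Omega> :: "'a::euclidean_space set"
  assumes "open \<Omega>" "compact K" "K \<subseteq> \<Omega>"
  obtains d \<epsilon> and \<rho> :: "nat \<Rightarrow> 'a \<Rightarrow> real"
  where "0 < d" "(\<Union>x\<in>K. cball x d) \<subseteq> \<Omega>" "\<And>n. 0 < \<epsilon> n" "\<And>n. \<epsilon> n < d / 4" "\<epsilon> \<longlonglongrightarrow> 0"
    "\<And>n. mollifier (\<epsilon> n) (\<rho> n)"
proof -
  obtain d where d: "0 < d" "(\<Union>x\<in>K. cball x d) \<subseteq> \<Omega>"
    using compact_subset_open_imp_cball_epsilon_subset[OF assms(2,1,3)] by metis
  define \<epsilon> where "\<epsilon> n = d / 8 * inverse (real (Suc n))" for n
  have pos: "0 < \<epsilon> n" for n using d by (simp add: \<epsilon>_def)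
  obtain \<rho> :: "nat \<Rightarrow> 'a \<Rightarrow> real" where "\<And>n. mollifier (\<epsilon> n) (\<rho> n)"
    using mollifier_exists[OF pos] by metis
  moreover have "\<epsilon> n < d / 4" for n
  proof -
    have "d / 8 * inverse (real (Suc n)) \<le> d / 8 * 1"
      using d by (intro mult_left_mono) (auto simp: field_simps)
    then show ?thesis using d by (simp add: \<epsilon>_def)
  qed
  moreover have "\<epsilon> \<longlonglongrightarrow> 0"
    unfolding \<epsilon>_def using tendsto_mult_right_zero[OF LIMSEQ_inverse_real_of_nat] by blast
  ultimately show ?thesis using that d pos by metis
qed

lemma conv_uniform_limit:
  assumes f: "Cc f" and r: "\<And>n. mollifier (\<epsilon> n) (\<rho> n)" "\<epsilon> \<longlonglongrightarrow> 0" and "0 < e"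
  shows "\<forall>\<^sub>F n in sequentially. \<forall>x. \<bar>conv f (\<rho> n) x - f x\<bar> \<le> e"
proof -
  obtain d where d: "0 < d" "\<And>x y. dist x y < d \<Longrightarrow> \<bar>f y - f x\<bar> < e"
    using Cc_uniformly_continuous[OF f \<open>0 < e\<close>] by metis
  have "\<forall>\<^sub>F n in sequentially. \<epsilon> n < d"
    using order_tendstoD(2)[OF r(2) d(1)] .
  then show ?thesis
  proof eventually_elim
    case (elim n)
    show ?case
    proof
      fix x
      show "\<bar>conv f (\<rho> n) x - f x\<bar> \<le> e"
      proof (rule conv_approx[OF f r(1)])
        show "\<bar>f y - f x\<bar> \<le> e" if "dist x y < \<epsilon> n" for y
          using d(2)[of x y] that elim by simp
      qed (use \<open>0 < e\<close> in simp)
    qed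
  qed
qed

lemma conv_tendsto:
  assumes "Cc f" "\<And>n. mollifier (\<epsilon> n) (\<rho> n)" "\<epsilon> \<longlonglongrightarrow> 0"
  shows "(\<lambda>n. conv f (\<rho> n) x) \<longlonglongrightarrow> f x"
  unfolding tendsto_iff dist_real_def
proof (intro allI impI)
  fix e :: real assume "0 < e"
  then have "\<forall>\<^sub>F n in sequentially. \<forall>x. \<bar>conv f (\<rho> n) x - f x\<bar> \<le> e / 2"
    by (intro conv_uniform_limit[OF assms]) simp
  then show "\<forall>\<^sub>F n in sequentially. \<bar>conv f (\<rho> n) x - f x\<bar> < e"
  proof eventually_elim
    case (elim n)
    then have "\<bar>conv f (\<rho> n) x - f x\<bar> \<le> e / 2" by (rule spec)
    then show ?case using \<open>0 < e\<close> by linarith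
  qed
qed

section \<open>The fundamental lemma of the calculus of variations\<close>

text \<open>The mollifications of \<open>\<psi>\<close> are test functions supported in one compact
  set, uniformly bounded and pointwise convergent to \<open>\<psi>\<close>.\<close>

lemma integral_Cc_in_eq_0:
  fixes f :: "'a::euclidean_space \<Rightarrow> real"
  assumes "open \<Omega>" and f: "loc_integrable \<Omega> f"
    and t: "\<And>\<phi>. \<phi> \<in> test_functions \<Omega> \<Longrightarrow> (LINT x|lebesgue_on \<Omega>. \<phi> x * f x) = 0"
    and p: "Cc_in \<Omega> \<psi>"
  shows "(LINT x|lebesgue_on \<Omega>. \<psi> x * f x) = 0"
proof -
  obtain K where K: "compact K" "K \<subseteq> \<Omega>" "\<And>x. x \<notin> K \<Longrightarrow> \<psi> x = 0"
    using Cc_inE[OF p] by metis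
  obtain d \<epsilon> and \<rho> :: "nat \<Rightarrow> 'a \<Rightarrow> real"
    where d: "0 < d" "(\<Union>x\<in>K. cball x d) \<subseteq> \<Omega>" and e: "\<And>n. 0 < \<epsilon> n" "\<And>n. \<epsilon> n < d / 4" "\<epsilon> \<longlonglongrightarrow> 0"
    and r: "\<And>n. mollifier (\<epsilon> n) (\<rho> n)"
    using mollification_sequence[OF \<open>open \<Omega>\<close> K(1,2)] by metis
  have sub: "(\<Union>x\<in>K. cball x (\<epsilon> n)) \<subseteq> (\<Union>x\<in>K. cball x d)" for n
    using e(2)[of n] d(1) by (intro UN_mono subset_cball) auto
  note p' = Cc_in_imp_Cc[OF p]
  obtain M where M: "0 \<le> M" "\<And>x. \<bar>\<psi> x\<bar> \<le> M" using Cc_bounded[OF p'] by metis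
  note c = Cc_in_conv[OF p' K(3,1) subset_trans[OF sub d(2)] r]
  have "(\<lambda>n. LINT x|lebesgue_on \<Omega>. conv \<psi> (\<rho> n) x * f x) \<longlonglongrightarrow> (LINT x|lebesgue_on \<Omega>. \<psi> x * f x)"
  proof (rule loc_integrable_dominated_convergence[OF f compact_nbhd[OF K(1), of d] d(2) \<open>open \<Omega>\<close>])
    show "continuous_on UNIV (conv \<psi> (\<rho> n))" for n
      using c(1)[of n] by (simp add: test_functions_iff Cc_in_def)
    show "conv \<psi> (\<rho> n) x = 0" if "x \<notin> (\<Union>x\<in>K. cball x d)" for n x
      using c(2)[of x n] that sub[of n] by blast
    \<comment> \<open>The oscillation of \<open>\<psi>\<close> contributes \<open>2 * M\<close>, its
      own size another \<open>M\<close>.\<close>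
    show "\<bar>conv \<psi> (\<rho> n) x\<bar> \<le> 3 * M" for n x
    proof -
      have "\<bar>conv \<psi> (\<rho> n) x - \<psi> x\<bar> \<le> 2 * M"
      proof (rule conv_approx[OF p' r])
        show "\<bar>\<psi> y - \<psi> x\<bar> \<le> 2 * M" for y using M(2)[of x] M(2)[of y] by linarith
      qed (use M(1) in simp)
      then show ?thesis using M(2)[of x] by linarith
    qed
    show "(\<lambda>n. conv \<psi> (\<rho> n) x) \<longlonglongrightarrow> \<psi> x" for x
      by (rule conv_tendsto[OF p' r e(3)])
  qed
  then show ?thesis using t[OF c(1)] by (simp add: LIMSEQ_const_iff)
qed

text \<open>Cutoffs equal to 1 on \<open>K\<close> whose transition layers shrink converge pointwise
  to the indicator of \<open>K\<close>.\<close>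

lemma integral_compact_eq_0:
  fixes f :: "'a::euclidean_space \<Rightarrow> real"
  assumes "open \<Omega>" and f: "loc_integrable \<Omega> f"
    and t: "\<And>\<psi>. Cc_in \<Omega> \<psi> \<Longrightarrow> (LINT x|lebesgue_on \<Omega>. \<psi> x * f x) = 0"
    and K: "compact K" "K \<subseteq> \<Omega>"
  shows "(LINT x|lebesgue_on \<Omega>. indicat_real K x * f x) = 0"
proof -
  obtain d where d: "0 < d" "(\<Union>x\<in>K. cball x d) \<subseteq> \<Omega>"
    using compact_subset_open_imp_cball_epsilon_subset[OF K(1) \<open>open \<Omega>\<close> K(2)] by metis
  define \<delta> where "\<delta> n = d * inverse (real (Suc n))" for n
  have pos: "0 < \<delta> n" "\<delta> n \<le> d" for n
    using d mult_left_mono[of "inverse (real (Suc n))" 1 d] by (auto simp: \<delta>_def field_simps)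
  have lim: "\<delta> \<longlonglongrightarrow> 0"
    unfolding \<delta>_def using tendsto_mult_right_zero[OF LIMSEQ_inverse_real_of_nat] by blast
  have sub: "(\<Union>x\<in>K. cball x (\<delta> n)) \<subseteq> (\<Union>x\<in>K. cball x d)" for n
    using pos(2)[of n] by (intro UN_mono subset_cball) auto
  have "\<exists>\<eta>. Cc_in \<Omega> \<eta> \<and> (\<forall>x. 0 \<le> \<eta> x \<and> \<eta> x \<le> 1) \<and> (\<forall>x y. x \<in> K \<longrightarrow> dist x y \<le> \<delta> n / 2 \<longrightarrow> \<eta> y = 1) \<and>
    (\<forall>x. x \<notin> (\<Union>x\<in>K. cball x (\<delta> n)) \<longrightarrow> \<eta> x = 0)" for n
    using cutoff_exists[OF K(1) subset_trans[OF sub d(2)] pos(1)] by metis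
  then obtain \<eta> where \<eta>: "\<And>n. Cc_in \<Omega> (\<eta> n)" "\<And>n x. 0 \<le> \<eta> n x \<and> \<eta> n x \<le> 1"
    "\<And>n x y. x \<in> K \<Longrightarrow> dist x y \<le> \<delta> n / 2 \<Longrightarrow> \<eta> n y = 1"
    "\<And>n x. x \<notin> (\<Union>x\<in>K. cball x (\<delta> n)) \<Longrightarrow> \<eta> n x = 0"
    by metis
  have "(\<lambda>n. LINT x|lebesgue_on \<Omega>. \<eta> n x * f x) \<longlonglongrightarrow> (LINT x|lebesgue_on \<Omega>. indicat_real K x * f x)"
  proof (rule loc_integrable_dominated_convergence[OF f compact_nbhd[OF K(1), of d] d(2) \<open>open \<Omega>\<close>])
    show "continuous_on UNIV (\<eta> n)" for n using \<eta>(1) by (simp add: Cc_in_def)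
    show "\<eta> n x = 0" if "x \<notin> (\<Union>x\<in>K. cball x d)" for n x
      using \<eta>(4) that sub[of n] by blast
    show "\<bar>\<eta> n x\<bar> \<le> 1" for n x using \<eta>(2)[of n x] by simp
    show "(\<lambda>n. \<eta> n x) \<longlonglongrightarrow> indicat_real K x" for x
    proof (cases "x \<in> K")
      case True
      then have "\<eta> n x = indicat_real K x" for n
        using \<eta>(3)[of x x n] pos(1)[of n] by simp
      then show ?thesis by simp
    next
      case False
      then obtain \<delta>' where \<delta>': "0 < \<delta>'" "ball x \<delta>' \<subseteq> - K"
        using compact_imp_closed[OF K(1)] open_contains_ball[of "- K"] by (metis ComplI open_Compl)
      have "\<forall>\<^sub>F n in sequentially. \<delta> n < \<delta>'" using order_tendstoD(2)[OF lim \<delta>'(1)] .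
      then have "\<forall>\<^sub>F n in sequentially. \<eta> n x = indicat_real K x"
      proof eventually_elim
        case (elim n)
        have "x \<notin> (\<Union>x\<in>K. cball x (\<delta> n))"
        proof
          assume "x \<in> (\<Union>x\<in>K. cball x (\<delta> n))"
          then obtain y where "y \<in> K" "dist y x \<le> \<delta> n" by auto
          then have "y \<in> ball x \<delta>'" using elim by (simp add: dist_commute)
          then show False using \<delta>'(2) \<open>y \<in> K\<close> by blast
        qed
        then show ?case using \<eta>(4) False by simp
      qed
      then show ?thesis by (rule tendsto_eventually)
    qed
  qed
  then show ?thesis using t[OF \<eta>(1)] by (simp add: LIMSEQ_const_iff)
qed

text \<open>On a closed subset \<open>T\<close> of the set in question \<open>f\<close> is positive
  with integral zero, so \<open>T\<close> is null. By inner regularity such sets exhaust the set up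
  to arbitrarily small measure.\<close>

lemma null_set_positive_part:
  fixes f :: "'a::euclidean_space \<Rightarrow> real"
  assumes "open \<Omega>" and f: "loc_integrable \<Omega> f" and K: "compact K" "K \<subseteq> \<Omega>"
    and t: "\<And>K. compact K \<Longrightarrow> K \<subseteq> \<Omega> \<Longrightarrow> (LINT x|lebesgue_on \<Omega>. indicat_real K x * f x) = 0"
  shows "{x \<in> K. 0 < f x} \<in> null_sets lebesgue"
proof -
  let ?S = "{x \<in> K. 0 < f x}"
  have fK: "f \<in> borel_measurable (lebesgue_on K)"
    using f K by (auto simp: loc_integrable_def)
  then have "{x \<in> space (lebesgue_on K). 0 < f x} \<in> sets (lebesgue_on K)" by measurable
  then have S: "?S \<in> sets lebesgue"
    using sets_lebesgue_compact[OF K(1)] by (auto simp: sets_restrict_space_iff)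
  have null: "T \<in> null_sets lebesgue" if T: "closed T" "T \<subseteq> ?S" for T
  proof -
    have cT: "compact T" "T \<subseteq> \<Omega>"
      using T K compact_Int_closed[OF K(1) T(1)] by (auto simp: Int_absorb1 subset_iff)
    have "integrable (lebesgue_on \<Omega>) (\<lambda>x. indicat_real T x * f x)"
      using integrable_indicator_loc_integrable[OF f cT \<open>open \<Omega>\<close>] .
    moreover have "AE x in lebesgue_on \<Omega>. 0 \<le> indicat_real T x * f x"
      using T by (intro AE_I2) (auto simp: indicator_def)
    ultimately have "AE x in lebesgue_on \<Omega>. indicat_real T x * f x = 0"
      using t[OF cT] integral_nonneg_eq_0_iff_AE by blast
    then have "AE x in lebesgue. x \<in> \<Omega> \<longrightarrow> indicat_real T x * f x = 0"
      using sets_lebesgue_open[OF \<open>open \<Omega>\<close>] by (simp add: AE_restrict_space_iff)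
    then have "AE x in lebesgue. x \<notin> T"
      by eventually_elim (use T cT in \<open>auto simp: indicator_def subset_iff\<close>)
    then show ?thesis
      using sets_lebesgue_compact[OF cT(1)] by (simp add: AE_iff_null_sets)
  qed
  have *: "emeasure lebesgue ?S \<le> ennreal e" if "0 < e" for e :: real
  proof -
    obtain T where T: "closed T" "T \<subseteq> ?S" "emeasure lebesgue (?S - T) < ennreal e"
      using sets_lebesgue_inner_closed[OF S \<open>0 < e\<close>] by metis
    have "emeasure lebesgue ?S = emeasure lebesgue (?S - T)"
      using emeasure_Diff_null_set[OF null[OF T(1,2)] S] by simp
    then show ?thesis using T(3) by simp
  qed
  have "emeasure lebesgue ?S \<le> 0"
  proof (rule ennreal_le_epsilon)
    fix e :: real assume "0 < e"
    then show "emeasure lebesgue ?S \<le> 0 + ennreal e" unfolding add_0 by (rule *)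
  qed
  then show ?thesis using S by (simp add: null_sets_def)
qed

text \<open>The previous lemma is applied to \<open>f\<close> and to its negative on each member of
  a compact exhaustion of the open set.\<close>

lemma fundamental_lemma:
  fixes f :: "'a::euclidean_space \<Rightarrow> real"
  assumes "open \<Omega>" and f: "loc_integrable \<Omega> f"
    and t: "\<And>\<phi>. \<phi> \<in> test_functions \<Omega> \<Longrightarrow> (LINT x|lebesgue_on \<Omega>. \<phi> x * f x) = 0"
  shows "AE x in lebesgue_on \<Omega>. f x = 0"
proof -
  have f': "loc_integrable \<Omega> (\<lambda>x. - f x)" using f by (simp add: loc_integrable_def)
  have 1: "(LINT x|lebesgue_on \<Omega>. indicat_real K x * f x) = 0" if "compact K" "K \<subseteq> \<Omega>" for K
    using that by (intro integral_compact_eq_0[OF \<open>open \<Omega>\<close> f] integral_Cc_in_eq_0[OF \<open>open \<Omega>\<close> f t])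
  have 2: "{x \<in> K. f x \<noteq> 0} \<in> null_sets lebesgue" if K: "compact K" "K \<subseteq> \<Omega>" for K
  proof -
    have "{x \<in> K. 0 < f x} \<in> null_sets lebesgue"
      by (rule null_set_positive_part[OF \<open>open \<Omega>\<close> f K 1])
    moreover have "{x \<in> K. 0 < - f x} \<in> null_sets lebesgue"
      by (rule null_set_positive_part[OF \<open>open \<Omega>\<close> f' K]) (use 1 in simp)
    ultimately have "{x \<in> K. 0 < f x} \<union> {x \<in> K. 0 < - f x} \<in> null_sets lebesgue" by (rule null_sets.Un)
    moreover have "{x \<in> K. 0 < f x} \<union> {x \<in> K. 0 < - f x} = {x \<in> K. f x \<noteq> 0}" by auto
    ultimately show ?thesis by simp
  qed
  show ?thesis
  proof (rule open_Union_compact_subsets[OF \<open>open \<Omega>\<close>])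
    fix C :: "nat \<Rightarrow> 'a set"
    assume C: "\<And>n. compact (C n)" "\<And>n. C n \<subseteq> \<Omega>" "\<Union>(range C) = \<Omega>"
    have "(\<Union>n. {x \<in> C n. f x \<noteq> 0}) \<in> null_sets lebesgue"
      using 2[OF C(1,2)] by (rule null_sets_UN)
    moreover have "(\<Union>n. {x \<in> C n. f x \<noteq> 0}) = {x \<in> \<Omega>. f x \<noteq> 0}" using C(3) by auto
    ultimately have "{x \<in> \<Omega>. f x \<noteq> 0} \<in> null_sets lebesgue" by simp
    then have "AE x in lebesgue. x \<notin> {x \<in> \<Omega>. f x \<noteq> 0}" by (rule AE_not_in)
    then show ?thesis
      using sets_lebesgue_open[OF \<open>open \<Omega>\<close>] by (simp add: AE_restrict_space_iff)
  qed
qed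

section \<open>Weak gradients\<close>

text \<open>Weak gradients are arbitrary representatives; completeness is what transfers
  measurability between functions that agree almost everywhere.\<close>

lemma complete_measure_lebesgue_on:
  assumes "S \<in> sets lebesgue" shows "complete_measure (lebesgue_on S)"
proof
  fix A B assume "B \<subseteq> A" "A \<in> null_sets (lebesgue_on S)"
  then have A: "A \<in> null_sets lebesgue" "A \<subseteq> S" "B \<subseteq> S"
    using assms by (auto simp: null_sets_restrict_space)
  have "B \<in> sets lebesgue"
    using \<open>B \<subseteq> A\<close> A(1) by (meson completion.complete null_setsD2)
  then show "B \<in> sets (lebesgue_on S)"
    using assms A(3) by (simp add: sets_restrict_space_iff)
qed

lemma borel_measurable_lebesgue_on_AE:
  fixes f g :: "'a::euclidean_space \<Rightarrow> 'b::topological_space"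
  assumes S: "S \<in> sets lebesgue" and f: "f \<in> borel_measurable (lebesgue_on S)"
    and eq: "AE x in lebesgue_on S. f x = g x"
  shows "g \<in> borel_measurable (lebesgue_on S)"
proof (rule measurableI)
  fix B :: "'b set" assume "B \<in> sets borel"
  then have "f -` B \<inter> space (lebesgue_on S) \<in> sets (lebesgue_on S)"
    by (rule measurable_sets[OF f])
  moreover have "AE x in lebesgue_on S. x \<in> f -` B \<inter> space (lebesgue_on S) \<longleftrightarrow> x \<in> g -` B \<inter> space (lebesgue_on S)"
    using eq by eventually_elim auto
  ultimately show "g -` B \<inter> space (lebesgue_on S) \<in> sets (lebesgue_on S)"
    using complete_measure.in_sets_AE[OF complete_measure_lebesgue_on[OF S]] by blast
qed simp

text \<open>By completeness either both functions are measurable or neither is. In the second case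
  neither is integrable and both integrals take the default value 0, so no measurability has to be
  supplied.\<close>

lemma integral_lebesgue_on_cong_AE:
  fixes f g :: "'a::euclidean_space \<Rightarrow> 'b::{banach, second_countable_topology}"
  assumes S: "S \<in> sets lebesgue" and eq: "AE x in lebesgue_on S. f x = g x"
  shows "integral\<^sup>L (lebesgue_on S) f = integral\<^sup>L (lebesgue_on S) g"
    "integrable (lebesgue_on S) f \<longleftrightarrow> integrable (lebesgue_on S) g"
proof -
  have eq': "AE x in lebesgue_on S. g x = f x" using eq by eventually_elim simp
  have m: "f \<in> borel_measurable (lebesgue_on S) \<longleftrightarrow> g \<in> borel_measurable (lebesgue_on S)"
    using borel_measurable_lebesgue_on_AE[OF S _ eq] borel_measurable_lebesgue_on_AE[OF S _ eq'] by blast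
  show *: "integrable (lebesgue_on S) f \<longleftrightarrow> integrable (lebesgue_on S) g"
  proof (cases "f \<in> borel_measurable (lebesgue_on S)")
    case True
    then show ?thesis using m eq by (intro integrable_cong_AE) auto
  next
    case False
    then show ?thesis using m borel_measurable_integrable by blast
  qed
  show "integral\<^sup>L (lebesgue_on S) f = integral\<^sup>L (lebesgue_on S) g"
  proof (cases "f \<in> borel_measurable (lebesgue_on S)")
    case True
    then show ?thesis using m eq by (intro integral_cong_AE) auto
  next
    case False
    then have "\<not> integrable (lebesgue_on S) f" using borel_measurable_integrable by blast
    then show ?thesis using * by (simp add: not_integrable_integral_eq)
  qed
qed

lemma AE_lebesgue_on_subset:
  assumes "AE x in lebesgue_on \<Omega>. P x" "K \<subseteq> \<Omega>" "K \<in> sets lebesgue" "\<Omega> \<in> sets lebesgue"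
  shows "AE x in lebesgue_on K. P x"
proof -
  have "AE x in lebesgue. x \<in> \<Omega> \<longrightarrow> P x" using assms by (simp add: AE_restrict_space_iff)
  then have "AE x in lebesgue. x \<in> K \<longrightarrow> P x" by eventually_elim (use assms in auto)
  then show ?thesis using assms by (simp add: AE_restrict_space_iff)
qed

lemma loc_integrable_cong_AE:
  fixes u v :: "'a::euclidean_space \<Rightarrow> 'b::euclidean_space"
  assumes "open \<Omega>" "loc_integrable \<Omega> u" "AE x in lebesgue_on \<Omega>. u x = v x"
  shows "loc_integrable \<Omega> v"
  unfolding loc_integrable_def
proof (intro allI impI, elim conjE)
  fix K assume K: "compact K" "K \<subseteq> \<Omega>"
  have "AE x in lebesgue_on K. u x = v x"
    using assms K by (intro AE_lebesgue_on_subset[OF assms(3)]) (auto simp: sets_lebesgue_open sets_lebesgue_compact)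
  then show "integrable (lebesgue_on K) v"
    using integral_lebesgue_on_cong_AE(2)[OF sets_lebesgue_compact[OF K(1)]] assms(2) K
    by (auto simp: loc_integrable_def)
qed

lemma is_weak_gradient_cong_AE:
  assumes "open \<Omega>" "is_weak_gradient \<Omega> u V"
    and u: "AE x in lebesgue_on \<Omega>. u x = w x" and V: "AE x in lebesgue_on \<Omega>. V x = W x"
  shows "is_weak_gradient \<Omega> w W"
  unfolding is_weak_gradient_def
proof (intro conjI ballI)
  note S = sets_lebesgue_open[OF assms(1)]
  show "loc_integrable \<Omega> w" "loc_integrable \<Omega> W"
    using assms loc_integrable_cong_AE unfolding is_weak_gradient_def by blast+
  fix \<phi> and i :: 'a assume \<phi>: "\<phi> \<in> test_functions \<Omega>" "i \<in> Basis"
  have "AE x in lebesgue_on \<Omega>. u x * frechet_derivative \<phi> (at x) i = w x * frechet_derivative \<phi> (at x) i"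
    using u by eventually_elim simp
  note 1 = integral_lebesgue_on_cong_AE(1)[OF S this]
  have "AE x in lebesgue_on \<Omega>. (V x \<bullet> i) * \<phi> x = (W x \<bullet> i) * \<phi> x"
    using V by eventually_elim simp
  note 2 = integral_lebesgue_on_cong_AE(1)[OF S this]
  have "(LINT x|lebesgue_on \<Omega>. u x * frechet_derivative \<phi> (at x) i) = - (LINT x|lebesgue_on \<Omega>. (V x \<bullet> i) * \<phi> x)"
    using assms(2) \<phi> by (simp add: is_weak_gradient_def)
  then show "(LINT x|lebesgue_on \<Omega>. w x * frechet_derivative \<phi> (at x) i) = - (LINT x|lebesgue_on \<Omega>. (W x \<bullet> i) * \<phi> x)"
    unfolding 1 2 .
qed

section \<open>Linearity, uniqueness and classical gradients\<close>

lemma loc_integrable_combine: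
  assumes "loc_integrable \<Omega> u" "loc_integrable \<Omega> v"
  shows "loc_integrable \<Omega> (\<lambda>x. a *\<^sub>R u x + b *\<^sub>R v x)"
  using assms unfolding loc_integrable_def by auto

lemma loc_integrable_inner: "loc_integrable \<Omega> V \<Longrightarrow> loc_integrable \<Omega> (\<lambda>x. V x \<bullet> i)"
  unfolding loc_integrable_def by auto

lemma is_weak_gradient_combine:
  fixes \<Omega> :: "'a::euclidean_space set"
  assumes "open \<Omega>" and u: "is_weak_gradient \<Omega> u V" and v: "is_weak_gradient \<Omega> v W"
  shows "is_weak_gradient \<Omega> (\<lambda>x. a * u x + b * v x) (\<lambda>x. a *\<^sub>R V x + b *\<^sub>R W x)"
  unfolding is_weak_gradient_def
proof (intro conjI ballI)
  have loc: "loc_integrable \<Omega> u" "loc_integrable \<Omega> v" "loc_integrable \<Omega> V" "loc_integrable \<Omega> W"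
    using u v by (simp_all add: is_weak_gradient_def)
  show "loc_integrable \<Omega> (\<lambda>x. a * u x + b * v x)"
    using loc_integrable_combine[OF loc(1,2), of a b] by simp
  show "loc_integrable \<Omega> (\<lambda>x. a *\<^sub>R V x + b *\<^sub>R W x)"
    using loc_integrable_combine[OF loc(3,4)] .
  fix \<phi> and i :: 'a assume \<phi>: "\<phi> \<in> test_functions \<Omega>" "i \<in> Basis"
  let ?d = "\<lambda>x. frechet_derivative \<phi> (at x) i"
  have iu: "integrable (lebesgue_on \<Omega>) (\<lambda>x. w x * ?d x)" if "loc_integrable \<Omega> w" for w :: "'a \<Rightarrow> real"
    using integrable_Cc_in_mult[OF that test_functionsD(4)[OF \<phi>(1)] \<open>open \<Omega>\<close>] by (simp add: mult.commute)
  have iV: "integrable (lebesgue_on \<Omega>) (\<lambda>x. (U x \<bullet> i) * \<phi> x)" if "loc_integrable \<Omega> U" for U :: "'a \<Rightarrow> 'a"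
    using integrable_Cc_in_mult[OF loc_integrable_inner[OF that] test_functionsD(1)[OF \<phi>(1)] \<open>open \<Omega>\<close>]
    by (simp add: mult.commute)
  have "(LINT x|lebesgue_on \<Omega>. (a * u x + b * v x) * ?d x) =
      a * (LINT x|lebesgue_on \<Omega>. u x * ?d x) + b * (LINT x|lebesgue_on \<Omega>. v x * ?d x)"
    using iu[OF loc(1)] iu[OF loc(2)] by (simp add: distrib_right mult.assoc)
  also have "\<dots> = - (a * (LINT x|lebesgue_on \<Omega>. (V x \<bullet> i) * \<phi> x) + b * (LINT x|lebesgue_on \<Omega>. (W x \<bullet> i) * \<phi> x))"
    using u v \<phi> by (simp add: is_weak_gradient_def)
  also have "\<dots> = - (LINT x|lebesgue_on \<Omega>. ((a *\<^sub>R V x + b *\<^sub>R W x) \<bullet> i) * \<phi> x)"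
    using iV[OF loc(3)] iV[OF loc(4)] by (simp add: inner_add_left distrib_right mult.assoc)
  finally show "(LINT x|lebesgue_on \<Omega>. (a * u x + b * v x) * ?d x) =
      - (LINT x|lebesgue_on \<Omega>. ((a *\<^sub>R V x + b *\<^sub>R W x) \<bullet> i) * \<phi> x)" .
qed

text \<open>By linearity the difference of the two candidates is a weak gradient of zero; the
  fundamental lemma applies to each of its coordinates.\<close>

lemma is_weak_gradient_unique:
  fixes \<Omega> :: "'a::euclidean_space set"
  assumes "open \<Omega>" and u: "is_weak_gradient \<Omega> u V" and v: "is_weak_gradient \<Omega> u W"
  shows "AE x in lebesgue_on \<Omega>. V x = W x"
proof -
  have g: "is_weak_gradient \<Omega> (\<lambda>x. 1 * u x + (-1) * u x) (\<lambda>x. 1 *\<^sub>R V x + (-1) *\<^sub>R W x)"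
    by (rule is_weak_gradient_combine[OF assms])
  have "AE x in lebesgue_on \<Omega>. (V x - W x) \<bullet> i = 0" if "i \<in> Basis" for i
  proof (rule fundamental_lemma[OF \<open>open \<Omega>\<close>])
    show "loc_integrable \<Omega> (\<lambda>x. (V x - W x) \<bullet> i)"
      using g loc_integrable_inner[of \<Omega> _ i] by (simp add: is_weak_gradient_def)
    show "(LINT x|lebesgue_on \<Omega>. \<phi> x * ((V x - W x) \<bullet> i)) = 0" if "\<phi> \<in> test_functions \<Omega>" for \<phi>
      using g that \<open>i \<in> Basis\<close> by (simp add: is_weak_gradient_def mult.commute)
  qed
  then have "AE x in lebesgue_on \<Omega>. \<forall>i\<in>Basis. (V x - W x) \<bullet> i = 0"
    by (simp add: AE_finite_all)
  then show ?thesis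
    by eventually_elim (metis euclidean_all_zero_iff right_minus_eq)
qed

lemma weak_gradient_works:
  assumes "is_weak_gradient \<Omega> u V" shows "is_weak_gradient \<Omega> u (weak_gradient \<Omega> u)"
  unfolding weak_gradient_def by (rule someI[of "is_weak_gradient \<Omega> u"]) (rule assms)

lemma weak_gradient_AE:
  assumes "open \<Omega>" "is_weak_gradient \<Omega> u V"
  shows "AE x in lebesgue_on \<Omega>. weak_gradient \<Omega> u x = V x"
  using is_weak_gradient_unique[OF assms(1) weak_gradient_works[OF assms(2)] assms(2)] .

text \<open>The chosen gradients coincide literally and not just almost everywhere, because the
  choice is made from one and the same predicate.\<close>

lemma weak_gradient_cong:
  assumes "open \<Omega>" "ae_eq \<Omega> u w"
  shows "is_weak_gradient \<Omega> u = is_weak_gradient \<Omega> w" "weak_gradient \<Omega> u = weak_gradient \<Omega> w"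
proof -
  have "AE x in lebesgue_on \<Omega>. u x = w x" "AE x in lebesgue_on \<Omega>. w x = u x"
    using assms(2) unfolding ae_eq_def by (auto elim: eventually_mono)
  then show "is_weak_gradient \<Omega> u = is_weak_gradient \<Omega> w"
    using is_weak_gradient_cong_AE[OF assms(1)] by (auto simp: fun_eq_iff)
  then show "weak_gradient \<Omega> u = weak_gradient \<Omega> w" by (simp add: weak_gradient_def)
qed

lemma loc_integrable_continuous:
  fixes f :: "'a::euclidean_space \<Rightarrow> 'b::euclidean_space"
  assumes "continuous_on \<Omega> f" shows "loc_integrable \<Omega> f"
  unfolding loc_integrable_def
proof (intro allI impI, elim conjE)
  fix K assume K: "compact K" "K \<subseteq> \<Omega>"
  interpret finite_measure "lebesgue_on K"
    using K by (intro finite_measure_lebesgue_on) (rule lmeasurable_compact)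
  have cK: "continuous_on K f" using assms K(2) by (rule continuous_on_subset)
  obtain M where "\<forall>x\<in>K. norm (f x) \<le> M"
    using compact_imp_bounded[OF compact_continuous_image[OF cK K(1)]] unfolding bounded_iff by auto
  then show "integrable (lebesgue_on K) f"
    using continuous_imp_measurable_on_sets_lebesgue[OF cK sets_lebesgue_compact[OF K(1)]]
    by (intro integrable_const_bound[of _ M]) (auto intro: AE_I2)
qed

lemma loc_integrable_scale_continuous:
  fixes c :: "'a::euclidean_space \<Rightarrow> real" and V :: "'a \<Rightarrow> 'b::euclidean_space"
  assumes "continuous_on \<Omega> c" "loc_integrable \<Omega> V" shows "loc_integrable \<Omega> (\<lambda>x. c x *\<^sub>R V x)"
  unfolding loc_integrable_def
proof (intro allI impI, elim conjE)
  fix K assume K: "compact K" "K \<subseteq> \<Omega>"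
  have cK: "continuous_on K c" using assms(1) K(2) by (rule continuous_on_subset)
  obtain M where M: "\<forall>x\<in>K. \<bar>c x\<bar> \<le> M"
    using compact_imp_bounded[OF compact_continuous_image[OF cK K(1)]] unfolding bounded_iff by auto
  have V: "integrable (lebesgue_on K) V" using assms(2) K by (simp add: loc_integrable_def)
  show "integrable (lebesgue_on K) (\<lambda>x. c x *\<^sub>R V x)"
  proof (rule Bochner_Integration.integrable_bound)
    show "integrable (lebesgue_on K) (\<lambda>x. M *\<^sub>R V x)" using V by simp
    show "(\<lambda>x. c x *\<^sub>R V x) \<in> borel_measurable (lebesgue_on K)"
      using continuous_imp_measurable_on_sets_lebesgue[OF cK sets_lebesgue_compact[OF K(1)]]
        borel_measurable_integrable[OF V] by (rule borel_measurable_scaleR)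
    show "AE x in lebesgue_on K. norm (c x *\<^sub>R V x) \<le> norm (M *\<^sub>R V x)"
      using M by (intro AE_I2) (auto intro!: mult_right_mono intro: order_trans[OF _ abs_ge_self])
  qed
qed

lemma is_weak_gradient_classical:
  fixes f :: "'a::euclidean_space \<Rightarrow> real"
  assumes "open \<Omega>" and f: "\<And>x. (f has_derivative f' x) (at x)" "\<And>v. continuous_on UNIV (\<lambda>x. f' x v)"
  shows "is_weak_gradient \<Omega> f (\<lambda>x. \<Sum>i\<in>Basis. f' x i *\<^sub>R i)"
  unfolding is_weak_gradient_def
proof (intro conjI ballI)
  have cf: "continuous_on UNIV f"
    by (meson f continuous_at_imp_continuous_on has_derivative_continuous)
  show "loc_integrable \<Omega> f"
    by (intro loc_integrable_continuous continuous_on_subset[OF cf]) auto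
  have "continuous_on UNIV (\<lambda>x. \<Sum>i\<in>Basis. f' x i *\<^sub>R i)" by (intro continuous_intros f(2))
  then show "loc_integrable \<Omega> (\<lambda>x. \<Sum>i\<in>Basis. f' x i *\<^sub>R i)"
    by (intro loc_integrable_continuous) (auto intro: continuous_on_subset)
  fix \<phi> and i :: 'a assume \<phi>: "\<phi> \<in> test_functions \<Omega>" "i \<in> Basis"
  note t = test_functionsD[OF \<phi>(1)]
  have b: "bounded {x. \<phi> x \<noteq> 0}" "bounded {x. frechet_derivative \<phi> (at x) i \<noteq> 0}"
    using Cc_in_imp_Cc[OF t(1)] Cc_in_imp_Cc[OF t(4)[of i]] by (auto simp: Cc_def)
  have c: "Cc (\<lambda>x. f x * frechet_derivative \<phi> (at x) i)" "Cc (\<lambda>x. f' x i * \<phi> x)"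
    by (intro Cc_mult_right Cc_in_imp_Cc[OF t(1)] Cc_in_imp_Cc[OF t(4)] cf f(2))+
  have "(LINT x|lebesgue_on \<Omega>. f x * frechet_derivative \<phi> (at x) i) = integral UNIV (\<lambda>x. f x * frechet_derivative \<phi> (at x) i)"
    using Cc_in_outside[OF t(4)] by (intro LINT_lebesgue_on_eq_integral c sets_lebesgue_open[OF \<open>open \<Omega>\<close>]) auto
  also have "\<dots> = integral UNIV (\<lambda>x. frechet_derivative \<phi> (at x) i * f x)"
    by (simp add: mult.commute)
  also have "\<dots> = - integral UNIV (\<lambda>x. \<phi> x * f' x i)"
    by (rule integral_by_parts_directional[OF t(2,3) f b])
  also have "integral UNIV (\<lambda>x. \<phi> x * f' x i) = integral UNIV (\<lambda>x. f' x i * \<phi> x)"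
    by (simp add: mult.commute)
  also have "\<dots> = (LINT x|lebesgue_on \<Omega>. f' x i * \<phi> x)"
    using Cc_in_outside[OF t(1)]
    by (intro LINT_lebesgue_on_eq_integral[symmetric] c sets_lebesgue_open[OF \<open>open \<Omega>\<close>]) auto
  also have "\<dots> = (LINT x|lebesgue_on \<Omega>. ((\<Sum>i\<in>Basis. f' x i *\<^sub>R i) \<bullet> i) * \<phi> x)"
    using \<phi>(2) by simp
  finally show "(LINT x|lebesgue_on \<Omega>. f x * frechet_derivative \<phi> (at x) i) =
      - (LINT x|lebesgue_on \<Omega>. ((\<Sum>i\<in>Basis. f' x i *\<^sub>R i) \<bullet> i) * \<phi> x)" .
qed

section \<open>The chain rule for continuous functions\<close>

text \<open>The values of \<open>u\<close> outside \<open>\<Omega>\<close> are arbitrary, hence the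
  explicit extension by 0. Continuity is glued from two open sets: \<open>\<Omega>\<close> and the
  complement of the compact set carrying \<open>\<eta>\<close>.\<close>

lemma Cc_in_mult_extend:
  fixes u \<eta> :: "'a::euclidean_space \<Rightarrow> real"
  assumes "open \<Omega>" "Cc_in \<Omega> \<eta>" "continuous_on \<Omega> u"
  shows "Cc_in \<Omega> (\<lambda>x. if x \<in> \<Omega> then \<eta> x * u x else 0)" (is "Cc_in \<Omega> ?f")
proof -
  obtain K where K: "compact K" "K \<subseteq> \<Omega>" "\<And>x. x \<notin> K \<Longrightarrow> \<eta> x = 0"
    using Cc_inE[OF assms(2)] by metis
  have "continuous_on \<Omega> ?f"
  proof (rule continuous_on_eq)
    show "continuous_on \<Omega> (\<lambda>x. \<eta> x * u x)"
      using assms(2,3) unfolding Cc_in_def by (intro continuous_on_mult) (auto intro: continuous_on_subset)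
  qed simp
  moreover have "continuous_on (- K) ?f"
    by (rule continuous_on_eq[OF continuous_on_const[of _ 0]]) (use K(3) in auto)
  ultimately have "continuous_on (\<Omega> \<union> - K) ?f"
    using \<open>open \<Omega>\<close> compact_imp_closed[OF K(1)] by (intro continuous_on_open_Un) (auto simp: open_Compl)
  moreover have "\<Omega> \<union> - K = UNIV" using K(2) by auto
  ultimately show ?thesis
    by (intro Cc_inI[OF _ K(1,2)]) (use K(3) in auto)
qed

lemma even_derivative_odd:
  assumes "\<And>x. (f has_derivative f' x) (at (x::'a::euclidean_space))" "\<And>x. f (- x) = (f x :: real)"
  shows "f' (- x) v = - f' x v"
proof -
  have "((\<lambda>x. f (- x)) has_derivative (\<lambda>h. f' (- x) (- h))) (at x)"
    by (rule has_derivative_compose[of "\<lambda>x. - x" "\<lambda>h. - h", OF _ assms(1)]) (auto intro!: derivative_eq_intros)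
  then have "(\<lambda>h. f' (- x) (- h)) = f' x"
    using has_derivative_unique[OF _ assms(1)] by (simp add: assms(2))
  then have "f' (- x) (- v) = f' x v" by metis
  then show ?thesis
    using linear_neg[OF has_derivative_linear[OF assms(1)]] by (metis minus_equation_iff)
qed

lemma mollifierD:
  assumes "mollifier \<epsilon> \<rho>"
  shows "(\<rho> has_derivative frechet_derivative \<rho> (at z)) (at z)"
    "continuous_on UNIV (\<lambda>z. frechet_derivative \<rho> (at z) v)" "continuous_on UNIV \<rho>"
    "frechet_derivative \<rho> (at (x - y)) v = - frechet_derivative \<rho> (at (y - x)) v"
proof -
  have s: "smooth_fun \<rho>" and e: "\<And>x. \<rho> (- x) = \<rho> x" using assms by (simp_all add: mollifier_def)
  show "(\<rho> has_derivative frechet_derivative \<rho> (at z)) (at z)"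
    "continuous_on UNIV (\<lambda>z. frechet_derivative \<rho> (at z) v)" "continuous_on UNIV \<rho>"
    using smooth_funD[OF s] by blast+
  show "frechet_derivative \<rho> (at (x - y)) v = - frechet_derivative \<rho> (at (y - x)) v"
    using even_derivative_odd[OF smooth_funD(2)[OF s] e, of "y - x" v] by simp
qed

text \<open>Moving the derivative of the mollifier onto the factor \<open>\<psi>\<close> turns \<open>conv \<psi> \<rho>\<close> into an
  admissible test function for \<open>u\<close>; thus no mollification of the weak gradient is needed.\<close>

lemma integral_conv_weak_gradient:
  fixes u :: "'a::euclidean_space \<Rightarrow> real"
  assumes "open \<Omega>" and u: "is_weak_gradient \<Omega> u V"
    and w: "Cc_in \<Omega> w" "\<And>x. x \<in> (\<Union>x\<in>K. cball x \<epsilon>) \<Longrightarrow> w x = u x"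
    and K: "compact K" "(\<Union>x\<in>K. cball x \<epsilon>) \<subseteq> \<Omega>" and p: "Cc \<psi>" "\<And>x. x \<notin> K \<Longrightarrow> \<psi> x = 0"
    and r: "mollifier \<epsilon> \<rho>" and i: "i \<in> Basis"
  shows "integral UNIV (\<lambda>x. \<psi> x * conv w (\<lambda>z. frechet_derivative \<rho> (at z) i) x)
    = (LINT x|lebesgue_on \<Omega>. (V x \<bullet> i) * conv \<psi> \<rho> x)"
proof -
  note t = Cc_in_conv[OF p K r]
  let ?r = "\<lambda>z. frechet_derivative \<rho> (at z) i"
  have d: "(conv \<psi> \<rho> has_derivative (\<lambda>v. conv \<psi> (\<lambda>z. frechet_derivative \<rho> (at z) v) x)) (at x)" for x
    by (rule has_derivative_conv[OF p(1) mollifierD(1,2)[OF r]])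
  have fd: "frechet_derivative (conv \<psi> \<rho>) (at x) i = conv \<psi> ?r x" for x
    using frechet_derivative_at[OF d[of x]] by metis
  have z: "conv \<psi> ?r x = 0" if "x \<notin> (\<Union>x\<in>K. cball x \<epsilon>)" for x
  proof -
    have "(\<lambda>v. conv \<psi> (\<lambda>z. frechet_derivative \<rho> (at z) v) x) = (\<lambda>v. 0)"
      by (rule has_derivative_zero_outside[OF d compact_imp_closed[OF compact_nbhd[OF K(1)]] that]) (rule t(2))
    then show ?thesis by (rule fun_cong)
  qed
  have cp: "Cc (\<lambda>y. w y * conv \<psi> ?r y)"
    by (intro Cc_mult_left Cc_in_imp_Cc[OF w(1)] continuous_on_conv p(1) mollifierD(2)[OF r])
  have "integral UNIV (\<lambda>x. \<psi> x * conv w ?r x) = integral UNIV (\<lambda>y. w y * integral UNIV (\<lambda>x. \<psi> x * ?r (x - y)))"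
    by (rule integral_conv_swap[OF p(1) Cc_in_imp_Cc[OF w(1)] mollifierD(2)[OF r]])
  also have "\<dots> = integral UNIV (\<lambda>y. - (w y * conv \<psi> ?r y))"
  proof -
    have "integral UNIV (\<lambda>x. \<psi> x * ?r (x - y)) = - conv \<psi> ?r y" for y
    proof -
      have "\<psi> x * ?r (x - y) = - (\<psi> x * ?r (y - x))" for x
        unfolding mollifierD(4)[OF r, of x y i] by simp
      then show ?thesis by (simp only: conv_def Henstock_Kurzweil_Integration.integral_neg)
    qed
    then show ?thesis by (simp only: mult_minus_right)
  qed
  also have "\<dots> = - integral UNIV (\<lambda>y. w y * conv \<psi> ?r y)" by simp
  also have "integral UNIV (\<lambda>y. w y * conv \<psi> ?r y) = (LINT y|lebesgue_on \<Omega>. w y * conv \<psi> ?r y)"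
    using Cc_in_outside[OF w(1)]
    by (intro LINT_lebesgue_on_eq_integral[symmetric] cp sets_lebesgue_open[OF \<open>open \<Omega>\<close>]) auto
  \<comment> \<open>Near \<open>K\<close> the function \<open>w\<close> coincides with
    \<open>u\<close>; elsewhere the derivative of the test function vanishes.\<close>
  also have "(\<lambda>y. w y * conv \<psi> ?r y) = (\<lambda>y. u y * frechet_derivative (conv \<psi> \<rho>) (at y) i)"
  proof
    fix y show "w y * conv \<psi> ?r y = u y * frechet_derivative (conv \<psi> \<rho>) (at y) i"
    proof (cases "y \<in> (\<Union>x\<in>K. cball x \<epsilon>)")
      case True
      show ?thesis unfolding fd w(2)[OF True] ..
    next
      case False
      show ?thesis unfolding fd z[OF False] by simp
    qed
  qed
  also have "(LINT y|lebesgue_on \<Omega>. u y * frechet_derivative (conv \<psi> \<rho>) (at y) i)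
      = - (LINT x|lebesgue_on \<Omega>. (V x \<bullet> i) * conv \<psi> \<rho> x)"
    using u t(1) i by (simp add: is_weak_gradient_def)
  finally show ?thesis by simp
qed

lemma conv_abs_le:
  assumes "Cc f" "mollifier \<epsilon> \<rho>" "\<And>x. \<bar>f x\<bar> \<le> M" shows "\<bar>conv f \<rho> x\<bar> \<le> M"
proof -
  have "\<bar>conv f \<rho> x - 0\<bar> \<le> M"
    by (rule conv_approx[OF assms(1,2)]) (use assms(3) order_trans[OF abs_ge_zero assms(3)] in auto)
  then show ?thesis by simp
qed

text \<open>For a mollification of \<open>u\<close> the identity is classical. Shifting the
  derivative back to the test side leaves the given gradient \<open>V\<close> paired with functions
  that converge boundedly, so dominated convergence handles both sides.\<close>

lemma is_weak_gradient_chain_C1: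
  fixes u :: "'a::euclidean_space \<Rightarrow> real"
  assumes "open \<Omega>" and cu: "continuous_on \<Omega> u" and u: "is_weak_gradient \<Omega> u V"
    and F: "\<And>s. (F has_real_derivative F' s) (at s)" and cF': "continuous_on UNIV F'"
  shows "is_weak_gradient \<Omega> (\<lambda>x. F (u x)) (\<lambda>x. F' (u x) *\<^sub>R V x)"
  unfolding is_weak_gradient_def
proof (intro conjI ballI)
  have cF: "continuous_on UNIV F"
    using F by (meson DERIV_isCont continuous_at_imp_continuous_on)
  show "loc_integrable \<Omega> (\<lambda>x. F (u x))"
    by (intro loc_integrable_continuous continuous_on_compose2[OF cF cu]) auto
  have "loc_integrable \<Omega> V" using u by (simp add: is_weak_gradient_def)
  then show "loc_integrable \<Omega> (\<lambda>x. F' (u x) *\<^sub>R V x)"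
    by (intro loc_integrable_scale_continuous continuous_on_compose2[OF cF' cu]) auto
  fix \<phi> and i :: 'a assume \<phi>: "\<phi> \<in> test_functions \<Omega>" and i: "i \<in> Basis"
  note t = test_functionsD[OF \<phi>]
  have lV: "loc_integrable \<Omega> (\<lambda>x. V x \<bullet> i)"
    by (rule loc_integrable_inner) fact
  let ?d = "\<lambda>x. frechet_derivative \<phi> (at x) i"
  obtain K where K: "compact K" "K \<subseteq> \<Omega>" "\<And>x. x \<notin> K \<Longrightarrow> \<phi> x = 0"
    using Cc_inE[OF t(1)] by metis
  have Kd: "?d x = 0" if "x \<notin> K" for x
    using frechet_derivative_zero_outside[OF t(2) K(1) that K(3)] by simp
  obtain d \<epsilon> and \<rho> :: "nat \<Rightarrow> 'a \<Rightarrow> real"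
    where d: "0 < d" "(\<Union>x\<in>K. cball x d) \<subseteq> \<Omega>" and e: "\<And>n. 0 < \<epsilon> n" "\<And>n. \<epsilon> n < d / 4" "\<epsilon> \<longlonglongrightarrow> 0"
    and r: "\<And>n. mollifier (\<epsilon> n) (\<rho> n)"
    using mollification_sequence[OF \<open>open \<Omega>\<close> K(1,2)] by metis
  obtain \<eta> where \<eta>: "Cc_in \<Omega> \<eta>" "\<And>x y. x \<in> K \<Longrightarrow> dist x y \<le> d / 2 \<Longrightarrow> \<eta> y = 1"
    using cutoff_exists[OF K(1) d(2,1)] by metis
  \<comment> \<open>Localising \<open>u\<close> makes it a continuous function on the whole space
    that can be convolved, without changing it wherever kernels centred in \<open>K\<close> can see
    it.\<close>
  define w where "w x = (if x \<in> \<Omega> then \<eta> x * u x else 0)" for x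
  have w: "Cc_in \<Omega> w"
    unfolding w_def by (rule Cc_in_mult_extend[OF \<open>open \<Omega>\<close> \<eta>(1) cu])
  note w' = Cc_in_imp_Cc[OF w]
  have sub: "(\<Union>x\<in>K. cball x (\<epsilon> n)) \<subseteq> (\<Union>x\<in>K. cball x d)" for n
    using e(2)[of n] d(1) by (intro UN_mono subset_cball) auto
  have wu: "w x = u x" if x: "x \<in> (\<Union>x\<in>K. cball x (\<epsilon> n))" for x n
  proof -
    obtain y where "y \<in> K" "x \<in> cball y (\<epsilon> n)" using x by blast
    then have "\<eta> x = 1" using e(2)[of n] d(1) by (intro \<eta>(2)[of y]) auto
    moreover have "x \<in> \<Omega>" using subset_trans[OF sub d(2)] x by (rule subsetD)
    ultimately show ?thesis by (simp add: w_def)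
  qed
  have wuK: "w x = u x" if "x \<in> K" for x
    using that e(1)[of 0] by (intro wu[of _ 0]) (auto intro!: bexI[of _ x])
  obtain M where M: "0 \<le> M" "\<And>x. \<bar>w x\<bar> \<le> M" using Cc_bounded[OF w'] by metis
  define W where "W n = conv w (\<rho> n)" for n
  have WM: "\<bar>W n x\<bar> \<le> M" for n x
    unfolding W_def by (rule conv_abs_le[OF w' r M(2)])
  have cW: "continuous_on UNIV (W n)" for n
    unfolding W_def by (rule continuous_on_conv[OF w' mollifierD(3)[OF r]])
  have Wlim: "\<forall>\<^sub>F n in sequentially. \<forall>x. \<bar>W n x - w x\<bar> \<le> e'" if "0 < e'" for e'
    unfolding W_def by (rule conv_uniform_limit[OF w' r e(3) that])
  have Wpt: "(\<lambda>n. W n x) \<longlonglongrightarrow> w x" for x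
    unfolding W_def by (rule conv_tendsto[OF w' r e(3)])
  obtain B where B: "0 < B" "\<And>s. \<bar>s\<bar> \<le> M \<Longrightarrow> \<bar>F s\<bar> \<le> B" "\<And>s. \<bar>s\<bar> \<le> M \<Longrightarrow> \<bar>F' s\<bar> \<le> B"
  proof -
    have "bounded (F ` {-M..M} \<union> F' ` {-M..M})"
      by (auto intro!: compact_imp_bounded compact_continuous_image continuous_on_subset[OF cF] continuous_on_subset[OF cF'])
    then obtain B where "0 < B" "\<forall>y\<in>F ` {-M..M} \<union> F' ` {-M..M}. norm y \<le> B"
      unfolding bounded_pos by metis
    then show ?thesis by (intro that[of B]) (auto simp: abs_le_iff)
  qed
  obtain D where D: "0 \<le> D" "\<And>x. \<bar>\<phi> x\<bar> \<le> D" using Cc_bounded[OF Cc_in_imp_Cc[OF t(1)]] by metis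
  have D1: "D + 1 \<noteq> 0" using D(1) by linarith
  obtain D' where D': "0 \<le> D'" "\<And>x. \<bar>?d x\<bar> \<le> D'" using Cc_bounded[OF Cc_in_imp_Cc[OF t(4)]] by metis
  \<comment> \<open>Merging \<open>F'\<close> of the mollification into the test factor puts the
    right-hand side into the form treated by \<open>integral_conv_weak_gradient\<close>.\<close>
  define \<psi> where "\<psi> n x = \<phi> x * F' (W n x)" for n x
  have \<psi>: "Cc (\<psi> n)" for n
    unfolding \<psi>_def by (intro Cc_mult_left Cc_in_imp_Cc[OF t(1)] continuous_on_compose2[OF cF' cW]) auto
  have \<psi>K: "\<psi> n x = 0" if "x \<notin> K" for n x using K(3)[OF that] by (simp add: \<psi>_def)
  have \<psi>B: "\<bar>\<psi> n x\<bar> \<le> D * B" for n x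
    unfolding \<psi>_def abs_mult using D(1) by (intro mult_mono D B(3) WM) auto
  have c1: "Cc (\<lambda>x. ?d x * F (W n x))" for n
    by (intro Cc_mult_left Cc_in_imp_Cc[OF t(4)] continuous_on_compose2[OF cF cW]) auto
  \<comment> \<open>The factor 1 on the left matches the shape of
    \<open>loc_integrable_dominated_convergence\<close> with the constant function 1 as
    \<open>u\<close>.\<close>
  have eq: "(LINT x|lebesgue_on \<Omega>. ?d x * F (W n x) * 1) = - (LINT x|lebesgue_on \<Omega>. conv (\<psi> n) (\<rho> n) x * (V x \<bullet> i))" for n
  proof -
    let ?r = "\<lambda>v z. frechet_derivative (\<rho> n) (at z) v"
    have dW: "(W n has_derivative (\<lambda>v. conv w (?r v) x)) (at x)" for x
      unfolding W_def by (rule has_derivative_conv[OF w' mollifierD(1,2)[OF r]])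
    have dF: "((\<lambda>x. F (W n x)) has_derivative (\<lambda>v. F' (W n x) * conv w (?r v) x)) (at x)" for x
      by (rule has_derivative_compose[OF dW F[unfolded has_field_derivative_def]])
    have "(LINT x|lebesgue_on \<Omega>. ?d x * F (W n x) * 1) = integral UNIV (\<lambda>x. ?d x * F (W n x))"
      using Cc_in_outside[OF t(4)] LINT_lebesgue_on_eq_integral[OF c1 _ sets_lebesgue_open[OF \<open>open \<Omega>\<close>], of n]
      by simp
    also have "\<dots> = - integral UNIV (\<lambda>x. \<phi> x * (F' (W n x) * conv w (?r i) x))"
    proof (rule integral_by_parts_directional[OF t(2,3) dF])
      show "continuous_on UNIV (\<lambda>x. F' (W n x) * conv w (?r i) x)"
        by (intro continuous_on_mult continuous_on_compose2[OF cF' cW] continuous_on_conv[OF w' mollifierD(2)[OF r]]) auto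
      show "bounded {x. \<phi> x \<noteq> 0}" "bounded {x. ?d x \<noteq> 0}"
        using Cc_in_imp_Cc[OF t(1)] Cc_in_imp_Cc[OF t(4)[of i]] by (auto simp: Cc_def)
    qed
    also have "(\<lambda>x. \<phi> x * (F' (W n x) * conv w (?r i) x)) = (\<lambda>x. \<psi> n x * conv w (?r i) x)"
      by (simp add: \<psi>_def mult.assoc)
    also have "integral UNIV (\<lambda>x. \<psi> n x * conv w (?r i) x) = (LINT x|lebesgue_on \<Omega>. (V x \<bullet> i) * conv (\<psi> n) (\<rho> n) x)"
      by (rule integral_conv_weak_gradient[OF \<open>open \<Omega>\<close> u w wu K(1) subset_trans[OF sub d(2)] \<psi> \<psi>K r i])
    finally show ?thesis by (simp add: mult.commute)
  qed
  have one: "loc_integrable \<Omega> (\<lambda>x. 1::real)" by (intro loc_integrable_continuous continuous_on_const)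
  have lim1: "(\<lambda>n. LINT x|lebesgue_on \<Omega>. ?d x * F (W n x) * 1) \<longlonglongrightarrow> (LINT x|lebesgue_on \<Omega>. ?d x * F (w x) * 1)"
  proof (rule loc_integrable_dominated_convergence(1)[OF one K(1,2) \<open>open \<Omega>\<close>])
    show "continuous_on UNIV (\<lambda>x. ?d x * F (W n x))" for n using c1 by (simp add: Cc_def)
    show "?d x * F (W n x) = 0" if "x \<notin> K" for n x using Kd[OF that] by simp
    show "\<bar>?d x * F (W n x)\<bar> \<le> D' * B" for n x
      unfolding abs_mult using D'(1) by (intro mult_mono D' B(2) WM) auto
    show "(\<lambda>n. ?d x * F (W n x)) \<longlonglongrightarrow> ?d x * F (w x)" for x
      by (intro tendsto_mult tendsto_const isCont_tendsto_compose[OF DERIV_isCont[OF F] Wpt])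
  qed
  have lim2: "(\<lambda>n. LINT x|lebesgue_on \<Omega>. conv (\<psi> n) (\<rho> n) x * (V x \<bullet> i)) \<longlonglongrightarrow>
      (LINT x|lebesgue_on \<Omega>. \<phi> x * F' (w x) * (V x \<bullet> i))"
  proof (rule loc_integrable_dominated_convergence(1)[OF lV compact_nbhd[OF K(1), of d] d(2) \<open>open \<Omega>\<close>])
    show "continuous_on UNIV (conv (\<psi> n) (\<rho> n))" for n
      by (rule continuous_on_conv[OF \<psi> mollifierD(3)[OF r]])
    show "conv (\<psi> n) (\<rho> n) x = 0" if "x \<notin> (\<Union>x\<in>K. cball x d)" for n x
      using Cc_in_conv(2)[OF \<psi> \<psi>K K(1) subset_trans[OF sub d(2)] r, of x n n] that sub[of n] by blast
    show "\<bar>conv (\<psi> n) (\<rho> n) x\<bar> \<le> D * B" for n x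
      by (rule conv_abs_le[OF \<psi> r \<psi>B])
    show "(\<lambda>n. conv (\<psi> n) (\<rho> n) x) \<longlonglongrightarrow> \<phi> x * F' (w x)" for x
      unfolding tendsto_iff dist_real_def
    proof (intro allI impI)
      fix e' :: real assume "0 < e'"
      have "Cc (\<lambda>x. \<phi> x * F' (w x))"
        using w' by (intro Cc_mult_left Cc_in_imp_Cc[OF t(1)] continuous_on_compose2[OF cF']) (auto simp: Cc_def)
      then obtain \<delta> where \<delta>: "0 < \<delta>" "\<And>x y. dist x y < \<delta> \<Longrightarrow> \<bar>\<phi> y * F' (w y) - \<phi> x * F' (w x)\<bar> < e' / 4"
        using Cc_uniformly_continuous[of "\<lambda>x. \<phi> x * F' (w x)" "e' / 4"] \<open>0 < e'\<close> by auto
      have "uniformly_continuous_on {-M..M} F'"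
        by (intro compact_uniformly_continuous continuous_on_subset[OF cF']) auto
      \<comment> \<open>Since \<open>\<psi> n\<close> changes with \<open>n\<close>, the error
        splits into a quarter of \<open>e'\<close> from replacing \<open>W n\<close> by
        \<open>w\<close> inside \<open>F'\<close>, and another quarter from moving \<open>y\<close>
        to \<open>x\<close>. The bound \<open>D\<close> of |\<phi>| may be 0, hence
        \<open>D + 1\<close>.\<close>
      moreover have "0 < e' / 4 / (D + 1)" using \<open>0 < e'\<close> D(1) by simp
      ultimately obtain \<delta>' where \<delta>': "0 < \<delta>'" "\<And>a b. a \<in> {-M..M} \<Longrightarrow> b \<in> {-M..M} \<Longrightarrow> dist b a < \<delta>' \<Longrightarrow> \<bar>F' b - F' a\<bar> < e' / 4 / (D + 1)"
        unfolding uniformly_continuous_on_def dist_real_def by metis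
      have "\<forall>\<^sub>F n in sequentially. \<epsilon> n < \<delta>" using order_tendstoD(2)[OF e(3) \<delta>(1)] .
      moreover have "\<forall>\<^sub>F n in sequentially. \<forall>x. \<bar>W n x - w x\<bar> \<le> \<delta>' / 2" using \<delta>'(1) by (intro Wlim) simp
      ultimately show "\<forall>\<^sub>F n in sequentially. \<bar>conv (\<psi> n) (\<rho> n) x - \<phi> x * F' (w x)\<bar> < e'"
      proof eventually_elim
        case (elim n)
        have "\<bar>conv (\<psi> n) (\<rho> n) x - \<phi> x * F' (w x)\<bar> \<le> e' / 2"
        proof (rule conv_approx[OF \<psi> r])
          fix y assume y: "dist x y < \<epsilon> n"
          have "\<bar>F' (W n y) - F' (w y)\<bar> < e' / 4 / (D + 1)"
          proof (rule \<delta>'(2))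
            show "w y \<in> {-M..M}" "W n y \<in> {-M..M}" using M(2)[of y] WM[of n y] by (auto simp: abs_le_iff)
            have "\<bar>W n y - w y\<bar> \<le> \<delta>' / 2" using elim(2) by (rule spec)
            then show "dist (W n y) (w y) < \<delta>'" using \<delta>'(1) by (simp add: dist_real_def)
          qed
          then have "\<bar>\<phi> y\<bar> * \<bar>F' (W n y) - F' (w y)\<bar> \<le> (D + 1) * (e' / 4 / (D + 1))"
            using D(1) D(2)[of y] by (intro mult_mono) auto
          also have "\<dots> = e' / 4"
            by (rule trans[OF times_divide_eq_right nonzero_mult_div_cancel_left[OF D1]])
          finally have "\<bar>\<psi> n y - \<phi> y * F' (w y)\<bar> \<le> e' / 4"
            by (simp add: \<psi>_def abs_mult[symmetric] right_diff_distrib)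
          moreover have "\<bar>\<phi> y * F' (w y) - \<phi> x * F' (w x)\<bar> < e' / 4"
            using y elim(1) by (intro \<delta>(2)) simp
          ultimately show "\<bar>\<psi> n y - \<phi> x * F' (w x)\<bar> \<le> e' / 2" by linarith
        qed (use \<open>0 < e'\<close> in simp)
        then show ?case using \<open>0 < e'\<close> by linarith
      qed
    qed
  qed
  have "(LINT x|lebesgue_on \<Omega>. ?d x * F (w x) * 1) = - (LINT x|lebesgue_on \<Omega>. \<phi> x * F' (w x) * (V x \<bullet> i))"
    using LIMSEQ_unique[OF lim1] tendsto_minus[OF lim2] by (simp only: eq)
  moreover have "(\<lambda>x. ?d x * F (w x) * 1) = (\<lambda>x. F (u x) * ?d x)"
  proof
    fix x show "?d x * F (w x) * 1 = F (u x) * ?d x"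
      using Kd[of x] wuK[of x] by (cases "x \<in> K") auto
  qed
  moreover have "(\<lambda>x. \<phi> x * F' (w x) * (V x \<bullet> i)) = (\<lambda>x. (F' (u x) *\<^sub>R V x) \<bullet> i * \<phi> x)"
  proof
    fix x show "\<phi> x * F' (w x) * (V x \<bullet> i) = (F' (u x) *\<^sub>R V x) \<bullet> i * \<phi> x"
      using K(3)[of x] wuK[of x] by (cases "x \<in> K") auto
  qed
  ultimately show "(LINT x|lebesgue_on \<Omega>. F (u x) * ?d x) = - (LINT x|lebesgue_on \<Omega>. (F' (u x) *\<^sub>R V x) \<bullet> i * \<phi> x)"
    by simp
qed

text \<open>\<open>F\<close> may be singular at 0, as powers and the logarithm are. A fixed test
  function sees \<open>u\<close> on a compact set only, where it has a positive minimum, so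
  \<open>F\<close> can be altered near 0 and below.\<close>

lemma is_weak_gradient_chain:
  fixes u :: "'a::euclidean_space \<Rightarrow> real"
  assumes "open \<Omega>" and cu: "continuous_on \<Omega> u" and u: "is_weak_gradient \<Omega> u V"
    and pos: "\<And>x. x \<in> \<Omega> \<Longrightarrow> 0 < u x"
    and F: "\<And>s. 0 < s \<Longrightarrow> (F has_real_derivative F' s) (at s)" and cF': "continuous_on {0<..} F'"
  shows "is_weak_gradient \<Omega> (\<lambda>x. F (u x)) (\<lambda>x. F' (u x) *\<^sub>R V x)"
  unfolding is_weak_gradient_def
proof (intro conjI ballI)
  have cF: "continuous_on {0<..} F"
    using F by (meson DERIV_isCont continuous_at_imp_continuous_on greaterThan_iff)
  show "loc_integrable \<Omega> (\<lambda>x. F (u x))"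
    using pos by (intro loc_integrable_continuous continuous_on_compose2[OF cF cu]) auto
  have "loc_integrable \<Omega> V" using u by (simp add: is_weak_gradient_def)
  then show "loc_integrable \<Omega> (\<lambda>x. F' (u x) *\<^sub>R V x)"
    using pos by (intro loc_integrable_scale_continuous continuous_on_compose2[OF cF' cu]) auto
  fix \<phi> and i :: 'a assume \<phi>: "\<phi> \<in> test_functions \<Omega>" and i: "i \<in> Basis"
  note t = test_functionsD[OF \<phi>]
  let ?d = "\<lambda>x. frechet_derivative \<phi> (at x) i"
  obtain K where K: "compact K" "K \<subseteq> \<Omega>" "\<And>x. x \<notin> K \<Longrightarrow> \<phi> x = 0"
    using Cc_inE[OF t(1)] by metis
  have Kd: "?d x = 0" if "x \<notin> K" for x
    using frechet_derivative_zero_outside[OF t(2) K(1) that K(3)] by simp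
  obtain c where c: "0 < c" "\<And>x. x \<in> K \<Longrightarrow> c \<le> u x"
  proof (cases "K = {}")
    case True
    then show ?thesis using that[of 1] by simp
  next
    case False
    obtain y where "y \<in> K" "\<forall>x\<in>K. u y \<le> u x"
      using continuous_attains_inf[OF K(1) False continuous_on_subset[OF cu K(2)]] by metis
    then show ?thesis using that[of "u y"] pos K(2) by blast
  qed
  text \<open>Below \<open>c\<close>, replace \<open>F\<close> by its tangent line at \<open>c\<close>.\<close>
  define f where "f s = F (max c s) + F' c * (s - max c s)" for s
  define f' where "f' s = F' (max c s)" for s
  have cf': "continuous_on UNIV f'"
    unfolding f'_def using c(1) by (intro continuous_on_compose2[OF cF'] continuous_intros) auto
  have f: "(f has_real_derivative f' s) (at s)" for s
  proof -
    consider "s < c" | "s > c" | "s = c" by linarith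
    then show ?thesis
    proof cases
      case 1
      have "((\<lambda>s. F c + F' c * (s - c)) has_real_derivative f' s) (at s)"
        using 1 by (auto intro!: derivative_eq_intros simp: f'_def max_def)
      then show ?thesis
        by (rule has_field_derivative_transform_within_open[of _ _ _ "{..<c}"])
           (use 1 in \<open>auto simp: f_def max_def\<close>)
    next
      case 2
      have "(F has_real_derivative f' s) (at s)"
        using F[of s] 2 c(1) by (simp add: f'_def max_def)
      then show ?thesis
        by (rule has_field_derivative_transform_within_open[of _ _ _ "{c<..}"])
           (use 2 in \<open>auto simp: f_def max_def\<close>)
    next
      case 3
      \<comment> \<open>At the junction the derivative is assembled from the one-sided derivatives
        of the tangent line and of \<open>F\<close>.\<close>
      have "(f has_real_derivative F' c) (at c within {..c} \<union> {c..})"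
        unfolding has_field_derivative_iff Lim_within_Un
      proof (fold has_field_derivative_iff, intro conjI)
        have "((\<lambda>s. F c + F' c * (s - c)) has_real_derivative F' c) (at c within {..c})"
          by (auto intro!: derivative_eq_intros)
        then show "(f has_real_derivative F' c) (at c within {..c})"
          by (rule has_field_derivative_transform_within[OF _ zero_less_one]) (auto simp: f_def max_def)
        have "(F has_real_derivative F' c) (at c within {c..})"
          using F[OF c(1)] by (rule has_field_derivative_at_within)
        then show "(f has_real_derivative F' c) (at c within {c..})"
          by (rule has_field_derivative_transform_within[OF _ zero_less_one]) (auto simp: f_def max_def)
      qed
      moreover have "{..c} \<union> {c..} = UNIV" by auto
      ultimately show ?thesis using 3 by (simp add: f'_def)
    qed
  qed
  have "is_weak_gradient \<Omega> (\<lambda>x. f (u x)) (\<lambda>x. f' (u x) *\<^sub>R V x)"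
    by (rule is_weak_gradient_chain_C1[OF \<open>open \<Omega>\<close> cu u f cf'])
  then have "(LINT x|lebesgue_on \<Omega>. f (u x) * ?d x) = - (LINT x|lebesgue_on \<Omega>. (f' (u x) *\<^sub>R V x) \<bullet> i * \<phi> x)"
    using \<phi> i by (simp add: is_weak_gradient_def)
  moreover have "(\<lambda>x. f (u x) * ?d x) = (\<lambda>x. F (u x) * ?d x)"
  proof
    fix x show "f (u x) * ?d x = F (u x) * ?d x"
      using Kd[of x] c(2)[of x] by (cases "x \<in> K") (auto simp: f_def max_def)
  qed
  moreover have "(\<lambda>x. (f' (u x) *\<^sub>R V x) \<bullet> i * \<phi> x) = (\<lambda>x. (F' (u x) *\<^sub>R V x) \<bullet> i * \<phi> x)"
  proof
    fix x show "(f' (u x) *\<^sub>R V x) \<bullet> i * \<phi> x = (F' (u x) *\<^sub>R V x) \<bullet> i * \<phi> x"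
      using K(3)[of x] c(2)[of x] by (cases "x \<in> K") (auto simp: f'_def max_def)
  qed
  ultimately show "(LINT x|lebesgue_on \<Omega>. F (u x) * ?d x) = - (LINT x|lebesgue_on \<Omega>. (F' (u x) *\<^sub>R V x) \<bullet> i * \<phi> x)"
    by simp
qed

section \<open>Functions with vanishing weak gradient\<close>

lemma test_function_translate_mollifier:
  fixes \<rho> :: "'a::euclidean_space \<Rightarrow> real"
  assumes "mollifier \<epsilon> \<rho>" "cball x \<epsilon> \<subseteq> \<Omega>"
  shows "(\<lambda>y. \<rho> (y - x)) \<in> test_functions \<Omega>"
proof -
  have s: "smooth_fun (\<lambda>y. \<rho> (y - x))"
    using assms(1) Ck_translation unfolding mollifier_def smooth_fun_def by blast
  have "\<rho> (y - x) = 0" if "y \<notin> cball x \<epsilon>" for y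
  proof -
    have "\<epsilon> \<le> norm (y - x)" using that by (simp add: dist_norm norm_minus_commute)
    then show ?thesis using assms(1) by (simp add: mollifier_def)
  qed
  then show ?thesis
    using s Cc_inI[OF smooth_funD(1)[OF s] compact_cball assms(2)] by (simp add: test_functions_iff)
qed

text \<open>On a small ball the mollifications have zero derivative, so they are constant there and
  so is their limit; connectedness turns local constancy into global constancy.\<close>

lemma weak_gradient_zero_imp_constant:
  fixes u :: "'a::euclidean_space \<Rightarrow> real"
  assumes "open \<Omega>" "connected \<Omega>" and cu: "continuous_on \<Omega> u" and u: "is_weak_gradient \<Omega> u (\<lambda>x. 0)"
    and "a \<in> \<Omega>" "b \<in> \<Omega>"
  shows "u a = u b"
proof (rule connected_local_const[OF assms(2,5,6)], intro ballI)
  fix a assume "a \<in> \<Omega>"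
  obtain s where s: "0 < s" "cball a s \<subseteq> \<Omega>"
    using \<open>open \<Omega>\<close> \<open>a \<in> \<Omega>\<close> open_contains_cball by metis
  have K: "compact (cball a s)" by simp
  obtain d \<epsilon> and \<rho> :: "nat \<Rightarrow> 'a \<Rightarrow> real"
    where d: "0 < d" "(\<Union>x\<in>cball a s. cball x d) \<subseteq> \<Omega>" and e: "\<And>n. 0 < \<epsilon> n" "\<And>n. \<epsilon> n < d / 4" "\<epsilon> \<longlonglongrightarrow> 0"
    and r: "\<And>n. mollifier (\<epsilon> n) (\<rho> n)"
    using mollification_sequence[OF \<open>open \<Omega>\<close> K s(2)] by metis
  obtain \<eta> where \<eta>: "Cc_in \<Omega> \<eta>" "\<And>x y. x \<in> cball a s \<Longrightarrow> dist x y \<le> d / 2 \<Longrightarrow> \<eta> y = 1"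
    using cutoff_exists[OF K d(2,1)] by metis
  define w where "w x = (if x \<in> \<Omega> then \<eta> x * u x else 0)" for x
  have w: "Cc_in \<Omega> w"
    unfolding w_def by (rule Cc_in_mult_extend[OF \<open>open \<Omega>\<close> \<eta>(1) cu])
  note w' = Cc_in_imp_Cc[OF w]
  have sub: "cball x (\<epsilon> n) \<subseteq> \<Omega>" if "x \<in> cball a s" for x n
  proof -
    have "cball x (\<epsilon> n) \<subseteq> cball x d" using e(2)[of n] d(1) by (intro subset_cball) auto
    then show ?thesis using d(2) that by blast
  qed
  have wu: "w y = u y" if "x \<in> cball a s" "y \<in> cball x (\<epsilon> n)" for x y n
  proof -
    have "\<eta> y = 1" using e(2)[of n] d(1) that(2) by (intro \<eta>(2)[OF that(1)]) auto
    moreover have "y \<in> \<Omega>" using sub[OF that(1)] that(2) by blast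
    ultimately show ?thesis by (simp add: w_def)
  qed
  \<comment> \<open>Up to sign, the directional derivative of the mollification at \<open>x\<close>
    is \<open>u\<close> tested against the derivative of the kernel translated to \<open>x\<close>,
    which the zero weak gradient annihilates.\<close>
  have zero: "conv w (\<lambda>z. frechet_derivative (\<rho> n) (at z) i) x = 0" if x: "x \<in> cball a s" and i: "i \<in> Basis" for n x i
  proof -
    let ?r = "\<lambda>z. frechet_derivative (\<rho> n) (at z) i"
    note t = test_function_translate_mollifier[OF r sub[OF x], of n]
    have "((\<lambda>y. \<rho> n (y - x)) has_derivative frechet_derivative (\<rho> n) (at (y - x))) (at y)" for y
      by (rule has_derivative_compose[of "\<lambda>y. y - x" "\<lambda>h. h", OF _ mollifierD(1)[OF r]])
         (auto intro!: derivative_eq_intros)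
    then have fd: "frechet_derivative (\<lambda>y. \<rho> n (y - x)) (at y) = frechet_derivative (\<rho> n) (at (y - x))" for y
      by (rule frechet_derivative_at[symmetric])
    have z: "?r z = 0" if "\<epsilon> n < norm z" for z
    proof -
      have "frechet_derivative (\<rho> n) (at z) = (\<lambda>v. 0)"
      proof (rule has_derivative_zero_outside[OF mollifierD(1)[OF r] closed_cball])
        show "z \<notin> cball 0 (\<epsilon> n)" using that by simp
        show "\<rho> n y = 0" if "y \<notin> cball 0 (\<epsilon> n)" for y
          using r[of n] that by (simp add: mollifier_def)
      qed
      then show ?thesis by simp
    qed
    have "w y * ?r (x - y) = - (u y * ?r (y - x))" for y
    proof (cases "y \<in> cball x (\<epsilon> n)")
      case True
      show ?thesis unfolding mollifierD(4)[OF r, of n x y i] wu[OF x True] by simp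
    next
      case False
      then have "?r (x - y) = 0" "?r (y - x) = 0" by (auto intro!: z simp: dist_norm norm_minus_commute)
      then show ?thesis by simp
    qed
    then have "conv w ?r x = - integral UNIV (\<lambda>y. u y * ?r (y - x))"
      unfolding conv_def by (simp only: Henstock_Kurzweil_Integration.integral_neg)
    also have "integral UNIV (\<lambda>y. u y * ?r (y - x)) = (LINT y|lebesgue_on \<Omega>. u y * ?r (y - x))"
    proof (rule LINT_lebesgue_on_eq_integral[symmetric, OF _ _ sets_lebesgue_open[OF \<open>open \<Omega>\<close>]])
      have "(\<lambda>y. u y * ?r (y - x)) = (\<lambda>y. w y * ?r (y - x))"
      proof
        fix y show "u y * ?r (y - x) = w y * ?r (y - x)"
        proof (cases "y \<in> cball x (\<epsilon> n)")
          case True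
          show ?thesis unfolding wu[OF x True] ..
        next
          case False
          then have "?r (y - x) = 0" by (auto intro!: z simp: dist_norm norm_minus_commute)
          then show ?thesis by simp
        qed
      qed
      moreover have "continuous_on UNIV (\<lambda>y. ?r (y - x))"
        by (rule continuous_on_compose2[OF mollifierD(2)[OF r]]) (auto intro!: continuous_intros)
      ultimately show "Cc (\<lambda>y. u y * ?r (y - x))"
        using Cc_mult_left[OF w'] by metis
      show "u y * ?r (y - x) = 0" if "y \<notin> \<Omega>" for y
      proof -
        have "y \<notin> cball x (\<epsilon> n)" using sub[OF x] that by blast
        then have "?r (y - x) = 0" by (auto intro!: z simp: dist_norm norm_minus_commute)
        then show ?thesis by simp
      qed
    qed
    also have "\<dots> = (LINT y|lebesgue_on \<Omega>. u y * frechet_derivative (\<lambda>y. \<rho> n (y - x)) (at y) i)"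
      by (simp only: fd)
    also have "\<dots> = - (LINT y|lebesgue_on \<Omega>. ((0::'a) \<bullet> i) * \<rho> n (y - x))"
      using u t i unfolding is_weak_gradient_def by blast
    finally show ?thesis by simp
  qed
  have const: "conv w (\<rho> n) x = conv w (\<rho> n) a" if "x \<in> cball a s" for n x
  proof -
    have "(conv w (\<rho> n) has_derivative (\<lambda>h. 0)) (at x within cball a s)" if "x \<in> cball a s" for x
    proof -
      let ?D = "\<lambda>v. conv w (\<lambda>z. frechet_derivative (\<rho> n) (at z) v) x"
      have D: "(conv w (\<rho> n) has_derivative ?D) (at x)"
        by (rule has_derivative_conv[OF w' mollifierD(1,2)[OF r]])
      have "?D = (\<lambda>h. 0)"
        by (rule linear_eq_stdbasis[OF has_derivative_linear[OF D] linear_zero]) (rule zero[OF that])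
      then show ?thesis using D by (metis has_derivative_at_withinI)
    qed
    then obtain c where "\<forall>x\<in>cball a s. conv w (\<rho> n) x = c"
      using has_derivative_zero_constant[OF convex_cball] by metis
    then show ?thesis using that s(1) by simp
  qed
  have lim: "(\<lambda>n. conv w (\<rho> n) x) \<longlonglongrightarrow> w x" for x
    by (rule conv_tendsto[OF w' r e(3)])
  have "u a = u x" if "x \<in> ball a s" for x
  proof -
    have x: "x \<in> cball a s" "a \<in> cball a s" using that s(1) by auto
    have "(\<lambda>n. conv w (\<rho> n) a) \<longlonglongrightarrow> w x"
      using lim[of x] unfolding const[OF x(1)] .
    then have "w a = w x" using LIMSEQ_unique[OF lim[of a]] by simp
    moreover have "x \<in> cball x (\<epsilon> 0)" "a \<in> cball a (\<epsilon> 0)" using e(1)[of 0] by auto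
    ultimately show ?thesis using wu[OF x(1)] wu[OF x(2)] by metis
  qed
  then show "\<forall>\<^sub>F x in at a within \<Omega>. u a = u x"
    unfolding eventually_at using s(1) by (intro exI[of _ s]) (auto simp: dist_commute)
qed

section \<open>Power curves between positive functions\<close>

text \<open>The graph of s^p lies strictly above its tangent at 1; the mean value theorem on either
  side of 1 compares the slopes.\<close>

lemma bernoulli_powr_strict:
  fixes s p :: real
  assumes "1 < p" "0 \<le> s" "s \<noteq> 1"
  shows "1 + p * (s - 1) < s powr p"
proof -
  consider "s = 0" | "0 < s" "s < 1" | "1 < s" using assms by linarith
  then show ?thesis
  proof cases
    case 1
    then show ?thesis using assms by simp
  next
    case 2
    have "\<exists>z. s < z \<and> z < 1 \<and> 1 powr p - s powr p = (1 - s) * (p * z powr (p - 1))"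
      using 2 by (intro MVT2) (auto intro!: derivative_eq_intros)
    then obtain z where z: "s < z" "z < 1" "1 powr p - s powr p = (1 - s) * (p * z powr (p - 1))" by metis
    have "z powr (p - 1) < 1 powr (p - 1)"
      using z 2 assms by (intro powr_less_mono2) auto
    then have "(1 - s) * (p * z powr (p - 1)) < (1 - s) * (p * 1)"
      using 2 assms by (intro mult_strict_left_mono) auto
    then show ?thesis using z(3) by (simp add: algebra_simps)
  next
    case 3
    have "\<exists>z. 1 < z \<and> z < s \<and> s powr p - 1 powr p = (s - 1) * (p * z powr (p - 1))"
      using 3 by (intro MVT2) (auto intro!: derivative_eq_intros)
    then obtain z where z: "1 < z" "z < s" "s powr p - 1 powr p = (s - 1) * (p * z powr (p - 1))" by metis
    have "1 powr (p - 1) < z powr (p - 1)"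
      using z assms by (intro powr_less_mono2) auto
    then have "(s - 1) * (p * 1) < (s - 1) * (p * z powr (p - 1))"
      using 3 assms by (intro mult_strict_left_mono) auto
    then show ?thesis using z(3) by (simp add: algebra_simps)
  qed
qed

lemma powr_strict_convex:
  fixes a b l m p :: real
  assumes p: "1 < p" and ab: "0 \<le> a" "0 \<le> b" "a \<noteq> b" and lm: "0 < l" "0 < m" "l + m = 1"
  shows "(l * a + m * b) powr p < l * a powr p + m * b powr p"
proof -
  define c where "c = l * a + m * b"
  have c: "0 < c"
  proof -
    have "0 < a \<or> 0 < b" using ab by linarith
    then show ?thesis
      unfolding c_def using ab lm by (auto intro: add_pos_nonneg add_nonneg_pos)
  qed
  have "c - a = m * (b - a)" "c - b = l * (a - b)"
  proof -
    have l: "l = 1 - m" using lm(3) by simp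
    show "c - a = m * (b - a)" "c - b = l * (a - b)" by (simp_all add: c_def l algebra_simps)
  qed
  then have ne: "a / c \<noteq> 1" "b / c \<noteq> 1" using ab lm c by auto
  have tangent: "c powr p * (1 + p * (x / c - 1)) < x powr p" if "0 \<le> x" "x / c \<noteq> 1" for x
  proof -
    have "1 + p * (x / c - 1) < (x / c) powr p"
      using that c by (intro bernoulli_powr_strict[OF p]) auto
    also have "(x / c) powr p = x powr p / c powr p"
      using that c by (simp add: powr_divide)
    finally show ?thesis using c by (simp add: field_simps)
  qed
  \<comment> \<open>Averaging the two tangent values: as \<open>c\<close> is the weighted mean of
    \<open>a\<close> and \<open>b\<close>, the linear terms cancel.\<close>
  have "c powr p = l * (c powr p * (1 + p * (a / c - 1))) + m * (c powr p * (1 + p * (b / c - 1)))"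
  proof -
    have "l * (1 + p * (a / c - 1)) + m * (1 + p * (b / c - 1)) = (l + m) * (1 - p) + p * ((l * a + m * b) / c)"
      by (simp add: add_divide_distrib algebra_simps)
    also have "\<dots> = 1" unfolding c_def[symmetric] using c lm(3) by simp
    finally have "c powr p * (l * (1 + p * (a / c - 1)) + m * (1 + p * (b / c - 1))) = c powr p" by simp
    then show ?thesis by (simp add: algebra_simps)
  qed
  also have "\<dots> < l * a powr p + m * b powr p"
    using tangent[OF ab(1) ne(1)] tangent[OF ab(2) ne(2)] lm
    by (intro add_strict_mono mult_strict_left_mono)
  finally show ?thesis by (simp add: c_def)
qed

text \<open>The triangle inequality followed by convexity of the power. If the ends agree, both
  links are equalities: strict convexity makes the norms equal, and equality in the triangle
  inequality makes the vectors parallel.\<close>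

lemma norm_powr_convex:
  fixes x y :: "'a::real_inner"
  assumes p: "1 < p" and lm: "0 \<le> l" "0 \<le> m" "l + m = 1"
  shows "norm (l *\<^sub>R x + m *\<^sub>R y) powr p \<le> l * norm x powr p + m * norm y powr p"
    and "norm (l *\<^sub>R x + m *\<^sub>R y) powr p = l * norm x powr p + m * norm y powr p \<Longrightarrow> 0 < l \<Longrightarrow> 0 < m \<Longrightarrow> x = y"
proof -
  have tri: "norm (l *\<^sub>R x + m *\<^sub>R y) \<le> l * norm x + m * norm y"
    using norm_triangle_ineq[of "l *\<^sub>R x" "m *\<^sub>R y"] lm by simp
  have 1: "norm (l *\<^sub>R x + m *\<^sub>R y) powr p \<le> (l * norm x + m * norm y) powr p"
    using tri p by (intro powr_mono2) auto
  have 2: "(l * norm x + m * norm y) powr p \<le> l * norm x powr p + m * norm y powr p"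
  proof -
    consider "l = 0" | "m = 0" | "norm x = norm y" | "0 < l" "0 < m" "norm x \<noteq> norm y" using lm by linarith
    then show ?thesis
    proof cases
      case 3
      have "l * norm y + m * norm y = norm y" "l * norm y powr p + m * norm y powr p = norm y powr p"
        using lm(3) by (simp_all flip: distrib_right)
      then show ?thesis using 3 by simp
    next
      case 4
      then show ?thesis using powr_strict_convex[OF p _ _ 4(3,1,2) lm(3)] by simp
    qed (use lm p in auto)
  qed
  show "norm (l *\<^sub>R x + m *\<^sub>R y) powr p \<le> l * norm x powr p + m * norm y powr p"
    using 1 2 by linarith
  assume eq: "norm (l *\<^sub>R x + m *\<^sub>R y) powr p = l * norm x powr p + m * norm y powr p" and pos: "0 < l" "0 < m"
  have n: "norm x = norm y"
  proof (rule ccontr)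
    assume "norm x \<noteq> norm y"
    then show False using powr_strict_convex[OF p _ _ _ pos lm(3), of "norm x" "norm y"] eq 1 by simp
  qed
  have "norm (l *\<^sub>R x + m *\<^sub>R y) = l * norm x + m * norm y"
  proof (rule ccontr)
    assume "norm (l *\<^sub>R x + m *\<^sub>R y) \<noteq> l * norm x + m * norm y"
    then have "norm (l *\<^sub>R x + m *\<^sub>R y) < l * norm x + m * norm y" using tri by simp
    then have "norm (l *\<^sub>R x + m *\<^sub>R y) powr p < (l * norm x + m * norm y) powr p"
      using p by (intro powr_less_mono2) auto
    then show False using 2 eq by simp
  qed
  then have "norm (l *\<^sub>R x + m *\<^sub>R y) = norm (l *\<^sub>R x) + norm (m *\<^sub>R y)" using pos by simp
  then have "norm (l *\<^sub>R x) *\<^sub>R m *\<^sub>R y = norm (m *\<^sub>R y) *\<^sub>R l *\<^sub>R x"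
    unfolding norm_triangle_eq .
  then have "(l * m * norm y) *\<^sub>R y = (l * m * norm y) *\<^sub>R x"
    using pos n by (simp add: ac_simps)
  then show "x = y" using pos n by auto
qed

section \<open>The power curve and its gradient\<close>

text \<open>The weighted power mean of exponent \<open>p\<close>: a straight segment after passing
  to p-th powers, which is why subcurves are again such curves.\<close>

definition geo :: "real \<Rightarrow> real \<Rightarrow> real \<Rightarrow> real \<Rightarrow> real" where
  "geo p t a b = ((1 - t) * a powr p + t * b powr p) powr (1 / p)"

text \<open>What the chain rule yields for the gradient of the curve at a point where the two
  functions have values \<open>a\<close>, \<open>b\<close> and gradients \<open>V\<close>,
  \<open>W\<close>.\<close>

definition geo_grad :: "real \<Rightarrow> real \<Rightarrow> real \<Rightarrow> real \<Rightarrow> 'a::real_vector \<Rightarrow> 'a \<Rightarrow> 'a" where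
  "geo_grad p t a b V W = geo p t a b powr (1 - p) *\<^sub>R
     (((1 - t) * a powr (p - 1)) *\<^sub>R V + (t * b powr (p - 1)) *\<^sub>R W)"

lemma geo_powr:
  assumes "1 < p" "0 \<le> t" "t \<le> 1" shows "geo p t a b powr p = (1 - t) * a powr p + t * b powr p"
  using assms by (simp add: geo_def powr_powr)

lemma geo_radicand_pos:
  assumes "0 < a" "0 < b" "0 \<le> t" "t \<le> (1::real)" shows "0 < (1 - t) * a powr p + t * b powr p"
proof (cases "t = 1")
  case False
  then show ?thesis using assms by (intro add_pos_nonneg) auto
qed (use assms in simp)

lemma geo_pos: "0 < a \<Longrightarrow> 0 < b \<Longrightarrow> 0 \<le> t \<Longrightarrow> t \<le> 1 \<Longrightarrow> 0 < geo p t a b"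
  using geo_radicand_pos[of a b t p] by (simp add: geo_def)

text \<open>In this form the logarithmic gradient of the curve is a convex combination of the
  logarithmic gradients \<open>V /\<^sub>R a\<close> and \<open>W /\<^sub>R b\<close>, ready for
  convexity of the p-th power of the norm.\<close>

lemma geo_grad_eq:
  assumes "1 < p" "0 < a" "0 < b" "0 \<le> t" "t \<le> 1"
  shows "geo_grad p t a b V W = geo p t a b *\<^sub>R
     (((1 - t) * a powr p / geo p t a b powr p) *\<^sub>R (V /\<^sub>R a) + (t * b powr p / geo p t a b powr p) *\<^sub>R (W /\<^sub>R b))"
proof -
  have g: "0 < geo p t a b" using assms by (intro geo_pos)
  have 1: "geo p t a b powr (1 - p) = geo p t a b / geo p t a b powr p"
    using g by (simp add: powr_diff)
  have 2: "x powr (p - 1) = x powr p * inverse x" if "0 < x" for x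
    using that by (simp add: powr_diff divide_inverse)
  show ?thesis
    unfolding geo_grad_def 1 2[OF assms(2)] 2[OF assms(3)]
    by (simp add: scaleR_add_right divide_inverse ac_simps)
qed

text \<open>A form of Picone's inequality.\<close>

lemma norm_geo_grad:
  fixes V W :: "'a::real_inner"
  assumes p: "1 < p" and ab: "0 < a" "0 < b" and t: "0 \<le> t" "t \<le> 1"
  shows "norm (geo_grad p t a b V W) powr p \<le> (1 - t) * norm V powr p + t * norm W powr p"
    and "norm (geo_grad p t a b V W) powr p = (1 - t) * norm V powr p + t * norm W powr p \<Longrightarrow> 0 < t \<Longrightarrow> t < 1
      \<Longrightarrow> V /\<^sub>R a = W /\<^sub>R b"
proof -
  define c where "c = geo p t a b"
  have c: "0 < c" unfolding c_def using ab t by (intro geo_pos)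
  have cp: "c powr p = (1 - t) * a powr p + t * b powr p" unfolding c_def by (rule geo_powr[OF p t])
  define l where "l = (1 - t) * a powr p / c powr p"
  define m where "m = t * b powr p / c powr p"
  have lm: "0 \<le> l" "0 \<le> m" "l + m = 1"
    using t c cp by (auto simp: l_def m_def simp flip: add_divide_distrib)
  have Z: "norm (geo_grad p t a b V W) powr p = c powr p * norm (l *\<^sub>R (V /\<^sub>R a) + m *\<^sub>R (W /\<^sub>R b)) powr p"
    unfolding geo_grad_eq[OF p ab t] c_def[symmetric] l_def[symmetric] m_def[symmetric]
    using c by (simp add: powr_mult)
  \<comment> \<open>The weights contain the p-th powers of \<open>a\<close> and \<open>b\<close>,
    which undo the division of \<open>V\<close> and \<open>W\<close>.\<close>
  have R: "c powr p * (l * norm (V /\<^sub>R a) powr p + m * norm (W /\<^sub>R b) powr p) = (1 - t) * norm V powr p + t * norm W powr p"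
  proof -
    have "norm (V /\<^sub>R a) powr p = norm V powr p / a powr p" "norm (W /\<^sub>R b) powr p = norm W powr p / b powr p"
    proof -
      have "norm (V /\<^sub>R a) = norm V / a" "norm (W /\<^sub>R b) = norm W / b"
        using ab by (simp_all add: divide_inverse mult.commute)
      then show "norm (V /\<^sub>R a) powr p = norm V powr p / a powr p" "norm (W /\<^sub>R b) powr p = norm W powr p / b powr p"
        using ab by (simp_all only: powr_divide norm_ge_zero less_imp_le)
    qed
    then show ?thesis
      using ab c by (simp add: l_def m_def field_simps)
  qed
  show "norm (geo_grad p t a b V W) powr p \<le> (1 - t) * norm V powr p + t * norm W powr p"
    unfolding Z R[symmetric] by (intro mult_left_mono norm_powr_convex(1)[OF p lm]) simp
  assume eq: "norm (geo_grad p t a b V W) powr p = (1 - t) * norm V powr p + t * norm W powr p" and t': "0 < t" "t < 1"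
  have "0 < l" "0 < m" using t' ab c by (auto simp: l_def m_def)
  moreover have "norm (l *\<^sub>R (V /\<^sub>R a) + m *\<^sub>R (W /\<^sub>R b)) powr p = l * norm (V /\<^sub>R a) powr p + m * norm (W /\<^sub>R b) powr p"
    using eq c unfolding Z R[symmetric] by simp
  ultimately show "V /\<^sub>R a = W /\<^sub>R b" using norm_powr_convex(2)[OF p lm] by blast
qed

section \<open>Dependence of the curve on its parameter\<close>

lemma powr_lipschitz_at_1:
  fixes \<alpha> c d :: real
  assumes "0 < c" "c \<le> 1" "1 \<le> d"
  obtains K where "0 \<le> K" "\<And>y. c \<le> y \<Longrightarrow> y \<le> d \<Longrightarrow> \<bar>y powr \<alpha> - 1\<bar> \<le> K * \<bar>y - 1\<bar>"
proof -
  have "continuous_on {c..d} (\<lambda>y. \<alpha> * y powr (\<alpha> - 1))"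
    using assms by (intro continuous_intros) auto
  then have "bounded ((\<lambda>y. \<alpha> * y powr (\<alpha> - 1)) ` {c..d})"
    by (intro compact_imp_bounded compact_continuous_image) auto
  then obtain K where K: "0 < K" "\<And>y. y \<in> {c..d} \<Longrightarrow> \<bar>\<alpha> * y powr (\<alpha> - 1)\<bar> \<le> K"
    unfolding bounded_pos by auto
  have "\<bar>y powr \<alpha> - 1\<bar> \<le> K * \<bar>y - 1\<bar>" if "c \<le> y" "y \<le> d" for y
  proof -
    have "norm (y powr \<alpha> - 1 powr \<alpha>) \<le> K * norm (y - 1)"
    proof (rule field_differentiable_bound[of "{c..d}"])
      show "((\<lambda>y. y powr \<alpha>) has_field_derivative \<alpha> * z powr (\<alpha> - 1)) (at z within {c..d})" if "z \<in> {c..d}" for z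
        using that assms by (auto intro!: derivative_eq_intros)
    qed (use that assms K in auto)
    then show ?thesis by simp
  qed
  then show ?thesis using that[of K] K(1) by simp
qed

text \<open>By homogeneity everything reduces to y = 1 + t ((b/a)^p - 1): the curve is
  \<open>a * y powr (1 / p)\<close>. Comparability keeps b/a between \<open>\<delta>\<close> and its
  inverse, so y stays in a fixed interval away from 0, where powers are Lipschitz, and |y - 1| is at
  most \<open>d * t\<close>. Hence \<open>K\<close> depends on \<open>p\<close> and
  \<open>\<delta>\<close> alone.\<close>

lemma geo_estimates:
  assumes p: "1 < p" and \<delta>: "0 < \<delta>" "\<delta> < 1"
  obtains K where "0 \<le> K"
    "\<And>a b t. 0 < a \<Longrightarrow> 0 < b \<Longrightarrow> \<delta> * b \<le> a \<Longrightarrow> \<delta> * a \<le> b \<Longrightarrow> 0 \<le> t \<Longrightarrow> t \<le> 1 \<Longrightarrow>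
       \<bar>geo p t a b - a\<bar> \<le> K * t * a"
    "\<And>a b t (V::'a::real_normed_vector) W. 0 < a \<Longrightarrow> 0 < b \<Longrightarrow> \<delta> * b \<le> a \<Longrightarrow> \<delta> * a \<le> b \<Longrightarrow> 0 \<le> t \<Longrightarrow> t \<le> 1 \<Longrightarrow>
       norm (geo_grad p t a b V W - V) \<le> K * t * (norm V + norm W)"
proof -
  define c where "c = \<delta> powr p"
  define d where "d = inverse \<delta> powr p"
  have c: "0 < c" "c \<le> 1" "1 \<le> d"
    using \<delta> p by (auto simp: c_def d_def powr_le1 ge_one_powr_ge_zero one_le_inverse_iff)
  obtain K1 where K1: "0 \<le> K1" "\<And>y. c \<le> y \<Longrightarrow> y \<le> d \<Longrightarrow> \<bar>y powr (1 / p) - 1\<bar> \<le> K1 * \<bar>y - 1\<bar>"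
    using powr_lipschitz_at_1[OF c] by metis
  obtain K2 where K2: "0 \<le> K2" "\<And>y. c \<le> y \<Longrightarrow> y \<le> d \<Longrightarrow> \<bar>y powr ((1 - p) / p) - 1\<bar> \<le> K2 * \<bar>y - 1\<bar>"
    using powr_lipschitz_at_1[OF c] by metis
  \<comment> \<open>\<open>B\<close> bounds \<open>y powr ((1 - p) / p)\<close> uniformly in t. The
    constant \<open>K\<close> adds what the three estimates cost: \<open>K1 * d\<close> for the
    value, \<open>K2 * d + B\<close> for the coefficient of \<open>V\<close>, and
    \<open>B * d\<close> for that of \<open>W\<close>.\<close>
  define B where "B = 1 + K2 * d"
  define K where "K = K1 * d + (K2 * d + B) + B * d"
  have B: "1 \<le> B" using K2 c by (simp add: B_def)
  have nn: "0 \<le> K1 * d" "0 \<le> K2 * d" "0 \<le> B * d" using K1 K2 c B by auto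
  have main: "\<exists>y. c \<le> y \<and> y \<le> d \<and> \<bar>y - 1\<bar> \<le> d * t \<and> geo p t a b = a * y powr (1 / p) \<and>
      geo p t a b powr (1 - p) = a powr (1 - p) * y powr ((1 - p) / p) \<and> b powr (p - 1) \<le> a powr (p - 1) * d"
    if h: "0 < a" "0 < b" "\<delta> * b \<le> a" "\<delta> * a \<le> b" "0 \<le> t" "t \<le> 1" for a b t
  proof -
    define q where "q = (b / a) powr p"
    define y where "y = (1 - t) + t * q"
    have ba: "\<delta> \<le> b / a" "b / a \<le> inverse \<delta>"
      using h \<delta> by (simp_all add: field_simps)
    have q: "c \<le> q" "q \<le> d"
      unfolding c_def d_def q_def using \<delta> p ba h by (auto intro!: powr_mono2)
    have y1: "y = 1 + t * (q - 1)" by (simp add: y_def algebra_simps)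
    have qd: "\<bar>q - 1\<bar> \<le> d" using q c by (auto simp: abs_le_iff)
    have 1: "c \<le> y"
    proof -
      have "(1 - t) * c + t * c \<le> y"
        unfolding y_def using c q h by (intro add_mono mult_left_mono) (auto intro: mult_right_le_one_le[of "1 - t" c, simplified] order_trans[OF mult_left_le])
      then show ?thesis by (simp add: algebra_simps)
    qed
    have 2: "y \<le> d"
    proof -
      have "y \<le> (1 - t) * d + t * d"
        unfolding y_def using c q h by (intro add_mono mult_left_mono) (auto simp: mult_le_cancel_left1)
      then show ?thesis by (simp add: algebra_simps)
    qed
    have 3: "\<bar>y - 1\<bar> \<le> d * t"
      unfolding y1 using qd h mult_left_mono[OF qd h(5)] by (simp add: abs_mult mult.commute)
    have rad: "(1 - t) * a powr p + t * b powr p = a powr p * y"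
      using h by (simp add: y_def q_def powr_divide algebra_simps)
    have ypos: "0 < y" using 1 c by linarith
    have 4: "geo p t a b = a * y powr (1 / p)"
      unfolding geo_def rad using h p ypos by (simp add: powr_mult powr_powr)
    have 5: "geo p t a b powr (1 - p) = a powr (1 - p) * y powr ((1 - p) / p)"
      unfolding 4 using h ypos by (simp add: powr_mult powr_powr)
    have "b powr (p - 1) = a powr (p - 1) * (b / a) powr (p - 1)"
      using h by (simp add: powr_divide)
    also have "(b / a) powr (p - 1) \<le> inverse \<delta> powr (p - 1)"
      using ba h p by (intro powr_mono2) auto
    also have "inverse \<delta> powr (p - 1) \<le> d"
      unfolding d_def using \<delta> by (intro powr_mono) (auto simp: one_le_inverse_iff)
    finally have 6: "b powr (p - 1) \<le> a powr (p - 1) * d" using h by (simp add: mult_left_mono)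
    show ?thesis using 1 2 3 4 5 6 by blast
  qed
  show ?thesis
  proof (rule that[of K])
    show "0 \<le> K" using nn B by (simp add: K_def)
    fix a b t :: real and V W :: 'a
    assume h: "0 < a" "0 < b" "\<delta> * b \<le> a" "\<delta> * a \<le> b" "0 \<le> t" "t \<le> 1"
    obtain y where y: "c \<le> y" "y \<le> d" "\<bar>y - 1\<bar> \<le> d * t" "geo p t a b = a * y powr (1 / p)"
      "geo p t a b powr (1 - p) = a powr (1 - p) * y powr ((1 - p) / p)" "b powr (p - 1) \<le> a powr (p - 1) * d"
      using main[OF h] by metis
    have "\<bar>geo p t a b - a\<bar> = a * \<bar>y powr (1 / p) - 1\<bar>"
    proof -
      have "a * y powr (1 / p) - a = a * (y powr (1 / p) - 1)" by (simp add: right_diff_distrib)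
      then show ?thesis unfolding y(4) using h(1) by (simp only: abs_mult abs_of_pos)
    qed
    also have "\<dots> \<le> a * (K1 * (d * t))"
      using h(1) K1(2)[OF y(1,2)] mult_left_mono[OF y(3) K1(1)] by (intro mult_left_mono) linarith+
    also have "\<dots> \<le> K * t * a"
    proof -
      have "K1 * d * (t * a) \<le> K * (t * a)" using nn B h by (intro mult_right_mono) (auto simp: K_def)
      then show ?thesis by (simp add: ac_simps)
    qed
    finally show "\<bar>geo p t a b - a\<bar> \<le> K * t * a" .
    define z where "z = y powr ((1 - p) / p)"
    have z0: "0 \<le> z" by (simp add: z_def)
    have z1: "\<bar>z - 1\<bar> \<le> K2 * d * t"
      unfolding z_def using K2(2)[OF y(1,2)] mult_left_mono[OF y(3) K2(1)] by (simp add: ac_simps)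
    have zB: "z \<le> B"
    proof -
      have "K2 * d * t \<le> K2 * d * 1" using nn(2) h(6) by (intro mult_left_mono) auto
      then show ?thesis using z1 by (simp add: B_def)
    qed
    have aa: "a powr (1 - p) * a powr (p - 1) = 1"
      using h(1) by (simp flip: powr_add)
    have "geo_grad p t a b V W - V = (z * (1 - t) - 1) *\<^sub>R V + (a powr (1 - p) * z * (t * b powr (p - 1))) *\<^sub>R W"
    proof -
      have "a powr (1 - p) * z * ((1 - t) * a powr (p - 1)) = z * (1 - t)"
        using aa by (simp add: ac_simps)
      then show ?thesis
        unfolding geo_grad_def y(5) z_def[symmetric] by (simp add: scaleR_add_right scaleR_diff_left)
    qed
    also have "norm \<dots> \<le> \<bar>z * (1 - t) - 1\<bar> * norm V + (a powr (1 - p) * z * (t * b powr (p - 1))) * norm W"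
      by (rule order_trans[OF norm_triangle_ineq]) (use z0 h in \<open>simp add: abs_mult\<close>)
    also have "\<dots> \<le> (K * t) * norm V + (K * t) * norm W"
    proof (intro add_mono mult_right_mono norm_ge_zero)
      have "\<bar>z * (1 - t) - 1\<bar> \<le> \<bar>z - 1\<bar> + z * t"
        using z0 h(5) by (simp add: right_diff_distrib abs_le_iff) (smt (verit) mult_nonneg_nonneg)
      also have "\<dots> \<le> K2 * d * t + B * t"
        using z1 zB h(5) by (intro add_mono mult_right_mono)
      also have "\<dots> \<le> K * t"
        unfolding distrib_right[symmetric] using nn h(5) by (intro mult_right_mono) (simp_all add: K_def)
      finally show "\<bar>z * (1 - t) - 1\<bar> \<le> K * t" .
      have "a powr (1 - p) * z * (t * b powr (p - 1)) \<le> a powr (1 - p) * B * (t * (a powr (p - 1) * d))"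
        using zB z0 h(5) y(6) B by (intro mult_mono mult_left_mono) auto
      also have "\<dots> = (a powr (1 - p) * a powr (p - 1)) * (B * d * t)" by (simp add: ac_simps)
      also have "\<dots> = B * d * t" by (simp add: aa)
      also have "\<dots> \<le> K * t"
        using nn B h(5) by (intro mult_right_mono) (simp_all add: K_def)
      finally show "a powr (1 - p) * z * (t * b powr (p - 1)) \<le> K * t" .
    qed
    finally show "norm (geo_grad p t a b V W - V) \<le> K * t * (norm V + norm W)"
      by (simp add: distrib_left)
  qed
qed

text \<open>Mean value points are compared across the two halves. The midpoint version is the one
  wanted, because the equality cases are read off at t = 1/2.\<close>

lemma midpoint_strictly_convex:
  fixes f f' :: "real \<Rightarrow> real"
  assumes f: "\<And>x. x \<in> {a..b} \<Longrightarrow> (f has_real_derivative f' x) (at x)"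
    and m: "\<And>x y. a < x \<Longrightarrow> x < y \<Longrightarrow> y < b \<Longrightarrow> f' x < f' y" and "a < b"
  shows "f ((a + b) / 2) < (f a + f b) / 2"
proof -
  let ?c = "(a + b) / 2"
  have c: "a < ?c" "?c < b" using \<open>a < b\<close> by auto
  have "\<exists>z. a < z \<and> z < ?c \<and> f ?c - f a = (?c - a) * f' z"
    using c by (intro MVT2 f) auto
  then obtain y where y: "a < y" "y < ?c" "f ?c - f a = (?c - a) * f' y" by metis
  have "\<exists>z. ?c < z \<and> z < b \<and> f b - f ?c = (b - ?c) * f' z"
    using c by (intro MVT2 f) auto
  then obtain z where z: "?c < z" "z < b" "f b - f ?c = (b - ?c) * f' z" by metis
  have "f' y < f' z" using y z by (intro m) auto
  then have "(?c - a) * f' y < (?c - a) * f' z" using c by (intro mult_strict_left_mono) auto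
  moreover have e: "b - ?c = ?c - a" by (simp add: field_simps)
  ultimately have "f ?c - f a < f b - f ?c" unfolding y(3) z(3) e by simp
  moreover have "q - r < s - q \<Longrightarrow> q < (r + s) / 2" for q r s :: real by (simp add: field_simps)
  ultimately show ?thesis by blast
qed

text \<open>The chain rule is applied to the p-th powers of both functions and then to the p-th root
  of their combination; positivity keeps all arguments in the open half-line.\<close>

lemma is_weak_gradient_geo:
  fixes u v :: "'a::euclidean_space \<Rightarrow> real"
  assumes "open \<Omega>" "1 < p" "0 \<le> t" "t \<le> 1"
    and u: "continuous_on \<Omega> u" "\<And>x. x \<in> \<Omega> \<Longrightarrow> 0 < u x" "is_weak_gradient \<Omega> u V"
    and v: "continuous_on \<Omega> v" "\<And>x. x \<in> \<Omega> \<Longrightarrow> 0 < v x" "is_weak_gradient \<Omega> v W"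
  shows "continuous_on \<Omega> (\<lambda>x. geo p t (u x) (v x))"
    "is_weak_gradient \<Omega> (\<lambda>x. geo p t (u x) (v x)) (\<lambda>x. geo_grad p t (u x) (v x) (V x) (W x))"
proof -
  have pw: "is_weak_gradient \<Omega> (\<lambda>x. w x powr p) (\<lambda>x. (p * w x powr (p - 1)) *\<^sub>R Z x)"
    if "continuous_on \<Omega> w" "\<And>x. x \<in> \<Omega> \<Longrightarrow> 0 < w x" "is_weak_gradient \<Omega> w Z" for w :: "'a \<Rightarrow> real" and Z
    by (rule is_weak_gradient_chain[OF assms(1) that(1,3,2)])
       (auto intro!: derivative_eq_intros continuous_intros)
  define s where "s x = (1 - t) * u x powr p + t * v x powr p" for x
  define S where "S x = (1 - t) *\<^sub>R (p * u x powr (p - 1)) *\<^sub>R V x + t *\<^sub>R (p * v x powr (p - 1)) *\<^sub>R W x" for x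
  have s: "is_weak_gradient \<Omega> s S"
    unfolding s_def S_def by (rule is_weak_gradient_combine[OF assms(1) pw[OF u] pw[OF v]])
  have cs: "continuous_on \<Omega> s"
    unfolding s_def using u(1,2) v(1,2) by (intro continuous_intros) force+
  have ps: "0 < s x" if "x \<in> \<Omega>" for x
    unfolding s_def using assms(3,4) u(2)[OF that] v(2)[OF that] by (intro geo_radicand_pos)
  have geo: "geo p t (u x) (v x) = s x powr (1 / p)" for x by (simp add: geo_def s_def)
  show "continuous_on \<Omega> (\<lambda>x. geo p t (u x) (v x))"
    unfolding geo using cs ps by (intro continuous_intros) force+
  have "is_weak_gradient \<Omega> (\<lambda>x. s x powr (1 / p)) (\<lambda>x. (1 / p * s x powr (1 / p - 1)) *\<^sub>R S x)"
    by (rule is_weak_gradient_chain[OF assms(1) cs s ps])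
       (use assms(2) in \<open>auto intro!: derivative_eq_intros continuous_intros\<close>)
  moreover have "(1 / p * s x powr (1 / p - 1)) *\<^sub>R S x = geo_grad p t (u x) (v x) (V x) (W x)" for x
  proof -
    have "geo p t (u x) (v x) powr (1 - p) = s x powr (1 / p - 1)"
      using assms(2) by (simp add: geo powr_powr diff_divide_distrib)
    then show ?thesis
      unfolding geo_grad_def S_def using assms(2) by (simp add: scaleR_add_right)
  qed
  ultimately show "is_weak_gradient \<Omega> (\<lambda>x. geo p t (u x) (v x)) (\<lambda>x. geo_grad p t (u x) (v x) (V x) (W x))"
    by (simp add: geo)
qed

section \<open>Sobolev spaces\<close>

text \<open>The sum is at most five times its largest term. Five summands are what the gradient
  error of the regularised curve splits into.\<close>

lemma powr_sum5_le:
  fixes a b c d e r :: real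
  assumes "0 \<le> a" "0 \<le> b" "0 \<le> c" "0 \<le> d" "0 \<le> e" "0 < r"
  shows "(a + b + c + d + e) powr r \<le> 5 powr r * (a powr r + b powr r + c powr r + d powr r + e powr r)"
proof -
  define m where "m = max a (max b (max c (max d e)))"
  have m: "a \<le> m" "b \<le> m" "c \<le> m" "d \<le> m" "e \<le> m" by (auto simp: m_def)
  have "(a + b + c + d + e) powr r \<le> (5 * m) powr r"
    using assms m by (intro powr_mono2) auto
  also have "\<dots> = 5 powr r * m powr r" using assms m by (simp add: powr_mult)
  also have "m powr r \<le> a powr r + b powr r + c powr r + d powr r + e powr r"
  proof -
    have "m = a \<or> m = b \<or> m = c \<or> m = d \<or> m = e" by (simp add: m_def max_def)
    moreover have "0 \<le> x powr r" for x :: real by simp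
    ultimately show ?thesis
      using \<open>\<And>x. 0 \<le> x powr r\<close>[of a] \<open>\<And>x. 0 \<le> x powr r\<close>[of b] \<open>\<And>x. 0 \<le> x powr r\<close>[of c]
        \<open>\<And>x. 0 \<le> x powr r\<close>[of d] \<open>\<And>x. 0 \<le> x powr r\<close>[of e] by (elim disjE; hypsubst; linarith)
  qed
  finally show ?thesis by simp
qed

lemma powr_sum2_le:
  fixes a b r :: real
  assumes "0 \<le> a" "0 \<le> b" "0 < r"
  shows "(a + b) powr r \<le> 5 powr r * (a powr r + b powr r)"
  using powr_sum5_le[of a b 0 0 0 r] assms by simp

lemma in_Lp_bound:
  fixes f :: "'a::euclidean_space \<Rightarrow> 'b::euclidean_space"
  assumes "0 < r" and f: "f \<in> borel_measurable (lebesgue_on \<Omega>)"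
    and g: "integrable (lebesgue_on \<Omega>) g" and le: "AE x in lebesgue_on \<Omega>. norm (f x) powr r \<le> g x"
  shows "in_Lp \<Omega> r f"
  unfolding in_Lp_def
proof (intro conjI f)
  show "integrable (lebesgue_on \<Omega>) (\<lambda>x. norm (f x) powr r)"
  proof (rule Bochner_Integration.integrable_bound[OF g])
    show "(\<lambda>x. norm (f x) powr r) \<in> borel_measurable (lebesgue_on \<Omega>)" using f by measurable
    show "AE x in lebesgue_on \<Omega>. norm (norm (f x) powr r) \<le> norm (g x)"
      using le by eventually_elim auto
  qed
qed

lemma in_Lp_combine:
  fixes f g :: "'a::euclidean_space \<Rightarrow> 'b::euclidean_space"
  assumes "0 < r" "in_Lp \<Omega> r f" "in_Lp \<Omega> r g"
  shows "in_Lp \<Omega> r (\<lambda>x. a *\<^sub>R f x + b *\<^sub>R g x)"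
proof (rule in_Lp_bound[OF assms(1)])
  show "(\<lambda>x. a *\<^sub>R f x + b *\<^sub>R g x) \<in> borel_measurable (lebesgue_on \<Omega>)"
    using assms by (auto simp: in_Lp_def intro!: borel_measurable_add borel_measurable_scaleR)
  show "integrable (lebesgue_on \<Omega>) (\<lambda>x. 5 powr r * (\<bar>a\<bar> powr r * norm (f x) powr r + \<bar>b\<bar> powr r * norm (g x) powr r))"
    using assms by (simp add: in_Lp_def)
  show "AE x in lebesgue_on \<Omega>. norm (a *\<^sub>R f x + b *\<^sub>R g x) powr r \<le>
      5 powr r * (\<bar>a\<bar> powr r * norm (f x) powr r + \<bar>b\<bar> powr r * norm (g x) powr r)"
  proof (intro AE_I2)
    fix x
    have "norm (a *\<^sub>R f x + b *\<^sub>R g x) powr r \<le> (\<bar>a\<bar> * norm (f x) + \<bar>b\<bar> * norm (g x)) powr r"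
      using norm_triangle_ineq[of "a *\<^sub>R f x" "b *\<^sub>R g x"] assms(1) by (intro powr_mono2) auto
    also have "\<dots> \<le> 5 powr r * ((\<bar>a\<bar> * norm (f x)) powr r + (\<bar>b\<bar> * norm (g x)) powr r)"
      using assms(1) by (intro powr_sum2_le) auto
    finally show "norm (a *\<^sub>R f x + b *\<^sub>R g x) powr r \<le>
      5 powr r * (\<bar>a\<bar> powr r * norm (f x) powr r + \<bar>b\<bar> powr r * norm (g x) powr r)"
      by (simp add: powr_mult)
  qed
qed

lemma in_Lp_cong_AE:
  assumes "open \<Omega>" "in_Lp \<Omega> r f" "AE x in lebesgue_on \<Omega>. f x = g x"
  shows "in_Lp \<Omega> r g"
proof -
  have "AE x in lebesgue_on \<Omega>. norm (f x) powr r = norm (g x) powr r"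
    using assms(3) by eventually_elim simp
  note i = integral_lebesgue_on_cong_AE(2)[OF sets_lebesgue_open[OF assms(1)] this]
  have "g \<in> borel_measurable (lebesgue_on \<Omega>)"
    by (rule borel_measurable_lebesgue_on_AE[OF sets_lebesgue_open[OF assms(1)] _ assms(3)])
       (use assms(2) in \<open>simp add: in_Lp_def\<close>)
  then show ?thesis
    using assms(2) i by (simp add: in_Lp_def)
qed

lemma W1_weak_gradient:
  assumes "open \<Omega>" "u \<in> W1 \<Omega> r"
  shows "is_weak_gradient \<Omega> u (weak_gradient \<Omega> u)" "in_Lp \<Omega> r (weak_gradient \<Omega> u)" "in_Lp \<Omega> r u"
proof -
  obtain V where V: "is_weak_gradient \<Omega> u V" "in_Lp \<Omega> r V" and u: "in_Lp \<Omega> r u"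
    using assms(2) unfolding W1_def by blast
  show "is_weak_gradient \<Omega> u (weak_gradient \<Omega> u)" using weak_gradient_works[OF V(1)] .
  have "AE x in lebesgue_on \<Omega>. V x = weak_gradient \<Omega> u x"
    using weak_gradient_AE[OF assms(1) V(1)] by eventually_elim simp
  then show "in_Lp \<Omega> r (weak_gradient \<Omega> u)" by (rule in_Lp_cong_AE[OF assms(1) V(2)])
  show "in_Lp \<Omega> r u" by fact
qed

lemma W1I: "in_Lp \<Omega> r u \<Longrightarrow> is_weak_gradient \<Omega> u V \<Longrightarrow> in_Lp \<Omega> r V \<Longrightarrow> u \<in> W1 \<Omega> r"
  unfolding W1_def by blast

lemma W1_combine:
  assumes "open \<Omega>" "0 < r" "u \<in> W1 \<Omega> r" "v \<in> W1 \<Omega> r"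
  shows "(\<lambda>x. a * u x + b * v x) \<in> W1 \<Omega> r"
  using in_Lp_combine[OF assms(2) W1_weak_gradient(3)[OF assms(1,3)] W1_weak_gradient(3)[OF assms(1,4)], of a b]
    is_weak_gradient_combine[OF assms(1) W1_weak_gradient(1)[OF assms(1,3)] W1_weak_gradient(1)[OF assms(1,4)]]
    in_Lp_combine[OF assms(2) W1_weak_gradient(2)[OF assms(1,3)] W1_weak_gradient(2)[OF assms(1,4)]]
  by (intro W1I) auto

lemma sobolev_norm_eq:
  assumes "open \<Omega>" "is_weak_gradient \<Omega> u V"
  shows "sobolev_norm \<Omega> r u = (LINT x|lebesgue_on \<Omega>. \<bar>u x\<bar> powr r + norm (V x) powr r) powr (1 / r)"
proof -
  have "AE x in lebesgue_on \<Omega>. \<bar>u x\<bar> powr r + norm (weak_gradient \<Omega> u x) powr r = \<bar>u x\<bar> powr r + norm (V x) powr r"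
    using weak_gradient_AE[OF assms] by eventually_elim simp
  from integral_lebesgue_on_cong_AE(1)[OF sets_lebesgue_open[OF assms(1)] this]
  show ?thesis unfolding sobolev_norm_def by simp
qed

lemma sobolev_norm_powr:
  assumes "open \<Omega>" "0 < r" "is_weak_gradient \<Omega> u V"
  shows "(LINT x|lebesgue_on \<Omega>. \<bar>u x\<bar> powr r + norm (V x) powr r) = sobolev_norm \<Omega> r u powr r"
  unfolding sobolev_norm_eq[OF assms(1,3)] using assms(2)
  by (simp add: powr_powr Bochner_Integration.integral_nonneg)

lemma integrable_bounded_lebesgue_on:
  fixes f :: "'a::euclidean_space \<Rightarrow> 'b::euclidean_space"
  assumes "open \<Omega>" "bounded \<Omega>" "f \<in> borel_measurable (lebesgue_on \<Omega>)" "AE x in lebesgue_on \<Omega>. norm (f x) \<le> M"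
  shows "integrable (lebesgue_on \<Omega>) f"
proof -
  have "\<Omega> \<in> lmeasurable" using assms(1,2) by (rule lmeasurable_open[rotated])
  then interpret finite_measure "lebesgue_on \<Omega>" by (rule finite_measure_lebesgue_on)
  show ?thesis using assms by (intro integrable_const_bound)
qed

section \<open>Approximation in \<open>W1_0\<close>\<close>

text \<open>Mollification commutes with differentiation, so for a C^1 function with compact support
  the values and all partial derivatives are approximated uniformly at once.\<close>

lemma sobolev_approximation_smooth:
  fixes D :: "'a::euclidean_space \<Rightarrow> real"
  assumes "open \<Omega>" "bounded \<Omega>" "0 < r" "0 < e"
    and D: "Cc_in \<Omega> D" "\<And>x. (D has_derivative D' x) (at x)" "\<And>v. continuous_on UNIV (\<lambda>x. D' x v)"
  shows "\<exists>\<phi> \<phi>'. \<phi> \<in> test_functions \<Omega> \<and> is_weak_gradient \<Omega> \<phi> \<phi>' \<and>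
    \<phi> \<in> borel_measurable (lebesgue_on \<Omega>) \<and> \<phi>' \<in> borel_measurable (lebesgue_on \<Omega>) \<and>
    (\<forall>x. \<bar>D x - \<phi> x\<bar> \<le> e) \<and> (\<forall>x. norm ((\<Sum>i\<in>Basis. D' x i *\<^sub>R i) - \<phi>' x) \<le> e)"
proof -
  obtain K where K: "compact K" "K \<subseteq> \<Omega>" "\<And>x. x \<notin> K \<Longrightarrow> D x = 0"
    using Cc_inE[OF D(1)] by metis
  obtain d \<epsilon> and \<rho> :: "nat \<Rightarrow> 'a \<Rightarrow> real"
    where d: "0 < d" "(\<Union>x\<in>K. cball x d) \<subseteq> \<Omega>" and \<epsilon>: "\<And>n. 0 < \<epsilon> n" "\<And>n. \<epsilon> n < d / 4" "\<epsilon> \<longlonglongrightarrow> 0"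
    and r: "\<And>n. mollifier (\<epsilon> n) (\<rho> n)"
    using mollification_sequence[OF \<open>open \<Omega>\<close> K(1,2)] by metis
  have sub: "(\<Union>x\<in>K. cball x (\<epsilon> n)) \<subseteq> (\<Union>x\<in>K. cball x d)" for n
    using \<epsilon>(2)[of n] d(1) by (intro UN_mono subset_cball) auto
  \<comment> \<open>The norm of the gradient error is at most the sum over the coordinates, so each
    one gets an equal share of \<open>e\<close>.\<close>
  define e' where "e' = e / real DIM('a)"
  have e': "0 < e'" using assms(4) by (simp add: e'_def)
  note DC = Cc_in_imp_Cc[OF D(1)]
  have D'C: "Cc (\<lambda>x. D' x i)" for i
    by (rule Cc_in_imp_Cc[OF Cc_in_derivative[OF D]])
  have "\<forall>\<^sub>F n in sequentially. (\<forall>x. \<bar>conv D (\<rho> n) x - D x\<bar> \<le> e) \<and>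
      (\<forall>i\<in>Basis. \<forall>x. \<bar>conv (\<lambda>x. D' x i) (\<rho> n) x - D' x i\<bar> \<le> e')"
    by (intro eventually_conj conv_uniform_limit[OF DC r \<epsilon>(3) assms(4)]
        eventually_ball_finite finite_Basis ballI conv_uniform_limit[OF D'C r \<epsilon>(3) e'])
  then obtain n where n: "\<And>x. \<bar>conv D (\<rho> n) x - D x\<bar> \<le> e"
    "\<And>i x. i \<in> Basis \<Longrightarrow> \<bar>conv (\<lambda>x. D' x i) (\<rho> n) x - D' x i\<bar> \<le> e'"
    using eventually_happens'[OF sequentially_bot] by blast
  let ?\<phi> = "conv D (\<rho> n)"
  let ?\<phi>' = "\<lambda>x. \<Sum>i\<in>Basis. conv (\<lambda>x. D' x i) (\<rho> n) x *\<^sub>R i"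
  have t: "?\<phi> \<in> test_functions \<Omega>"
    by (rule Cc_in_conv(1)[OF DC K(3,1) subset_trans[OF sub d(2)] r])
  have b: "bounded {x. D x \<noteq> 0}" "bounded {x. D' x v \<noteq> 0}" for v
    using DC D'C by (auto simp: Cc_def)
  have sw: "conv D (\<lambda>z. frechet_derivative (\<rho> n) (at z) v) x = conv (\<lambda>x. D' x v) (\<rho> n) x" for v x
    by (rule conv_derivative_swap[OF D(2,3) mollifierD(1,2)[OF r] b])
  have der: "(?\<phi> has_derivative (\<lambda>v. conv (\<lambda>x. D' x v) (\<rho> n) x)) (at x)" for x
    using has_derivative_conv[OF DC mollifierD(1,2)[OF r], of n x] unfolding sw .
  have cont: "continuous_on UNIV (\<lambda>x. conv (\<lambda>x. D' x v) (\<rho> n) x)" for v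
    by (rule continuous_on_conv[OF D'C mollifierD(3)[OF r]])
  have wg: "is_weak_gradient \<Omega> ?\<phi> ?\<phi>'"
    by (rule is_weak_gradient_classical[OF assms(1) der cont])
  have "continuous_on UNIV ?\<phi>'" by (intro continuous_intros cont)
  then have m2: "?\<phi>' \<in> borel_measurable (lebesgue_on \<Omega>)"
    by (intro continuous_imp_measurable_on_sets_lebesgue sets_lebesgue_open[OF assms(1)]) (auto intro: continuous_on_subset)
  have m1: "?\<phi> \<in> borel_measurable (lebesgue_on \<Omega>)"
    using t by (intro borel_measurable_lebesgue_on_continuous sets_lebesgue_open[OF assms(1)]) (auto simp: test_functions_iff Cc_in_def)
  have est: "norm ((\<Sum>i\<in>Basis. D' x i *\<^sub>R i) - ?\<phi>' x) \<le> e" for x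
  proof -
    have "(\<Sum>i\<in>Basis. D' x i *\<^sub>R i) - ?\<phi>' x = (\<Sum>i\<in>Basis. (D' x i - conv (\<lambda>x. D' x i) (\<rho> n) x) *\<^sub>R i)"
      by (simp add: sum_subtractf scaleR_diff_left)
    also have "norm \<dots> \<le> (\<Sum>i\<in>(Basis::'a set). e')"
      using n(2)[of _ x] by (intro sum_norm_le) (simp add: abs_minus_commute)
    also have "\<dots> = e" by (simp add: e'_def)
    finally show ?thesis .
  qed
  have "\<bar>D x - ?\<phi> x\<bar> \<le> e" for x using n(1)[of x] by (simp add: abs_minus_commute)
  then show ?thesis using t wg m1 m2 est by (intro exI[of _ ?\<phi>] exI[of _ ?\<phi>'] conjI allI)
qed

text \<open>Membership may be tested with compactly supported C^1 functions \<open>D n\<close>: a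
  further mollification costs a uniform error, which is small in the Sobolev norm because the domain
  has finite measure.\<close>

lemma W1_0_I:
  fixes w :: "'a::euclidean_space \<Rightarrow> real"
  assumes "open \<Omega>" "bounded \<Omega>" "0 < r" and w: "w \<in> W1 \<Omega> r" "is_weak_gradient \<Omega> w Z" "in_Lp \<Omega> r Z"
    and D: "\<And>n. Cc_in \<Omega> (D n)" "\<And>n x. (D n has_derivative D' n x) (at x)" "\<And>n v. continuous_on UNIV (\<lambda>x. D' n x v)"
    and int: "\<And>n. integrable (lebesgue_on \<Omega>) (\<lambda>x. \<bar>w x - D n x\<bar> powr r + norm (Z x - (\<Sum>i\<in>Basis. D' n x i *\<^sub>R i)) powr r)"
    and lim: "(\<lambda>n. LINT x|lebesgue_on \<Omega>. \<bar>w x - D n x\<bar> powr r + norm (Z x - (\<Sum>i\<in>Basis. D' n x i *\<^sub>R i)) powr r) \<longlonglongrightarrow> 0"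
  shows "w \<in> W1_0 \<Omega> r"
  unfolding W1_0_def
proof (intro CollectI conjI w(1) allI impI)
  fix \<epsilon> :: real assume "0 < \<epsilon>"
  have "\<Omega> \<in> lmeasurable" using assms(1,2) by (rule lmeasurable_open[rotated])
  then interpret finite_measure "lebesgue_on \<Omega>" by (rule finite_measure_lebesgue_on)
  define \<mu> where "\<mu> = measure (lebesgue_on \<Omega>) (space (lebesgue_on \<Omega>))"
  \<comment> \<open>The total error is below \<open>5 powr r * (c + 2 * c)\<close>: one
    \<open>c\<close> for the distance to \<open>D n\<close>, and two for the uniform error
    \<open>e\<close> in value and gradient, whose r-th power times the measure is at most
    \<open>c\<close>. The \<open>\<mu> + 1\<close> below avoids dividing by zero.\<close>
  define c where "c = \<epsilon> powr r / (5 powr r * 4)"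
  have c: "0 < c" using \<open>0 < \<epsilon>\<close> by (simp add: c_def)
  define e where "e = (c / (\<mu> + 1)) powr (1 / r)"
  have \<mu>: "0 \<le> \<mu>" by (simp add: \<mu>_def)
  have e: "0 < e" using c \<mu> by (simp add: e_def)
  have er: "e powr r * \<mu> \<le> c"
  proof -
    have "e powr r = c / (\<mu> + 1)" using c \<mu> assms(3) by (simp add: e_def powr_powr)
    then have "e powr r + e powr r * \<mu> = c" using c \<mu> by (simp add: field_simps)
    then show ?thesis using powr_ge_zero[of e r] by linarith
  qed
  obtain n where n: "(LINT x|lebesgue_on \<Omega>. \<bar>w x - D n x\<bar> powr r + norm (Z x - (\<Sum>i\<in>Basis. D' n x i *\<^sub>R i)) powr r) < c"
  proof -
    obtain N where "\<forall>n\<ge>N. (LINT x|lebesgue_on \<Omega>. \<bar>w x - D n x\<bar> powr r + norm (Z x - (\<Sum>i\<in>Basis. D' n x i *\<^sub>R i)) powr r) < c"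
      using order_tendstoD(2)[OF lim c] unfolding eventually_sequentially by (rule exE)
    then show ?thesis by (intro that[of N]) (erule allE[of _ N], erule mp, rule order_refl)
  qed
  obtain \<phi> \<phi>' where t: "\<phi> \<in> test_functions \<Omega>" "is_weak_gradient \<Omega> \<phi> \<phi>'"
    "\<phi> \<in> borel_measurable (lebesgue_on \<Omega>)" "\<phi>' \<in> borel_measurable (lebesgue_on \<Omega>)"
    and a': "\<forall>x. \<bar>D n x - \<phi> x\<bar> \<le> e" "\<forall>x. norm ((\<Sum>i\<in>Basis. D' n x i *\<^sub>R i) - \<phi>' x) \<le> e"
    using sobolev_approximation_smooth[OF assms(1-3) e D(1)[of n] D(2)[of n] D(3)[of n]]
    by (elim exE conjE) (rule that)
  note a = a'(1)[THEN spec] a'(2)[THEN spec]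
  let ?f = "\<lambda>x. \<bar>w x - D n x\<bar> powr r + norm (Z x - (\<Sum>i\<in>Basis. D' n x i *\<^sub>R i)) powr r"
  let ?g = "\<lambda>x. \<bar>w x - \<phi> x\<bar> powr r + norm (Z x - \<phi>' x) powr r"
  have wg: "is_weak_gradient \<Omega> (\<lambda>x. w x - \<phi> x) (\<lambda>x. Z x - \<phi>' x)"
    using is_weak_gradient_combine[OF assms(1) w(2) t(2), of 1 "-1"] by simp
  have "(LINT x|lebesgue_on \<Omega>. ?g x) \<le> (LINT x|lebesgue_on \<Omega>. 5 powr r * (?f x + 2 * e powr r))"
  proof (rule Bochner_Integration.integral_mono')
    show "integrable (lebesgue_on \<Omega>) (\<lambda>x. 5 powr r * (?f x + 2 * e powr r))"
      by (intro integrable_mult_right Bochner_Integration.integrable_add[OF int[of n]] integrable_const)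
    show "?g x \<le> 5 powr r * (?f x + 2 * e powr r)" if "x \<in> space (lebesgue_on \<Omega>)" for x
    proof -
      have "\<bar>w x - \<phi> x\<bar> powr r \<le> (\<bar>w x - D n x\<bar> + e) powr r"
        using a(1)[of x] assms(3) by (intro powr_mono2) auto
      also have "\<dots> \<le> 5 powr r * (\<bar>w x - D n x\<bar> powr r + e powr r)"
        using e assms(3) by (intro powr_sum2_le) auto
      finally have 1: "\<bar>w x - \<phi> x\<bar> powr r \<le> 5 powr r * (\<bar>w x - D n x\<bar> powr r + e powr r)" .
      have "norm (Z x - \<phi>' x) \<le> norm (Z x - (\<Sum>i\<in>Basis. D' n x i *\<^sub>R i)) + e"
        using norm_triangle_ineq[of "Z x - (\<Sum>i\<in>Basis. D' n x i *\<^sub>R i)" "(\<Sum>i\<in>Basis. D' n x i *\<^sub>R i) - \<phi>' x"] a(2)[of x]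
        by simp
      then have "norm (Z x - \<phi>' x) powr r \<le> (norm (Z x - (\<Sum>i\<in>Basis. D' n x i *\<^sub>R i)) + e) powr r"
        using assms(3) by (intro powr_mono2) auto
      also have "\<dots> \<le> 5 powr r * (norm (Z x - (\<Sum>i\<in>Basis. D' n x i *\<^sub>R i)) powr r + e powr r)"
        using e assms(3) by (intro powr_sum2_le) auto
      finally show ?thesis using 1 by (simp add: algebra_simps)
    qed
  qed simp
  also have "\<dots> = 5 powr r * ((LINT x|lebesgue_on \<Omega>. ?f x) + 2 * e powr r * \<mu>)"
  proof -
    have "(LINT x|lebesgue_on \<Omega>. ?f x + 2 * e powr r) = (LINT x|lebesgue_on \<Omega>. ?f x) + (LINT x|lebesgue_on \<Omega>. 2 * e powr r)"
      by (rule Bochner_Integration.integral_add[OF int integrable_const])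
    also have "(LINT x|lebesgue_on \<Omega>. 2 * e powr r) = 2 * e powr r * \<mu>"
      by (simp add: \<mu>_def)
    finally show ?thesis by (simp only: integral_mult_right_zero)
  qed
  also have "\<dots> < 5 powr r * (c + 2 * c)"
    using n er by (intro mult_strict_left_mono) auto
  also have "\<dots> \<le> \<epsilon> powr r" using c by (simp add: c_def)
  finally have "(LINT x|lebesgue_on \<Omega>. ?g x) powr (1 / r) < (\<epsilon> powr r) powr (1 / r)"
    using assms(3) by (intro powr_less_mono2 Bochner_Integration.integral_nonneg) auto
  then have "sobolev_norm \<Omega> r (\<lambda>x. w x - \<phi> x) < \<epsilon>"
    unfolding sobolev_norm_eq[OF assms(1) wg] using \<open>0 < \<epsilon>\<close> assms(3) by (simp add: powr_powr)
  then show "\<exists>\<phi>\<in>test_functions \<Omega>. sobolev_norm \<Omega> r (\<lambda>x. w x - \<phi> x) < \<epsilon>"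
    using t(1) by blast
qed

section \<open>Increments of the curve in \<open>W1\<close>\<close>

definition comparable_on :: "real \<Rightarrow> 'a set \<Rightarrow> ('a \<Rightarrow> real) \<Rightarrow> ('a \<Rightarrow> real) \<Rightarrow> bool" where
  "comparable_on \<delta> \<Omega> u v \<longleftrightarrow> (\<forall>x\<in>\<Omega>. \<delta> * v x \<le> u x \<and> \<delta> * u x \<le> v x)"

text \<open>The properties that continuous representatives of the critical points share: positivity
  allows the chain rule for powers, and the upper bound makes \<open>G\<close> integrable along the
  curve.\<close>

definition pos_W1 :: "'a::euclidean_space set \<Rightarrow> real \<Rightarrow> ('a \<Rightarrow> real) \<Rightarrow> bool" where
  "pos_W1 \<Omega> r u \<longleftrightarrow> continuous_on \<Omega> u \<and> (\<forall>x\<in>\<Omega>. 0 < u x) \<and> (\<exists>M. \<forall>x\<in>\<Omega>. u x \<le> M) \<and> u \<in> W1 \<Omega> r"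

lemma pos_W1_measurable:
  assumes "open \<Omega>" "pos_W1 \<Omega> r u"
  shows "u \<in> borel_measurable (lebesgue_on \<Omega>)" "weak_gradient \<Omega> u \<in> borel_measurable (lebesgue_on \<Omega>)"
  using assms W1_weak_gradient[of \<Omega> u r] by (auto simp: pos_W1_def in_Lp_def)

lemma borel_measurable_geo:
  fixes V W :: "'a::euclidean_space \<Rightarrow> 'a"
  assumes [measurable]: "u \<in> borel_measurable (lebesgue_on \<Omega>)" "v \<in> borel_measurable (lebesgue_on \<Omega>)"
    "V \<in> borel_measurable (lebesgue_on \<Omega>)" "W \<in> borel_measurable (lebesgue_on \<Omega>)"
  shows "(\<lambda>x. geo p t (u x) (v x)) \<in> borel_measurable (lebesgue_on \<Omega>)"
    "(\<lambda>x. geo_grad p t (u x) (v x) (V x) (W x)) \<in> borel_measurable (lebesgue_on \<Omega>)"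
  unfolding geo_grad_def geo_def by measurable

text \<open>The pointwise estimates of \<open>geo_estimates\<close> are raised to the power
  \<open>r\<close> and integrated. A bound linear in \<open>t\<close> is what converts an error
  o(|w|) in the derivative of \<open>I\<close> into o(t).\<close>

lemma geo_diff_W1:
  fixes \<Omega> :: "'a::euclidean_space set"
  assumes "open \<Omega>" "bounded \<Omega>" and p: "1 < p" and r: "0 < r" and u: "pos_W1 \<Omega> r u" and v: "pos_W1 \<Omega> r v"
    and \<delta>: "0 < \<delta>" "\<delta> < 1" "comparable_on \<delta> \<Omega> u v"
  shows "\<exists>K\<ge>0. \<forall>t. 0 \<le> t \<longrightarrow> t \<le> 1 \<longrightarrow> (\<lambda>x. geo p t (u x) (v x) - u x) \<in> W1 \<Omega> r \<and>
      sobolev_norm \<Omega> r (\<lambda>x. geo p t (u x) (v x) - u x) \<le> K * t"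
proof -
  let ?V = "weak_gradient \<Omega> u" and ?W = "weak_gradient \<Omega> v"
  have uW: "u \<in> W1 \<Omega> r" "v \<in> W1 \<Omega> r" using u v by (auto simp: pos_W1_def)
  note wu = W1_weak_gradient[OF assms(1) uW(1)] and wv = W1_weak_gradient[OF assms(1) uW(2)]
  obtain K where K: "0 \<le> K"
    "\<And>a b t. 0 < a \<Longrightarrow> 0 < b \<Longrightarrow> \<delta> * b \<le> a \<Longrightarrow> \<delta> * a \<le> b \<Longrightarrow> 0 \<le> t \<Longrightarrow> t \<le> 1 \<Longrightarrow>
       \<bar>geo p t a b - a\<bar> \<le> K * t * a"
    "\<And>a b t (V::'a) W. 0 < a \<Longrightarrow> 0 < b \<Longrightarrow> \<delta> * b \<le> a \<Longrightarrow> \<delta> * a \<le> b \<Longrightarrow> 0 \<le> t \<Longrightarrow> t \<le> 1 \<Longrightarrow>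
       norm (geo_grad p t a b V W - V) \<le> K * t * (norm V + norm W)"
    using geo_estimates[OF p \<delta>(1,2)] by blast
  \<comment> \<open>After scaling by \<open>(K * t) powr r\<close> this dominates the increment
    together with its gradient; \<open>5 powr r\<close> comes from splitting the power of a sum of
    two gradient norms.\<close>
  define g where "g x = norm (u x) powr r + 5 powr r * (norm (?V x) powr r + norm (?W x) powr r)" for x
  have g: "integrable (lebesgue_on \<Omega>) g"
    unfolding g_def using wu(2,3) wv(2)
    by (intro Bochner_Integration.integrable_add integrable_mult_right) (auto simp: in_Lp_def)
  have g0: "0 \<le> g x" for x by (simp add: g_def)
  define C where "C = K * (LINT x|lebesgue_on \<Omega>. g x) powr (1 / r)"
  have "(\<lambda>x. geo p t (u x) (v x) - u x) \<in> W1 \<Omega> r \<and>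
      sobolev_norm \<Omega> r (\<lambda>x. geo p t (u x) (v x) - u x) \<le> C * t" if t: "0 \<le> t" "t \<le> 1" for t
  proof -
    define w where "w x = geo p t (u x) (v x) - u x" for x
    define Z where "Z x = geo_grad p t (u x) (v x) (?V x) (?W x) - ?V x" for x
    have wg: "is_weak_gradient \<Omega> w Z"
    proof -
      have "is_weak_gradient \<Omega> (\<lambda>x. geo p t (u x) (v x)) (\<lambda>x. geo_grad p t (u x) (v x) (?V x) (?W x))"
        using u v by (intro is_weak_gradient_geo(2)[OF assms(1) p t] wu(1) wv(1)) (auto simp: pos_W1_def)
      from is_weak_gradient_combine[OF assms(1) this wu(1), of 1 "-1"]
      show ?thesis by (simp add: w_def[abs_def] Z_def[abs_def])
    qed
    note m = pos_W1_measurable[OF assms(1) u] pos_W1_measurable[OF assms(1) v]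
    have mw: "w \<in> borel_measurable (lebesgue_on \<Omega>)" "Z \<in> borel_measurable (lebesgue_on \<Omega>)"
      unfolding w_def Z_def using m borel_measurable_geo[OF m(1,3,2,4), of p t] by auto
    have est: "norm (w x) powr r + norm (Z x) powr r \<le> (K * t) powr r * g x" if x: "x \<in> \<Omega>" for x
    proof -
      have h: "0 < u x" "0 < v x" "\<delta> * v x \<le> u x" "\<delta> * u x \<le> v x"
        using u v \<delta>(3) x by (auto simp: pos_W1_def comparable_on_def)
      have Kt: "0 \<le> K * t" using K(1) t by simp
      have "norm (w x) powr r \<le> (K * t * norm (u x)) powr r"
        using K(2)[OF h t] h(1) r by (intro powr_mono2) (auto simp: w_def)
      then have 1: "norm (w x) powr r \<le> (K * t) powr r * norm (u x) powr r" using Kt by (simp add: powr_mult)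
      have "norm (Z x) powr r \<le> (K * t * (norm (?V x) + norm (?W x))) powr r"
        using K(3)[OF h t] r by (intro powr_mono2) (auto simp: Z_def)
      also have "\<dots> = (K * t) powr r * (norm (?V x) + norm (?W x)) powr r" using Kt by (simp add: powr_mult)
      also have "\<dots> \<le> (K * t) powr r * (5 powr r * (norm (?V x) powr r + norm (?W x) powr r))"
        using r by (intro mult_left_mono powr_sum2_le) auto
      finally show ?thesis using 1 by (simp add: g_def distrib_left)
    qed
    have ig: "integrable (lebesgue_on \<Omega>) (\<lambda>x. (K * t) powr r * g x)" using g by simp
    have Lp: "in_Lp \<Omega> r w" "in_Lp \<Omega> r Z"
    proof -
      have 0: "0 \<le> norm (w x) powr r" "0 \<le> norm (Z x) powr r" for x by simp_all
      have "AE x in lebesgue_on \<Omega>. norm (w x) powr r \<le> (K * t) powr r * g x"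
      proof (rule AE_I2)
        fix x assume "x \<in> space (lebesgue_on \<Omega>)"
        then have "norm (w x) powr r + norm (Z x) powr r \<le> (K * t) powr r * g x" by (intro est) simp
        then show "norm (w x) powr r \<le> (K * t) powr r * g x" using 0[of x] by linarith
      qed
      then show "in_Lp \<Omega> r w" by (rule in_Lp_bound[OF r mw(1) ig])
      have "AE x in lebesgue_on \<Omega>. norm (Z x) powr r \<le> (K * t) powr r * g x"
      proof (rule AE_I2)
        fix x assume "x \<in> space (lebesgue_on \<Omega>)"
        then have "norm (w x) powr r + norm (Z x) powr r \<le> (K * t) powr r * g x" by (intro est) simp
        then show "norm (Z x) powr r \<le> (K * t) powr r * g x" using 0[of x] by linarith
      qed
      then show "in_Lp \<Omega> r Z" by (rule in_Lp_bound[OF r mw(2) ig])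
    qed
    have "sobolev_norm \<Omega> r w = (LINT x|lebesgue_on \<Omega>. \<bar>w x\<bar> powr r + norm (Z x) powr r) powr (1 / r)"
      by (rule sobolev_norm_eq[OF assms(1) wg])
    also have "\<dots> \<le> (LINT x|lebesgue_on \<Omega>. (K * t) powr r * g x) powr (1 / r)"
    proof (rule powr_mono2)
      show "(LINT x|lebesgue_on \<Omega>. \<bar>w x\<bar> powr r + norm (Z x) powr r) \<le> (LINT x|lebesgue_on \<Omega>. (K * t) powr r * g x)"
        using est g0 by (intro Bochner_Integration.integral_mono'[OF ig]) auto
    qed (use r in \<open>auto intro: Bochner_Integration.integral_nonneg\<close>)
    also have "\<dots> = C * t"
    proof -
      have "((K * t) powr r * (LINT x|lebesgue_on \<Omega>. g x)) powr (1 / r) = K * t * (LINT x|lebesgue_on \<Omega>. g x) powr (1 / r)"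
        using r K(1) t g0 by (simp add: powr_mult powr_powr Bochner_Integration.integral_nonneg)
      then show ?thesis by (simp add: C_def ac_simps)
    qed
    finally have "sobolev_norm \<Omega> r w \<le> C * t" .
    moreover have "w \<in> W1 \<Omega> r" by (rule W1I[OF Lp(1) wg Lp(2)])
    ultimately show ?thesis by (simp add: w_def[abs_def])
  qed
  moreover have "0 \<le> C" using K(1) by (simp add: C_def)
  ultimately show ?thesis by blast
qed

section \<open>Increments of the curve in \<open>W1_0\<close>\<close>

lemma has_derivative_pos_part_powr:
  assumes "1 < p"
  shows "((\<lambda>s. max 0 s powr p) has_real_derivative p * max 0 s powr (p - 1)) (at s)"
proof -
  consider "s < 0" | "s > 0" | "s = 0" by linarith
  then show ?thesis
  proof cases
    case 1
    have "((\<lambda>s. 0) has_real_derivative p * max 0 s powr (p - 1)) (at s)" using 1 by (simp add: max_def)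
    then show ?thesis
      by (rule has_field_derivative_transform_within_open[of _ _ _ "{..<0}"]) (use 1 in \<open>auto simp: max_def\<close>)
  next
    case 2
    have "((\<lambda>s. s powr p) has_real_derivative p * max 0 s powr (p - 1)) (at s)"
      using 2 by (auto intro!: derivative_eq_intros simp: max_def)
    then show ?thesis
      by (rule has_field_derivative_transform_within_open[of _ _ _ "{0<..}"]) (use 2 in \<open>auto simp: max_def\<close>)
  next
    case 3
    have "(\<lambda>h::real. max 0 h powr (p - 1)) \<midarrow>0\<rightarrow> 0"
      by (rule tendsto_zero_powrI[where b="p - 1"]) (use assms in \<open>auto intro!: tendsto_eq_intros\<close>)
    moreover have "max 0 h powr p / h = max 0 h powr (p - 1)" for h :: real
      by (cases "h > 0") (auto simp: max_def powr_diff)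
    ultimately show ?thesis using 3 by (simp add: DERIV_def)
  qed
qed

text \<open>The exponent \<open>1 / p - 1\<close> is negative, so dropping \<open>R\<close>
  increases the expression; then the powers of \<open>a\<close> cancel and
  \<open>l powr (1 / p)\<close> remains.\<close>

lemma pos_part_slope_bound:
  fixes l a R p :: real
  assumes "1 < p" "0 \<le> l" "l \<le> 1" "0 \<le> a" "0 < R"
  shows "0 \<le> (l * a powr p + R) powr (1 / p - 1) * (l * a powr (p - 1))"
    "(l * a powr p + R) powr (1 / p - 1) * (l * a powr (p - 1)) \<le> 1"
proof -
  show "0 \<le> (l * a powr p + R) powr (1 / p - 1) * (l * a powr (p - 1))" using assms by simp
  show "(l * a powr p + R) powr (1 / p - 1) * (l * a powr (p - 1)) \<le> 1"
  proof (cases "l = 0 \<or> a = 0")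
    case False
    then have la: "0 < l" "0 < a" using assms by auto
    have "(l * a powr p + R) powr (1 / p - 1) \<le> (l * a powr p) powr (1 / p - 1)"
      using assms la by (intro powr_mono2') auto
    also have "\<dots> = l powr (1 / p - 1) * a powr (1 - p)"
      using la assms by (simp add: powr_mult powr_powr right_diff_distrib)
    finally have "(l * a powr p + R) powr (1 / p - 1) * (l * a powr (p - 1)) \<le> l powr (1 / p - 1) * a powr (1 - p) * (l * a powr (p - 1))"
      using la by (intro mult_right_mono) auto
    also have "\<dots> = (l powr (1 / p - 1) * l powr 1) * (a powr (1 - p) * a powr (p - 1))"
      using la by simp
    also have "\<dots> = l powr (1 / p)"
      unfolding powr_add[symmetric] using la by simp
    also have "\<dots> \<le> 1" using la assms by (intro powr_le1) auto
    finally show ?thesis .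
  qed auto
qed

text \<open>For \<open>W\<^sub>0\<^sup>1\<^sup>,\<^sup>r\<close> the curve is approximated by \<open>geo_reg \<epsilon> p t \<phi> \<psi> - \<epsilon> powr (1 / p)\<close> with test functions
  \<open>\<phi>\<close>, \<open>\<psi>\<close>: this is \<open>C\<^sup>1\<close>, it vanishes where \<open>\<phi> = \<psi> = 0\<close>, and the slopes \<open>geo_reg1\<close>, \<open>geo_reg2\<close> lie in
  \<open>[0, 1]\<close> uniformly in \<open>\<epsilon>\<close>.\<close>

definition geo_reg :: "real \<Rightarrow> real \<Rightarrow> real \<Rightarrow> real \<Rightarrow> real \<Rightarrow> real" where
  "geo_reg \<epsilon> p t a b = ((1 - t) * max 0 a powr p + t * max 0 b powr p + \<epsilon>) powr (1 / p)"

definition geo_reg1 :: "real \<Rightarrow> real \<Rightarrow> real \<Rightarrow> real \<Rightarrow> real \<Rightarrow> real" where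
  "geo_reg1 \<epsilon> p t a b = ((1 - t) * max 0 a powr p + t * max 0 b powr p + \<epsilon>) powr (1 / p - 1) * ((1 - t) * max 0 a powr (p - 1))"

definition geo_reg2 :: "real \<Rightarrow> real \<Rightarrow> real \<Rightarrow> real \<Rightarrow> real \<Rightarrow> real" where
  "geo_reg2 \<epsilon> p t a b = ((1 - t) * max 0 a powr p + t * max 0 b powr p + \<epsilon>) powr (1 / p - 1) * (t * max 0 b powr (p - 1))"

lemma geo_reg_bounds:
  assumes "1 < p" "0 \<le> t" "t \<le> 1" "0 < \<epsilon>"
  shows "0 \<le> geo_reg1 \<epsilon> p t a b" "geo_reg1 \<epsilon> p t a b \<le> 1" "0 \<le> geo_reg2 \<epsilon> p t a b" "geo_reg2 \<epsilon> p t a b \<le> 1"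
proof -
  have R: "0 < t * max 0 b powr p + \<epsilon>" "0 < (1 - t) * max 0 a powr p + \<epsilon>"
    using assms by (auto intro!: add_nonneg_pos)
  have eq: "(1 - t) * max 0 a powr p + t * max 0 b powr p + \<epsilon> = (1 - t) * max 0 a powr p + (t * max 0 b powr p + \<epsilon>)"
    "(1 - t) * max 0 a powr p + t * max 0 b powr p + \<epsilon> = t * max 0 b powr p + ((1 - t) * max 0 a powr p + \<epsilon>)"
    by simp_all
  show "0 \<le> geo_reg1 \<epsilon> p t a b" "geo_reg1 \<epsilon> p t a b \<le> 1"
    unfolding geo_reg1_def eq(1) using assms by (intro pos_part_slope_bound R; simp)+
  show "0 \<le> geo_reg2 \<epsilon> p t a b" "geo_reg2 \<epsilon> p t a b \<le> 1"
    unfolding geo_reg2_def eq(2) using assms by (intro pos_part_slope_bound R; simp)+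
qed

lemma has_derivative_geo_reg:
  fixes f g :: "'a::real_normed_vector \<Rightarrow> real"
  assumes p: "1 < p" and t: "0 \<le> t" "t \<le> 1" and e: "0 < \<epsilon>"
    and f: "(f has_derivative f') (at x)" and g: "(g has_derivative g') (at x)"
  shows "((\<lambda>x. geo_reg \<epsilon> p t (f x) (g x)) has_derivative
    (\<lambda>v. geo_reg1 \<epsilon> p t (f x) (g x) * f' v + geo_reg2 \<epsilon> p t (f x) (g x) * g' v)) (at x)"
proof -
  define s where "s x = (1 - t) * max 0 (f x) powr p + t * max 0 (g x) powr p + \<epsilon>" for x
  have pos: "0 < s x" for x
    unfolding s_def using t e by (intro add_nonneg_pos add_nonneg_nonneg) auto
  have "((\<lambda>x. max 0 (h x) powr p) has_derivative (\<lambda>v. p * max 0 (h x) powr (p - 1) * h' v)) (at x)"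
    if "(h has_derivative h') (at x)" for h :: "'a \<Rightarrow> real" and h'
    by (rule has_derivative_compose[OF that has_derivative_pos_part_powr[OF p, unfolded has_field_derivative_def]])
  note fg = this[OF f] this[OF g]
  have ds: "(s has_derivative (\<lambda>v. (1 - t) * (p * max 0 (f x) powr (p - 1) * f' v) + t * (p * max 0 (g x) powr (p - 1) * g' v))) (at x)"
    unfolding s_def[abs_def] by (rule has_derivative_eq_rhs, (rule has_derivative_add has_derivative_mult_right fg has_derivative_const)+) simp
  have dp: "((\<lambda>y. y powr (1 / p)) has_derivative (*) (1 / p * s x powr (1 / p - 1))) (at (s x))"
    using pos[of x] p by (intro has_field_derivative_imp_has_derivative) (auto intro!: derivative_eq_intros)
  have "((\<lambda>x. s x powr (1 / p)) has_derivative (\<lambda>v. 1 / p * s x powr (1 / p - 1) *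
      ((1 - t) * (p * max 0 (f x) powr (p - 1) * f' v) + t * (p * max 0 (g x) powr (p - 1) * g' v)))) (at x)"
    by (rule has_derivative_compose[OF ds dp])
  moreover have "1 / p * s x powr (1 / p - 1) *
      ((1 - t) * (p * max 0 (f x) powr (p - 1) * f' v) + t * (p * max 0 (g x) powr (p - 1) * g' v))
    = geo_reg1 \<epsilon> p t (f x) (g x) * f' v + geo_reg2 \<epsilon> p t (f x) (g x) * g' v" for v
    using p by (simp add: geo_reg1_def geo_reg2_def flip: s_def) (simp add: field_simps)
  ultimately show ?thesis by (simp add: geo_reg_def s_def[abs_def])
qed

text \<open>One argument is changed at a time, along which the slopes lie in the unit
  interval.\<close>

lemma geo_reg_lipschitz:
  assumes p: "1 < p" and t: "0 \<le> t" "t \<le> 1" and e: "0 < \<epsilon>"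
  shows "\<bar>geo_reg \<epsilon> p t a b - geo_reg \<epsilon> p t a' b'\<bar> \<le> \<bar>a - a'\<bar> + \<bar>b - b'\<bar>"
proof -
  note B = geo_reg_bounds[OF p t e]
  have "norm (geo_reg \<epsilon> p t a b - geo_reg \<epsilon> p t a' b) \<le> 1 * norm (a - a')"
  proof (rule field_differentiable_bound[of UNIV])
    show "((\<lambda>s. geo_reg \<epsilon> p t s b) has_field_derivative geo_reg1 \<epsilon> p t z b) (at z within UNIV)" for z
      using has_derivative_geo_reg[OF p t e has_derivative_ident has_derivative_const[of b], of z]
      by (simp add: has_field_derivative_def)
    show "norm (geo_reg1 \<epsilon> p t z b) \<le> 1" for z using B(1,2)[of z b] by simp
  qed auto
  moreover have "norm (geo_reg \<epsilon> p t a' b - geo_reg \<epsilon> p t a' b') \<le> 1 * norm (b - b')"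
  proof (rule field_differentiable_bound[of UNIV])
    show "((\<lambda>s. geo_reg \<epsilon> p t a' s) has_field_derivative geo_reg2 \<epsilon> p t a' z) (at z within UNIV)" for z
      using has_derivative_geo_reg[OF p t e has_derivative_const[of a'] has_derivative_ident, of z]
      by (simp add: has_field_derivative_def)
    show "norm (geo_reg2 \<epsilon> p t a' z) \<le> 1" for z using B(3,4)[of a' z] by simp
  qed auto
  ultimately show ?thesis by simp
qed

lemma continuous_on_geo_reg:
  fixes S :: "'a::euclidean_space set"
  assumes p: "1 < p" and t: "0 \<le> t" "t \<le> 1" and e: "0 < \<epsilon>" and c: "continuous_on S f" "continuous_on S g"
  shows "continuous_on S (\<lambda>x. geo_reg \<epsilon> p t (f x) (g x))"
    "continuous_on S (\<lambda>x. geo_reg1 \<epsilon> p t (f x) (g x))" "continuous_on S (\<lambda>x. geo_reg2 \<epsilon> p t (f x) (g x))"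
proof -
  have m: "continuous_on S (\<lambda>x. max 0 (h x) powr q)" if "continuous_on S h" "0 < q" for h :: "'a \<Rightarrow> real" and q
    by (rule continuous_on_powr') (use that in \<open>auto intro!: continuous_intros\<close>)
  have pos: "0 < (1 - t) * max 0 (f x) powr p + t * max 0 (g x) powr p + \<epsilon>" for x
    using t e by (intro add_nonneg_pos add_nonneg_nonneg) auto
  have s: "continuous_on S (\<lambda>x. ((1 - t) * max 0 (f x) powr p + t * max 0 (g x) powr p + \<epsilon>) powr q)" for q
  proof (rule continuous_on_powr)
    show "continuous_on S (\<lambda>x. (1 - t) * max 0 (f x) powr p + t * max 0 (g x) powr p + \<epsilon>)"
      using p by (intro continuous_on_add continuous_on_mult continuous_on_const m c) auto
    show "\<forall>x\<in>S. (1 - t) * max 0 (f x) powr p + t * max 0 (g x) powr p + \<epsilon> \<noteq> 0"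
    proof
      fix x show "(1 - t) * max 0 (f x) powr p + t * max 0 (g x) powr p + \<epsilon> \<noteq> 0"
        using pos[of x] by linarith
    qed
  qed (rule continuous_on_const)
  show "continuous_on S (\<lambda>x. geo_reg \<epsilon> p t (f x) (g x))"
    "continuous_on S (\<lambda>x. geo_reg1 \<epsilon> p t (f x) (g x))" "continuous_on S (\<lambda>x. geo_reg2 \<epsilon> p t (f x) (g x))"
    unfolding geo_reg_def geo_reg1_def geo_reg2_def using p
    by (intro continuous_on_mult continuous_on_const s m c; simp)+
qed

lemma powr_superadditive:
  fixes x y p :: real
  assumes "1 < p" "0 \<le> x" "0 \<le> y" shows "x powr p + y powr p \<le> (x + y) powr p"
proof -
  have e: "z powr p = z * z powr (p - 1)" if "0 \<le> z" for z
    using that powr_add[of z 1 "p - 1"] by simp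
  have "x * x powr (p - 1) \<le> x * (x + y) powr (p - 1)" "y * y powr (p - 1) \<le> y * (x + y) powr (p - 1)"
    using assms by (intro mult_left_mono powr_mono2; simp)+
  then show ?thesis using assms by (simp add: e distrib_right)
qed

text \<open>The root is subadditive, so adding \<open>\<epsilon>\<close> under it raises the value
  by at most \<open>\<epsilon> powr (1 / p)\<close>; subtracting that amount leaves an error of the
  same size.\<close>

lemma geo_reg_approx:
  assumes p: "1 < p" and t: "0 \<le> t" "t \<le> 1" and e: "0 < \<epsilon>" and ab: "0 < a" "0 < b"
  shows "\<bar>geo_reg \<epsilon> p t a b - \<epsilon> powr (1 / p) - geo p t a b\<bar> \<le> \<epsilon> powr (1 / p)"
proof -
  define s where "s = (1 - t) * a powr p + t * b powr p"
  have s: "0 < s" unfolding s_def using ab t by (rule geo_radicand_pos)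
  have 1: "s powr (1 / p) \<le> (s + \<epsilon>) powr (1 / p)" using s e p by (intro powr_mono2) auto
  have "s + \<epsilon> \<le> (s powr (1 / p) + \<epsilon> powr (1 / p)) powr p"
    using powr_superadditive[OF p, of "s powr (1 / p)" "\<epsilon> powr (1 / p)"] s e p by (simp add: powr_powr)
  then have "(s + \<epsilon>) powr (1 / p) \<le> ((s powr (1 / p) + \<epsilon> powr (1 / p)) powr p) powr (1 / p)"
    using s e p by (intro powr_mono2) auto
  then have 2: "(s + \<epsilon>) powr (1 / p) \<le> s powr (1 / p) + \<epsilon> powr (1 / p)"
    using p s e by (simp add: powr_powr)
  show ?thesis using 1 2 ab by (simp add: geo_reg_def geo_def max_def flip: s_def)
qed

lemma Cc_in_union:
  fixes f g :: "'a::euclidean_space \<Rightarrow> real"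
  assumes "Cc_in \<Omega> f" "Cc_in \<Omega> g" "continuous_on UNIV h" "\<And>x. f x = 0 \<Longrightarrow> g x = 0 \<Longrightarrow> h x = 0"
  shows "Cc_in \<Omega> h"
proof -
  obtain K where K: "compact K" "K \<subseteq> \<Omega>" "\<And>x. x \<notin> K \<Longrightarrow> f x = 0" using Cc_inE[OF assms(1)] by metis
  obtain L where L: "compact L" "L \<subseteq> \<Omega>" "\<And>x. x \<notin> L \<Longrightarrow> g x = 0" using Cc_inE[OF assms(2)] by metis
  show ?thesis
    by (rule Cc_inI[OF assms(3) compact_Un[OF K(1) L(1)]]) (use K L assms(4) in auto)
qed

lemma test_function_gradient:
  assumes "open \<Omega>" "\<phi> \<in> test_functions \<Omega>"
  shows "is_weak_gradient \<Omega> \<phi> (\<lambda>x. \<Sum>i\<in>Basis. frechet_derivative \<phi> (at x) i *\<^sub>R i)"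
    "continuous_on UNIV (\<lambda>x. \<Sum>i\<in>Basis. frechet_derivative \<phi> (at x) i *\<^sub>R i)"
  using is_weak_gradient_classical[OF assms(1) test_functionsD(2,3)[OF assms(2)]]
  by (auto intro!: continuous_intros test_functionsD(3)[OF assms(2)])

lemma test_function_W1:
  fixes \<Omega> :: "'a::euclidean_space set"
  assumes "open \<Omega>" "bounded \<Omega>" "0 < r" and \<phi>: "\<phi> \<in> test_functions \<Omega>"
  shows "in_Lp \<Omega> r \<phi>" "in_Lp \<Omega> r (\<lambda>x. \<Sum>i\<in>Basis. frechet_derivative \<phi> (at x) i *\<^sub>R i)"
proof -
  have const: "integrable (lebesgue_on \<Omega>) (\<lambda>x. c)" for c :: real
    by (rule integrable_bounded_lebesgue_on[OF assms(1,2), of _ "\<bar>c\<bar>"]) auto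
  obtain M where M: "\<And>x. \<bar>\<phi> x\<bar> \<le> M"
    using Cc_bounded[OF Cc_in_imp_Cc[OF test_functionsD(1)[OF \<phi>]]] by metis
  show "in_Lp \<Omega> r \<phi>"
  proof (rule in_Lp_bound[OF assms(3) _ const[of "M powr r"]])
    show "\<phi> \<in> borel_measurable (lebesgue_on \<Omega>)"
      using test_functionsD(1)[OF \<phi>] sets_lebesgue_open[OF assms(1)]
      by (intro borel_measurable_lebesgue_on_continuous) (auto simp: Cc_in_def)
    show "AE x in lebesgue_on \<Omega>. norm (\<phi> x) powr r \<le> M powr r"
      using M assms(3) by (intro AE_I2 powr_mono2) auto
  qed
  have "\<exists>M. \<forall>x. \<bar>frechet_derivative \<phi> (at x) i\<bar> \<le> M" for i
    using Cc_bounded[OF Cc_in_imp_Cc[OF test_functionsD(4)[OF \<phi>, of i]]] by metis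
  then obtain B where B: "\<And>i x. \<bar>frechet_derivative \<phi> (at x) i\<bar> \<le> B i" by metis
  have n: "norm (\<Sum>i\<in>Basis. frechet_derivative \<phi> (at x) i *\<^sub>R i) \<le> (\<Sum>i\<in>Basis. B i)" for x
    using B by (intro sum_norm_le) simp
  show "in_Lp \<Omega> r (\<lambda>x. \<Sum>i\<in>Basis. frechet_derivative \<phi> (at x) i *\<^sub>R i)"
  proof (rule in_Lp_bound[OF assms(3) _ const[of "(\<Sum>i\<in>Basis. B i) powr r"]])
    show "(\<lambda>x. \<Sum>i\<in>Basis. frechet_derivative \<phi> (at x) i *\<^sub>R i) \<in> borel_measurable (lebesgue_on \<Omega>)"
      using test_function_gradient(2)[OF assms(1) \<phi>] sets_lebesgue_open[OF assms(1)]
      by (intro continuous_imp_measurable_on_sets_lebesgue) (auto intro: continuous_on_subset)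
    show "AE x in lebesgue_on \<Omega>. norm (\<Sum>i\<in>Basis. frechet_derivative \<phi> (at x) i *\<^sub>R i) powr r \<le> (\<Sum>i\<in>Basis. B i) powr r"
      using n assms(3) by (intro AE_I2 powr_mono2) auto
  qed
qed

lemma W1_0_approximating_sequence:
  fixes \<Omega> :: "'a::euclidean_space set"
  assumes "open \<Omega>" "bounded \<Omega>" "0 < r" and u: "u \<in> W1_0 \<Omega> r"
  shows "\<exists>\<phi>. (\<forall>n. \<phi> n \<in> test_functions \<Omega>) \<and>
    (\<forall>n. integrable (lebesgue_on \<Omega>) (\<lambda>x. \<bar>u x - \<phi> n x\<bar> powr r +
      norm (weak_gradient \<Omega> u x - (\<Sum>i\<in>Basis. frechet_derivative (\<phi> n) (at x) i *\<^sub>R i)) powr r)) \<and>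
    (\<lambda>n. LINT x|lebesgue_on \<Omega>. \<bar>u x - \<phi> n x\<bar> powr r +
      norm (weak_gradient \<Omega> u x - (\<Sum>i\<in>Basis. frechet_derivative (\<phi> n) (at x) i *\<^sub>R i)) powr r) \<longlonglongrightarrow> 0"
proof -
  have W: "u \<in> W1 \<Omega> r" using u by (simp add: W1_0_def)
  note wu = W1_weak_gradient[OF assms(1) W]
  let ?g = "\<lambda>\<phi> x. \<Sum>i\<in>Basis. frechet_derivative \<phi> (at x) i *\<^sub>R i"
  \<comment> \<open>The tolerance is an r-th root so that the integral of r-th powers falls below
    \<open>inverse (real (Suc n))\<close>.\<close>
  have pos: "0 < inverse (real (Suc n)) powr (1 / r)" for n by simp
  have "\<exists>\<phi>. \<phi> \<in> test_functions \<Omega> \<and> sobolev_norm \<Omega> r (\<lambda>x. u x - \<phi> x) < inverse (real (Suc n)) powr (1 / r)" for n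
    using u pos[of n] unfolding W1_0_def by blast
  then obtain \<phi> where \<phi>: "\<And>n. \<phi> n \<in> test_functions \<Omega>"
    "\<And>n. sobolev_norm \<Omega> r (\<lambda>x. u x - \<phi> n x) < inverse (real (Suc n)) powr (1 / r)" by metis
  have wg: "is_weak_gradient \<Omega> (\<lambda>x. u x - \<phi> n x) (\<lambda>x. weak_gradient \<Omega> u x - ?g (\<phi> n) x)" for n
    using is_weak_gradient_combine[OF assms(1) wu(1) test_function_gradient(1)[OF assms(1) \<phi>(1)], of 1 "-1" n] by simp
  let ?E = "\<lambda>n x. \<bar>u x - \<phi> n x\<bar> powr r + norm (weak_gradient \<Omega> u x - ?g (\<phi> n) x) powr r"
  have int: "integrable (lebesgue_on \<Omega>) (?E n)" for n
  proof (rule Bochner_Integration.integrable_add)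
    show "integrable (lebesgue_on \<Omega>) (\<lambda>x. \<bar>u x - \<phi> n x\<bar> powr r)"
      using in_Lp_combine[OF assms(3) wu(3) test_function_W1(1)[OF assms(1-3) \<phi>(1)], of 1 "-1" n]
      by (simp add: in_Lp_def)
    show "integrable (lebesgue_on \<Omega>) (\<lambda>x. norm (weak_gradient \<Omega> u x - ?g (\<phi> n) x) powr r)"
      using in_Lp_combine[OF assms(3) wu(2) test_function_W1(2)[OF assms(1-3) \<phi>(1)], of 1 "-1" n]
      by (simp add: in_Lp_def)
  qed
  have "(LINT x|lebesgue_on \<Omega>. ?E n x) \<le> inverse (real (Suc n))" for n
  proof -
    have "(LINT x|lebesgue_on \<Omega>. ?E n x) = sobolev_norm \<Omega> r (\<lambda>x. u x - \<phi> n x) powr r"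
      by (rule sobolev_norm_powr[OF assms(1,3) wg])
    also have "\<dots> \<le> (inverse (real (Suc n)) powr (1 / r)) powr r"
      using \<phi>(2)[of n] assms(3) by (intro powr_mono2) (auto simp: sobolev_norm_def)
    also have "\<dots> = inverse (real (Suc n))" using assms(3) by (simp add: powr_powr)
    finally show ?thesis .
  qed
  moreover have "0 \<le> (LINT x|lebesgue_on \<Omega>. ?E n x)" for n by (rule Bochner_Integration.integral_nonneg) simp
  ultimately have "(\<lambda>n. LINT x|lebesgue_on \<Omega>. ?E n x) \<longlonglongrightarrow> 0"
    by (intro tendsto_sandwich[OF _ _ tendsto_const LIMSEQ_inverse_real_of_nat] always_eventually allI)
  then show ?thesis using \<phi>(1) int by blast
qed

lemma tendsto_abs_powr_zero_imp:
  fixes f :: "nat \<Rightarrow> real"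
  assumes "0 < r" "(\<lambda>n. \<bar>f n\<bar> powr r) \<longlonglongrightarrow> 0" shows "f \<longlonglongrightarrow> 0"
proof -
  have "(\<lambda>n. (\<bar>f n\<bar> powr r) powr (1 / r)) \<longlonglongrightarrow> 0"
    by (rule tendsto_zero_powrI[OF assms(2) tendsto_const]) (use assms(1) in auto)
  then have "(\<lambda>n. \<bar>f n\<bar>) \<longlonglongrightarrow> 0" using assms(1) by (simp add: powr_powr)
  then show ?thesis by (simp add: tendsto_rabs_zero_iff)
qed

lemma geo_reg_slope_tendsto:
  assumes p: "1 < p" and t: "0 \<le> t" "t \<le> 1" and ab: "0 < a" "0 < b"
    and f: "f \<longlonglongrightarrow> a" and g: "g \<longlonglongrightarrow> b" and e: "e \<longlonglongrightarrow> 0"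
  shows "(\<lambda>n. geo_reg1 (e n) p t (f n) (g n)) \<longlonglongrightarrow> geo p t a b powr (1 - p) * ((1 - t) * a powr (p - 1))"
    "(\<lambda>n. geo_reg2 (e n) p t (f n) (g n)) \<longlonglongrightarrow> geo p t a b powr (1 - p) * (t * b powr (p - 1))"
proof -
  define s where "s = (1 - t) * a powr p + t * b powr p"
  have s: "0 < s" unfolding s_def using ab t by (rule geo_radicand_pos)
  have geo: "geo p t a b powr (1 - p) = s powr (1 / p - 1)"
    using p by (simp add: geo_def s_def powr_powr diff_divide_distrib)
  have m: "(\<lambda>n. max 0 (f n)) \<longlonglongrightarrow> a" "(\<lambda>n. max 0 (g n)) \<longlonglongrightarrow> b"
    using tendsto_max[OF tendsto_const[of 0] f] tendsto_max[OF tendsto_const[of 0] g] ab by simp_all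
  have "(\<lambda>n. (1 - t) * max 0 (f n) powr p + t * max 0 (g n) powr p + e n) \<longlonglongrightarrow> s + 0"
    unfolding s_def using ab by (intro tendsto_intros m e) auto
  then have S: "(\<lambda>n. ((1 - t) * max 0 (f n) powr p + t * max 0 (g n) powr p + e n) powr (1 / p - 1)) \<longlonglongrightarrow> s powr (1 / p - 1)"
    using s by (intro tendsto_powr tendsto_const) auto
  show "(\<lambda>n. geo_reg1 (e n) p t (f n) (g n)) \<longlonglongrightarrow> geo p t a b powr (1 - p) * ((1 - t) * a powr (p - 1))"
    "(\<lambda>n. geo_reg2 (e n) p t (f n) (g n)) \<longlonglongrightarrow> geo p t a b powr (1 - p) * (t * b powr (p - 1))"
    unfolding geo_reg1_def geo_reg2_def geo using ab by (intro tendsto_mult S tendsto_const tendsto_powr m; simp)+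
qed

text \<open>The gradient error is arranged in two kinds of terms: bounded slopes times differences
  of gradients, which are small in norm, and slope errors times the fixed gradients
  \<open>V\<close>, \<open>W\<close>, for which pointwise convergence of the slopes will be
  enough.\<close>

lemma geo_reg_error:
  fixes V W V' W' :: "'a::real_inner"
  assumes p: "1 < p" and t: "0 \<le> t" "t \<le> 1" and e: "0 < \<epsilon>" and r: "0 < r" and ab: "0 < a" "0 < b"
  defines "c1 \<equiv> geo p t a b powr (1 - p) * ((1 - t) * a powr (p - 1))"
    and "c2 \<equiv> geo p t a b powr (1 - p) * (t * b powr (p - 1))"
  shows "\<bar>(geo p t a b - a) - (geo_reg \<epsilon> p t a' b' - \<epsilon> powr (1 / p) - a')\<bar> powr r
      + norm ((geo_grad p t a b V W - V) - (geo_reg1 \<epsilon> p t a' b' *\<^sub>R V' + geo_reg2 \<epsilon> p t a' b' *\<^sub>R W' - V')) powr r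
    \<le> 5 powr r * (2 * ((\<bar>a - a'\<bar> powr r + norm (V - V') powr r) + (\<bar>b - b'\<bar> powr r + norm (W - W') powr r))
      + (\<epsilon> powr (1 / p)) powr r
      + \<bar>c1 - geo_reg1 \<epsilon> p t a' b'\<bar> powr r * norm V powr r + \<bar>c2 - geo_reg2 \<epsilon> p t a' b'\<bar> powr r * norm W powr r)"
proof -
  define A where "A = geo_reg1 \<epsilon> p t a' b'"
  define B where "B = geo_reg2 \<epsilon> p t a' b'"
  have AB: "0 \<le> A" "A \<le> 1" "0 \<le> B" "B \<le> 1" unfolding A_def B_def by (rule geo_reg_bounds[OF p t e])+
  have nn: "0 \<le> x powr r" for x :: real by simp
  have "\<bar>(geo p t a b - a) - (geo_reg \<epsilon> p t a' b' - \<epsilon> powr (1 / p) - a')\<bar> \<le>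
      \<bar>a - a'\<bar> + \<bar>a - a'\<bar> + \<bar>b - b'\<bar> + \<epsilon> powr (1 / p) + 0"
    using geo_reg_lipschitz[OF p t e, of a b a' b'] geo_reg_approx[OF p t e ab] by linarith
  then have "\<bar>(geo p t a b - a) - (geo_reg \<epsilon> p t a' b' - \<epsilon> powr (1 / p) - a')\<bar> powr r \<le>
      (\<bar>a - a'\<bar> + \<bar>a - a'\<bar> + \<bar>b - b'\<bar> + \<epsilon> powr (1 / p) + 0) powr r"
    using r by (intro powr_mono2) auto
  also have "\<dots> \<le> 5 powr r * (\<bar>a - a'\<bar> powr r + \<bar>a - a'\<bar> powr r + \<bar>b - b'\<bar> powr r + (\<epsilon> powr (1 / p)) powr r + 0 powr r)"
    using r by (intro powr_sum5_le) auto
  finally have 1: "\<bar>(geo p t a b - a) - (geo_reg \<epsilon> p t a' b' - \<epsilon> powr (1 / p) - a')\<bar> powr r \<le>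
    5 powr r * (\<bar>a - a'\<bar> powr r + \<bar>a - a'\<bar> powr r + \<bar>b - b'\<bar> powr r + (\<epsilon> powr (1 / p)) powr r)" using r by simp
  have "(geo_grad p t a b V W - V) - (A *\<^sub>R V' + B *\<^sub>R W' - V') =
      (c1 - A) *\<^sub>R V + A *\<^sub>R (V - V') + (c2 - B) *\<^sub>R W + B *\<^sub>R (W - W') + - (V - V')"
    by (simp add: geo_grad_def c1_def c2_def algebra_simps)
  also have "norm \<dots> \<le> norm ((c1 - A) *\<^sub>R V) + norm (A *\<^sub>R (V - V')) + norm ((c2 - B) *\<^sub>R W) + norm (B *\<^sub>R (W - W')) + norm (- (V - V'))"
    by (intro norm_triangle_le add_mono order_refl norm_triangle_ineq)
  also have "\<dots> \<le> \<bar>c1 - A\<bar> * norm V + norm (V - V') + \<bar>c2 - B\<bar> * norm W + norm (W - W') + norm (V - V')"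
    using AB by (intro add_mono) (auto simp: mult_left_le_one_le norm_minus_commute)
  finally have "norm ((geo_grad p t a b V W - V) - (A *\<^sub>R V' + B *\<^sub>R W' - V')) powr r \<le>
      (\<bar>c1 - A\<bar> * norm V + norm (V - V') + \<bar>c2 - B\<bar> * norm W + norm (W - W') + norm (V - V')) powr r"
    using r by (intro powr_mono2) auto
  also have "\<dots> \<le> 5 powr r * ((\<bar>c1 - A\<bar> * norm V) powr r + norm (V - V') powr r + (\<bar>c2 - B\<bar> * norm W) powr r + norm (W - W') powr r + norm (V - V') powr r)"
    using r by (intro powr_sum5_le) auto
  finally have 2: "norm ((geo_grad p t a b V W - V) - (A *\<^sub>R V' + B *\<^sub>R W' - V')) powr r \<le>
      5 powr r * (\<bar>c1 - A\<bar> powr r * norm V powr r + norm (V - V') powr r + \<bar>c2 - B\<bar> powr r * norm W powr r + norm (W - W') powr r + norm (V - V') powr r)"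
    by (simp add: powr_mult)
  have "\<bar>(geo p t a b - a) - (geo_reg \<epsilon> p t a' b' - \<epsilon> powr (1 / p) - a')\<bar> powr r
      + norm ((geo_grad p t a b V W - V) - (A *\<^sub>R V' + B *\<^sub>R W' - V')) powr r \<le>
    5 powr r * ((\<bar>a - a'\<bar> powr r + \<bar>a - a'\<bar> powr r + \<bar>b - b'\<bar> powr r + (\<epsilon> powr (1 / p)) powr r)
      + (\<bar>c1 - A\<bar> powr r * norm V powr r + norm (V - V') powr r + \<bar>c2 - B\<bar> powr r * norm W powr r + norm (W - W') powr r + norm (V - V') powr r))"
    using add_mono[OF 1 2] unfolding distrib_left[symmetric] .
  also have "\<dots> \<le> 5 powr r * (2 * ((\<bar>a - a'\<bar> powr r + norm (V - V') powr r) + (\<bar>b - b'\<bar> powr r + norm (W - W') powr r))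
      + (\<epsilon> powr (1 / p)) powr r + \<bar>c1 - A\<bar> powr r * norm V powr r + \<bar>c2 - B\<bar> powr r * norm W powr r)"
    using nn[of "\<bar>b - b'\<bar>"] nn[of "norm (W - W')"] by (intro mult_left_mono) auto
  finally show ?thesis unfolding A_def B_def .
qed

text \<open>Test functions approximating \<open>u\<close> and \<open>v\<close> are inserted into the
  regularised curve, with \<open>\<epsilon>\<close> tending to 0. Uniform slope bounds control most
  of the error by the distance of the test functions; the slope errors vanish by dominated
  convergence.\<close>

lemma geo_diff_W1_0:
  fixes \<Omega> :: "'a::euclidean_space set"
  assumes "open \<Omega>" "bounded \<Omega>" and p: "1 < p" and r: "0 < r" and u: "pos_W1 \<Omega> r u" "u \<in> W1_0 \<Omega> r"
    and v: "pos_W1 \<Omega> r v" "v \<in> W1_0 \<Omega> r" and t: "0 \<le> t" "t \<le> 1"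
    and w: "(\<lambda>x. geo p t (u x) (v x) - u x) \<in> W1 \<Omega> r"
  shows "(\<lambda>x. geo p t (u x) (v x) - u x) \<in> W1_0 \<Omega> r"
proof -
  let ?V = "weak_gradient \<Omega> u" and ?W = "weak_gradient \<Omega> v"
  let ?M = "lebesgue_on \<Omega>"
  let ?g = "\<lambda>\<phi> x. \<Sum>i\<in>Basis. frechet_derivative \<phi> (at x) i *\<^sub>R i"
  have uW: "u \<in> W1 \<Omega> r" "v \<in> W1 \<Omega> r" using u v by (auto simp: pos_W1_def)
  note wu = W1_weak_gradient[OF assms(1) uW(1)] and wv = W1_weak_gradient[OF assms(1) uW(2)]
  note m [measurable] = pos_W1_measurable[OF assms(1) u(1)] pos_W1_measurable[OF assms(1) v(1)]
  obtain \<phi> where \<phi>: "\<And>n. \<phi> n \<in> test_functions \<Omega>"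
    "\<And>n. integrable ?M (\<lambda>x. \<bar>u x - \<phi> n x\<bar> powr r + norm (?V x - ?g (\<phi> n) x) powr r)"
    "(\<lambda>n. LINT x|?M. \<bar>u x - \<phi> n x\<bar> powr r + norm (?V x - ?g (\<phi> n) x) powr r) \<longlonglongrightarrow> 0"
    using W1_0_approximating_sequence[OF assms(1,2) r u(2)] by blast
  obtain \<psi> where \<psi>: "\<And>n. \<psi> n \<in> test_functions \<Omega>"
    "\<And>n. integrable ?M (\<lambda>x. \<bar>v x - \<psi> n x\<bar> powr r + norm (?W x - ?g (\<psi> n) x) powr r)"
    "(\<lambda>n. LINT x|?M. \<bar>v x - \<psi> n x\<bar> powr r + norm (?W x - ?g (\<psi> n) x) powr r) \<longlonglongrightarrow> 0"
    using W1_0_approximating_sequence[OF assms(1,2) r v(2)] by blast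
  define E where "E n x = (\<bar>u x - \<phi> n x\<bar> powr r + norm (?V x - ?g (\<phi> n) x) powr r)
      + (\<bar>v x - \<psi> n x\<bar> powr r + norm (?W x - ?g (\<psi> n) x) powr r)" for n x
  have E0: "0 \<le> E n x" for n x by (simp add: E_def)
  have Ei: "integrable ?M (E n)" for n
    unfolding E_def by (intro Bochner_Integration.integrable_add \<phi>(2) \<psi>(2))
  have Elim: "(\<lambda>n. LINT x|?M. E n x) \<longlonglongrightarrow> 0"
  proof -
    have "(LINT x|?M. E n x) = (LINT x|?M. \<bar>u x - \<phi> n x\<bar> powr r + norm (?V x - ?g (\<phi> n) x) powr r)
      + (LINT x|?M. \<bar>v x - \<psi> n x\<bar> powr r + norm (?W x - ?g (\<psi> n) x) powr r)" for n
      unfolding E_def by (rule Bochner_Integration.integral_add[OF \<phi>(2) \<psi>(2)])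
    then show ?thesis using tendsto_add[OF \<phi>(3) \<psi>(3)] by simp
  qed
  \<comment> \<open>Convergence in the mean gives pointwise convergence along a subsequence, which
    the convergence of the slopes requires.\<close>
  have "\<exists>s. strict_mono s \<and> (AE x in ?M. (\<lambda>n. E (s n) x) \<longlonglongrightarrow> 0)"
  proof -
    have "(\<lambda>n. LINT x|?M. norm (E n x)) \<longlonglongrightarrow> 0" using Elim E0 by simp
    then show ?thesis by (intro tendsto_L1_AE_subseq Ei)
  qed
  then obtain s where s: "strict_mono s" "AE x in ?M. (\<lambda>n. E (s n) x) \<longlonglongrightarrow> 0" by blast
  define e where "e n = inverse (real (Suc n))" for n
  have e: "0 < e n" for n by (simp add: e_def)
  have elim: "e \<longlonglongrightarrow> 0" unfolding e_def by (rule LIMSEQ_inverse_real_of_nat)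
  define A where "A n x = geo_reg1 (e n) p t (\<phi> (s n) x) (\<psi> (s n) x)" for n x
  define B where "B n x = geo_reg2 (e n) p t (\<phi> (s n) x) (\<psi> (s n) x)" for n x
  define a where "a x = geo p t (u x) (v x) powr (1 - p) * ((1 - t) * u x powr (p - 1))" for x
  define b where "b x = geo p t (u x) (v x) powr (1 - p) * (t * v x powr (p - 1))" for x
  have AB: "0 \<le> A n x" "A n x \<le> 1" "0 \<le> B n x" "B n x \<le> 1" for n x
    unfolding A_def B_def by (rule geo_reg_bounds[OF p t e])+
  have cts: "continuous_on UNIV (\<phi> n)" "continuous_on UNIV (\<psi> n)" for n
    using test_functionsD(1)[OF \<phi>(1)] test_functionsD(1)[OF \<psi>(1)] by (simp_all add: Cc_in_def)
  have cAB: "continuous_on UNIV (A n)" "continuous_on UNIV (B n)" for n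
    unfolding A_def B_def by (intro continuous_on_geo_reg p t e cts)+
  have mAB [measurable]: "A n \<in> borel_measurable ?M" "B n \<in> borel_measurable ?M" for n
    by (intro borel_measurable_lebesgue_on_continuous cAB sets_lebesgue_open[OF assms(1)])+
  have [measurable]: "(\<lambda>x. geo p t (u x) (v x)) \<in> borel_measurable ?M"
    using borel_measurable_geo(1)[OF m(1,3,2,4)] .
  have mab [measurable]: "a \<in> borel_measurable ?M" "b \<in> borel_measurable ?M"
    unfolding a_def b_def by measurable
  have ABlim: "AE x in ?M. (\<lambda>n. A n x) \<longlonglongrightarrow> a x \<and> (\<lambda>n. B n x) \<longlonglongrightarrow> b x"
    using s(2) AE_space
  proof eventually_elim
    case (elim x)
    then have pos: "0 < u x" "0 < v x" using u(1) v(1) by (auto simp: pos_W1_def)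
    have "(\<lambda>n. \<bar>u x - \<phi> (s n) x\<bar> powr r) \<longlonglongrightarrow> 0" "(\<lambda>n. \<bar>v x - \<psi> (s n) x\<bar> powr r) \<longlonglongrightarrow> 0"
      by (rule tendsto_sandwich[OF _ _ tendsto_const elim(1)]; intro always_eventually allI; simp add: E_def)+
    then have "(\<lambda>n. u x - \<phi> (s n) x) \<longlonglongrightarrow> 0" "(\<lambda>n. v x - \<psi> (s n) x) \<longlonglongrightarrow> 0"
      by (auto intro: tendsto_abs_powr_zero_imp[OF r])
    from tendsto_diff[OF tendsto_const[of "u x"] this(1)] tendsto_diff[OF tendsto_const[of "v x"] this(2)]
    have "(\<lambda>n. \<phi> (s n) x) \<longlonglongrightarrow> u x" "(\<lambda>n. \<psi> (s n) x) \<longlonglongrightarrow> v x" by simp_all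
    from geo_reg_slope_tendsto[OF p t pos this \<open>e \<longlonglongrightarrow> 0\<close>]
    show ?case by (simp add: A_def B_def a_def b_def)
  qed
  \<comment> \<open>The limit slope inherits the bounds 0 and 1, so the slope error is at most 1 and
    the r-th power of the gradient norm dominates.\<close>
  have dom: "integrable ?M (\<lambda>x. \<bar>c x - C n x\<bar> powr r * norm (U x) powr r)"
      "(\<lambda>n. LINT x|?M. \<bar>c x - C n x\<bar> powr r * norm (U x) powr r) \<longlonglongrightarrow> 0"
    if [measurable]: "c \<in> borel_measurable ?M" "\<And>n. C n \<in> borel_measurable ?M" and U: "in_Lp \<Omega> r U"
      and C: "\<And>n x. 0 \<le> C n x" "\<And>n x. C n x \<le> 1" and l: "AE x in ?M. (\<lambda>n. C n x) \<longlonglongrightarrow> c x"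
    for c C and U :: "'a \<Rightarrow> 'a" and n
  proof -
    have [measurable]: "U \<in> borel_measurable ?M" and iU: "integrable ?M (\<lambda>x. norm (U x) powr r)"
      using U by (simp_all add: in_Lp_def)
    have bound: "AE x in ?M. norm (\<bar>c x - C n x\<bar> powr r * norm (U x) powr r) \<le> norm (U x) powr r" for n
      using l
    proof eventually_elim
      case (elim x)
      have "0 \<le> c x" "c x \<le> 1"
        using LIMSEQ_le_const[OF elim, of 0] LIMSEQ_le_const2[OF elim, of 1] C by auto
      then have "\<bar>c x - C n x\<bar> \<le> 1" using C(1)[of n x] C(2)[of n x] by linarith
      then have "\<bar>c x - C n x\<bar> powr r \<le> 1" using r by (intro powr_le1) auto
      then show ?case by (simp add: abs_mult mult_left_le_one_le)
    qed
    have l0: "AE x in ?M. (\<lambda>n. \<bar>c x - C n x\<bar> powr r * norm (U x) powr r) \<longlonglongrightarrow> 0"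
      using l
    proof eventually_elim
      case (elim x)
      have "(\<lambda>n. \<bar>c x - C n x\<bar>) \<longlonglongrightarrow> 0"
        using tendsto_rabs[OF tendsto_diff[OF tendsto_const[of "c x"] elim]] by simp
      then have "(\<lambda>n. \<bar>c x - C n x\<bar> powr r) \<longlonglongrightarrow> 0"
        by (rule tendsto_zero_powrI[OF _ tendsto_const]) (use r in auto)
      then show ?case by (rule tendsto_mult_left_zero)
    qed
    show "integrable ?M (\<lambda>x. \<bar>c x - C n x\<bar> powr r * norm (U x) powr r)"
      by (rule Bochner_Integration.integrable_bound[OF iU]) (use bound[of n] in auto)
    have "(\<lambda>n. LINT x|?M. \<bar>c x - C n x\<bar> powr r * norm (U x) powr r) \<longlonglongrightarrow> (LINT x|?M. 0)"
      by (rule integral_dominated_convergence[OF _ _ iU l0 bound]) measurable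
    then show "(\<lambda>n. LINT x|?M. \<bar>c x - C n x\<bar> powr r * norm (U x) powr r) \<longlonglongrightarrow> 0" by simp
  qed
  have dA: "integrable ?M (\<lambda>x. \<bar>a x - A n x\<bar> powr r * norm (?V x) powr r)"
      "(\<lambda>n. LINT x|?M. \<bar>a x - A n x\<bar> powr r * norm (?V x) powr r) \<longlonglongrightarrow> 0" for n
    using ABlim by (auto intro!: dom mab mAB wu(2) AB elim: eventually_mono)
  have dB: "integrable ?M (\<lambda>x. \<bar>b x - B n x\<bar> powr r * norm (?W x) powr r)"
      "(\<lambda>n. LINT x|?M. \<bar>b x - B n x\<bar> powr r * norm (?W x) powr r) \<longlonglongrightarrow> 0" for n
    using ABlim by (auto intro!: dom mab mAB wv(2) AB elim: eventually_mono)
  \<comment> \<open>This is the right-hand side of \<open>geo_reg_error\<close> along the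
    subsequence.\<close>
  define R where "R n x = 5 powr r * (2 * E (s n) x + (e n powr (1 / p)) powr r
      + \<bar>a x - A n x\<bar> powr r * norm (?V x) powr r + \<bar>b x - B n x\<bar> powr r * norm (?W x) powr r)" for n x
  have const: "integrable ?M (\<lambda>x. c)" for c :: real
    by (rule integrable_bounded_lebesgue_on[OF assms(1,2), of _ "\<bar>c\<bar>"]) auto
  have Ri: "integrable ?M (R n)" for n
    unfolding R_def by (intro Bochner_Integration.integrable_add integrable_mult_right Ei const dA dB)
  have Rlim: "(\<lambda>n. LINT x|?M. R n x) \<longlonglongrightarrow> 0"
  proof -
    have eq: "(LINT x|?M. R n x) = 5 powr r * (2 * (LINT x|?M. E (s n) x) + (e n powr (1 / p)) powr r * (LINT x|?M. 1)
      + (LINT x|?M. \<bar>a x - A n x\<bar> powr r * norm (?V x) powr r) + (LINT x|?M. \<bar>b x - B n x\<bar> powr r * norm (?W x) powr r))" for n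
      unfolding R_def using Ei[of "s n"] const dA(1)[of n] dB(1)[of n] by simp
    have "(\<lambda>n. e n powr (1 / p)) \<longlonglongrightarrow> 0"
      by (rule tendsto_zero_powrI[OF elim tendsto_const]) (use p e in \<open>auto simp: less_imp_le\<close>)
    then have "(\<lambda>n. (e n powr (1 / p)) powr r) \<longlonglongrightarrow> 0"
      by (rule tendsto_zero_powrI[OF _ tendsto_const]) (use r in auto)
    moreover have "(\<lambda>n. LINT x|?M. E (s n) x) \<longlonglongrightarrow> 0"
      using LIMSEQ_subseq_LIMSEQ[OF Elim s(1)] by (simp add: o_def)
    ultimately have "(\<lambda>n. LINT x|?M. R n x) \<longlonglongrightarrow> 5 powr r * (2 * 0 + 0 * (LINT x|?M. 1) + 0 + 0)"
      unfolding eq using dA(2) dB(2) by (intro tendsto_intros)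
    then show ?thesis by simp
  qed
  \<comment> \<open>Subtracting \<open>e n powr (1 / p)\<close> makes the function vanish where both
    test functions do, hence compactly supported; subtracting the approximation of \<open>u\<close>
    fits it to the increment of the curve.\<close>
  define D where "D n x = geo_reg (e n) p t (\<phi> (s n) x) (\<psi> (s n) x) - e n powr (1 / p) - \<phi> (s n) x" for n x
  define D' where "D' n x v = A n x * frechet_derivative (\<phi> (s n)) (at x) v + B n x * frechet_derivative (\<psi> (s n)) (at x) v
    - frechet_derivative (\<phi> (s n)) (at x) v" for n x v
  define Z where "Z x = geo_grad p t (u x) (v x) (?V x) (?W x) - ?V x" for x
  have sumD': "(\<Sum>i\<in>Basis. D' n x i *\<^sub>R i) = A n x *\<^sub>R ?g (\<phi> (s n)) x + B n x *\<^sub>R ?g (\<psi> (s n)) x - ?g (\<phi> (s n)) x" for n x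
    by (simp add: D'_def scaleR_diff_left scaleR_add_left sum.distrib sum_subtractf scaleR_sum_right)
  have wgZ: "is_weak_gradient \<Omega> (\<lambda>x. geo p t (u x) (v x) - u x) Z"
  proof -
    have "is_weak_gradient \<Omega> (\<lambda>x. geo p t (u x) (v x)) (\<lambda>x. geo_grad p t (u x) (v x) (?V x) (?W x))"
      using u(1) v(1) by (intro is_weak_gradient_geo(2)[OF assms(1) p t] wu(1) wv(1)) (auto simp: pos_W1_def)
    from is_weak_gradient_combine[OF assms(1) this wu(1), of 1 "-1"]
    show ?thesis by (simp add: Z_def[abs_def])
  qed
  have LpZ: "in_Lp \<Omega> r Z"
  proof -
    have "AE x in ?M. weak_gradient \<Omega> (\<lambda>x. geo p t (u x) (v x) - u x) x = Z x"
      by (rule weak_gradient_AE[OF assms(1) wgZ])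
    then show ?thesis by (rule in_Lp_cong_AE[OF assms(1) W1_weak_gradient(2)[OF assms(1) w]])
  qed
  have mZ [measurable]: "Z \<in> borel_measurable ?M" using LpZ by (simp add: in_Lp_def)
  let ?F = "\<lambda>n x. \<bar>(geo p t (u x) (v x) - u x) - D n x\<bar> powr r + norm (Z x - (\<Sum>i\<in>Basis. D' n x i *\<^sub>R i)) powr r"
  have le: "?F n x \<le> R n x" if "x \<in> \<Omega>" for n x
  proof -
    have pos: "0 < u x" "0 < v x" using u(1) v(1) that by (auto simp: pos_W1_def)
    show ?thesis
      unfolding sumD' D_def Z_def R_def E_def A_def B_def a_def b_def
      by (rule geo_reg_error[OF p t e r pos])
  qed
  have dD: "(D n has_derivative D' n x) (at x)" for n x
    unfolding D_def[abs_def] D'_def[abs_def] A_def B_def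
    by (rule has_derivative_eq_rhs, (rule has_derivative_diff has_derivative_const has_derivative_geo_reg[OF p t e]
        test_functionsD(2)[OF \<phi>(1)] test_functionsD(2)[OF \<psi>(1)])+) simp
  have cD': "continuous_on UNIV (\<lambda>x. D' n x v)" for n v
    unfolding D'_def by (intro continuous_intros cAB test_functionsD(3)[OF \<phi>(1)] test_functionsD(3)[OF \<psi>(1)])
  have CD: "Cc_in \<Omega> (D n)" for n
  proof (rule Cc_in_union[OF test_functionsD(1)[OF \<phi>(1)] test_functionsD(1)[OF \<psi>(1)]])
    show "continuous_on UNIV (D n)"
      unfolding D_def by (intro continuous_intros continuous_on_geo_reg p t e cts)
    show "D n x = 0" if "\<phi> (s n) x = 0" "\<psi> (s n) x = 0" for x
      using that by (simp add: D_def geo_reg_def)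
  qed
  have mD [measurable]: "D n \<in> borel_measurable ?M" for n
    using CD by (intro borel_measurable_lebesgue_on_continuous sets_lebesgue_open[OF assms(1)]) (simp add: Cc_in_def)
  have mD' [measurable]: "(\<lambda>x. \<Sum>i\<in>Basis. D' n x i *\<^sub>R i) \<in> borel_measurable ?M" for n
  proof -
    have "continuous_on UNIV (\<lambda>x. \<Sum>i\<in>Basis. D' n x i *\<^sub>R i)" by (intro continuous_intros cD')
    then show ?thesis
      by (intro continuous_imp_measurable_on_sets_lebesgue sets_lebesgue_open[OF assms(1)]) (auto intro: continuous_on_subset)
  qed
  have F0: "0 \<le> ?F n x" for n x by simp
  have Fi: "integrable ?M (?F n)" for n
  proof (rule Bochner_Integration.integrable_bound[OF Ri])
    show "?F n \<in> borel_measurable ?M" by measurable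
    show "AE x in ?M. norm (?F n x) \<le> norm (R n x)"
    proof (rule AE_I2)
      fix x assume "x \<in> space ?M"
      then have "?F n x \<le> R n x" by (intro le) simp
      then show "norm (?F n x) \<le> norm (R n x)" using F0[of x n] by (simp only: real_norm_def abs_of_nonneg)
    qed
  qed
  have "(LINT x|?M. ?F n x) \<le> (LINT x|?M. R n x)" for n
    by (rule Bochner_Integration.integral_mono[OF Fi Ri]) (rule le, simp)
  moreover have "0 \<le> (LINT x|?M. ?F n x)" for n by (rule Bochner_Integration.integral_nonneg) simp
  ultimately have "(\<lambda>n. LINT x|?M. ?F n x) \<longlonglongrightarrow> 0"
    by (intro tendsto_sandwich[OF _ _ tendsto_const Rlim] always_eventually allI)
  then show ?thesis
    by (rule W1_0_I[OF assms(1,2) r w wgZ LpZ CD dD cD' Fi])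
qed

section \<open>The functional\<close>

lemma interval_integral_has_real_derivative:
  fixes f :: "real \<Rightarrow> real"
  assumes "continuous_on UNIV f"
  shows "((\<lambda>t. LBINT s=0..ereal t. f s) has_real_derivative f x) (at x)"
proof -
  \<comment> \<open>The interval contains 0 and has \<open>x\<close> in its interior, so the
    derivative within it is a full derivative.\<close>
  let ?b = "\<bar>x\<bar> + 1"
  have "((\<lambda>u. LBINT y=ereal 0..ereal u. f y) has_vector_derivative f x) (at x within {-?b..?b})"
    by (rule interval_integral_FTC2) (auto intro: continuous_on_subset[OF assms])
  moreover have "at x within {-?b..?b} = at x"
    by (rule at_within_interior) auto
  ultimately show ?thesis
    by (simp add: has_real_derivative_iff_has_vector_derivative flip: zero_ereal_def)
qed

text \<open>The real argument is replaced by its rounding down to multiples of 1/(n+1), which takes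
  countably many values; continuity in that argument gives the limit. The inner map \<open>a\<close>
  allows application on a product space.\<close>

lemma borel_measurable_caratheodory_compose:
  fixes f :: "'a \<Rightarrow> real \<Rightarrow> real"
  assumes m: "\<And>t. (\<lambda>x. f x t) \<in> borel_measurable M" and c: "\<And>x. continuous_on UNIV (f x)"
    and a: "a \<in> measurable N M" and b: "b \<in> borel_measurable N"
  shows "(\<lambda>y. f (a y) (b y)) \<in> borel_measurable N"
proof (rule borel_measurable_LIMSEQ_real)
  fix n
  show "(\<lambda>y. f (a y) (real_of_int \<lfloor>real (Suc n) * b y\<rfloor> / real (Suc n))) \<in> borel_measurable N"
  proof (rule measurable_compose_countable[where f="\<lambda>i y. f (a y) (real_of_int i / real (Suc n))"])
    show "(\<lambda>y. f (a y) (real_of_int i / real (Suc n))) \<in> borel_measurable N" for i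
      by (rule measurable_compose[OF a m])
    show "(\<lambda>y. \<lfloor>real (Suc n) * b y\<rfloor>) \<in> measurable N (count_space UNIV)"
      using b by measurable
  qed
next
  fix y
  have lim: "(\<lambda>n. real_of_int \<lfloor>real (Suc n) * b y\<rfloor> / real (Suc n)) \<longlonglongrightarrow> b y"
  proof (rule tendsto_sandwich[OF always_eventually always_eventually])
    show "\<forall>n. b y - inverse (real (Suc n)) \<le> real_of_int \<lfloor>real (Suc n) * b y\<rfloor> / real (Suc n)"
    proof
      fix n
      have "real (Suc n) * b y - 1 \<le> real_of_int \<lfloor>real (Suc n) * b y\<rfloor>" by linarith
      then have "(real (Suc n) * b y - 1) / real (Suc n) \<le> real_of_int \<lfloor>real (Suc n) * b y\<rfloor> / real (Suc n)"
        by (rule divide_right_mono) simp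
      moreover have "(real (Suc n) * b y - 1) / real (Suc n) = b y - inverse (real (Suc n))"
        by (simp add: field_simps del: of_nat_Suc)
      ultimately show "b y - inverse (real (Suc n)) \<le> real_of_int \<lfloor>real (Suc n) * b y\<rfloor> / real (Suc n)" by simp
    qed
    show "\<forall>n. real_of_int \<lfloor>real (Suc n) * b y\<rfloor> / real (Suc n) \<le> b y"
    proof
      fix n
      have "real_of_int \<lfloor>real (Suc n) * b y\<rfloor> / real (Suc n) \<le> (real (Suc n) * b y) / real (Suc n)"
        by (rule divide_right_mono) (linarith, simp)
      then show "real_of_int \<lfloor>real (Suc n) * b y\<rfloor> / real (Suc n) \<le> b y" by (simp del: of_nat_Suc)
    qed
    show "(\<lambda>n. b y - inverse (real (Suc n))) \<longlonglongrightarrow> b y"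
      using tendsto_diff[OF tendsto_const LIMSEQ_inverse_real_of_nat] by simp
  qed (rule tendsto_const)
  have "isCont (f (a y)) (b y)" using c by (simp add: continuous_on_eq_continuous_at)
  then show "(\<lambda>n. f (a y) (real_of_int \<lfloor>real (Suc n) * b y\<rfloor> / real (Suc n))) \<longlonglongrightarrow> f (a y) (b y)"
    using lim by (rule isCont_tendsto_compose)
qed

lemma borel_measurable_primitive:
  fixes g :: "'a::euclidean_space \<Rightarrow> real \<Rightarrow> real"
  assumes S: "\<Omega> \<in> sets lebesgue" and g: "caratheodory \<Omega> g"
    and w: "w \<in> borel_measurable (lebesgue_on \<Omega>)" and pos: "\<And>x. x \<in> \<Omega> \<Longrightarrow> 0 < w x"
  shows "(\<lambda>x. LBINT s=0..ereal (w x). g x s) \<in> borel_measurable (lebesgue_on \<Omega>)"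
proof -
  \<comment> \<open>Replacing \<open>g\<close> by 0 at the null set of points without continuity
    makes the integrand jointly measurable, so its parameter integral is measurable; completeness
    carries the result back to \<open>g\<close>.\<close>
  define f where "f x = (if continuous_on UNIV (g x) then g x else (\<lambda>t. 0))" for x
  have cg: "AE x in lebesgue_on \<Omega>. continuous_on UNIV (g x)" using g by (simp add: caratheodory_def)
  have mf: "(\<lambda>x. f x t) \<in> borel_measurable (lebesgue_on \<Omega>)" for t
  proof (rule borel_measurable_lebesgue_on_AE[OF S])
    show "(\<lambda>x. g x t) \<in> borel_measurable (lebesgue_on \<Omega>)" using g by (simp add: caratheodory_def)
    show "AE x in lebesgue_on \<Omega>. g x t = f x t" using cg by eventually_elim (simp add: f_def)
  qed
  have cf: "continuous_on UNIV (f x)" for x by (simp add: f_def)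
  have pm: "(\<lambda>z. f (fst z) (snd z)) \<in> borel_measurable (lebesgue_on \<Omega> \<Otimes>\<^sub>M lborel)"
    by (rule borel_measurable_caratheodory_compose[OF mf cf]) auto
  have wm: "(\<lambda>z. w (fst z)) \<in> borel_measurable (lebesgue_on \<Omega> \<Otimes>\<^sub>M lborel)"
    by (rule measurable_compose[OF measurable_fst w])
  have "(\<lambda>z. (if 0 < snd z \<and> snd z < w (fst z) then f (fst z) (snd z) else 0)) \<in> borel_measurable (lebesgue_on \<Omega> \<Otimes>\<^sub>M lborel)"
    using pm wm by measurable
  then have "(\<lambda>x. \<integral>s. (if 0 < s \<and> s < w x then f x s else 0) \<partial>lborel) \<in> borel_measurable (lebesgue_on \<Omega>)"
    by (intro lborel.borel_measurable_lebesgue_integral) (simp add: split_beta)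
  moreover have "AE x in lebesgue_on \<Omega>. (\<integral>s. (if 0 < s \<and> s < w x then f x s else 0) \<partial>lborel) = (LBINT s=0..ereal (w x). g x s)"
    using cg AE_space
  proof eventually_elim
    case (elim x)
    then have "0 < w x" using pos by simp
    have "(LBINT s=0..ereal (w x). g x s) = (LBINT s:{0<..<w x}. g x s)"
      using \<open>0 < w x\<close> by (simp add: interval_lebesgue_integral_def zero_ereal_def)
    also have "\<dots> = (\<integral>s. (if 0 < s \<and> s < w x then f x s else 0) \<partial>lborel)"
      unfolding set_lebesgue_integral_def
      by (rule Bochner_Integration.integral_cong) (use elim in \<open>auto simp: indicator_def f_def\<close>)
    finally show ?case by simp
  qed
  ultimately show ?thesis by (rule borel_measurable_lebesgue_on_AE[OF S])
qed

lemma primitive_growth: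
  fixes G g :: "real \<Rightarrow> real"
  assumes G: "\<And>t. (G has_real_derivative g t) (at t)" "G 0 = 0" and a: "0 < a" "a \<le> M"
    and g: "\<And>t. \<bar>g t\<bar> \<le> C * (1 + \<bar>t\<bar> powr \<sigma>)" and "0 < C" "0 < \<sigma>"
  shows "\<bar>G a\<bar> \<le> M * (C * (1 + M powr \<sigma>))"
proof -
  have "\<exists>z. 0 < z \<and> z < a \<and> G a - G 0 = (a - 0) * g z"
    using a by (intro MVT2 G) auto
  then obtain z where z: "0 < z" "z < a" "G a = a * g z" using G(2) by auto
  have "\<bar>g z\<bar> \<le> C * (1 + M powr \<sigma>)"
    using z a assms(6,7) by (intro order_trans[OF g] mult_left_mono add_left_mono powr_mono2) auto
  then show ?thesis
    unfolding z(3) abs_mult using a by (intro mult_mono) auto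
qed

text \<open>In the variable \<open>s = t\<^sup>p\<close> the primitive \<open>G\<close> is concave on the half line, since the derivative of
  \<open>G (s\<^sup>1\<^sup>/\<^sup>p)\<close> is \<open>g t / (p t\<^sup>p\<^sup>-\<^sup>1)\<close>.\<close>

lemma has_derivative_primitive_powr:
  assumes "1 < p" and G: "\<And>t. (G has_real_derivative g t) (at t)" and "0 < s"
  shows "((\<lambda>s. - G (s powr (1 / p))) has_real_derivative
    - (g (s powr (1 / p)) / (s powr (1 / p)) powr (p - 1) / p)) (at s)"
proof -
  have "((\<lambda>s. s powr (1 / p)) has_real_derivative 1 / p * s powr (1 / p - 1)) (at s)"
    using assms by (auto intro!: derivative_eq_intros)
  from DERIV_chain2[OF G this]
  have "((\<lambda>s. - G (s powr (1 / p))) has_real_derivative - (g (s powr (1 / p)) * (1 / p * s powr (1 / p - 1)))) (at s)"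
    by (rule DERIV_minus)
  moreover have "s powr (1 / p - 1) = inverse ((s powr (1 / p)) powr (p - 1))"
  proof -
    have "(s powr (1 / p)) powr (p - 1) = s powr (1 - 1 / p)"
      using assms by (simp add: powr_powr right_diff_distrib)
    then show ?thesis using powr_minus[of s "1 - 1 / p"] by simp
  qed
  ultimately show ?thesis by (simp add: divide_inverse ac_simps)
qed

lemma primitive_geo_concave:
  assumes p: "1 < p" and G: "\<And>t. (G has_real_derivative g t) (at t)"
    and anti: "antimono_on {0<..} (\<lambda>t. g t / t powr (p - 1))"
    and ab: "0 < a" "0 < b" and t: "0 \<le> t" "t \<le> 1"
  shows "(1 - t) * G a + t * G b \<le> G (geo p t a b)"
proof -
  let ?k = "\<lambda>s. - G (s powr (1 / p))"
  have "convex_on {0<..} ?k"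
  proof (rule convex_on_realI)
    show "(?k has_real_derivative - (g (s powr (1 / p)) / (s powr (1 / p)) powr (p - 1) / p)) (at s)" if "s \<in> {0<..}" for s
      using that by (intro has_derivative_primitive_powr[OF p G]) auto
    show "- (g (x powr (1 / p)) / (x powr (1 / p)) powr (p - 1) / p) \<le> - (g (y powr (1 / p)) / (y powr (1 / p)) powr (p - 1) / p)"
      if "x \<in> {0<..}" "y \<in> {0<..}" "x \<le> y" for x y
    proof -
      have "x powr (1 / p) \<le> y powr (1 / p)" using that p by (intro powr_mono2) auto
      then have "g (y powr (1 / p)) / (y powr (1 / p)) powr (p - 1) \<le> g (x powr (1 / p)) / (x powr (1 / p)) powr (p - 1)"
        using that monotone_onD[OF anti, of "x powr (1 / p)" "y powr (1 / p)"] by simp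
      from divide_right_mono[OF this, of p] show ?thesis using p by simp
    qed
  qed auto
  then have "?k ((1 - t) * a powr p + t * b powr p) \<le> (1 - t) * ?k (a powr p) + t * ?k (b powr p)"
    using convex_onD[of "{0<..}" ?k t "a powr p" "b powr p"] t ab by simp
  moreover have "(a powr p) powr (1 / p) = a" "(b powr p) powr (1 / p) = b" using p ab by (simp_all add: powr_powr)
  ultimately show ?thesis by (simp add: geo_def)
qed

lemma primitive_geo_strictly_concave:
  assumes p: "1 < p" and G: "\<And>t. (G has_real_derivative g t) (at t)"
    and anti: "strict_antimono_on {0<..} (\<lambda>t. g t / t powr (p - 1))"
    and ab: "0 < a" "0 < b" "a \<noteq> b"
  shows "(G a + G b) / 2 < G (geo p (1 / 2) a b)"
proof -
  have *: "(G a + G b) / 2 < G (geo p (1 / 2) a b)" if ab: "0 < a" "a < b" for a b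
  proof -
    let ?k = "\<lambda>s. - G (s powr (1 / p))"
    have k: "?k ((a powr p + b powr p) / 2) < (?k (a powr p) + ?k (b powr p)) / 2"
    proof (rule midpoint_strictly_convex)
      show "(?k has_real_derivative - (g (s powr (1 / p)) / (s powr (1 / p)) powr (p - 1) / p)) (at s)"
        if "s \<in> {a powr p..b powr p}" for s
      proof -
        have "0 < a powr p" "a powr p \<le> s" using ab that by simp_all
        then have "0 < s" by (rule less_le_trans)
        then show ?thesis by (rule has_derivative_primitive_powr[OF p G])
      qed
      show "- (g (x powr (1 / p)) / (x powr (1 / p)) powr (p - 1) / p) < - (g (y powr (1 / p)) / (y powr (1 / p)) powr (p - 1) / p)"
        if "a powr p < x" "x < y" "y < b powr p" for x y
      proof -
        have "0 < x" using that(1) by (rule le_less_trans[rotated]) simp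
        then have "x powr (1 / p) < y powr (1 / p)" using that p by (intro powr_less_mono2) auto
        then have "g (y powr (1 / p)) / (y powr (1 / p)) powr (p - 1) < g (x powr (1 / p)) / (x powr (1 / p)) powr (p - 1)"
          using \<open>0 < x\<close> that(2) monotone_onD[OF anti, of "x powr (1 / p)" "y powr (1 / p)"] by simp
        from divide_strict_right_mono[OF this, of p] show ?thesis using p by simp
      qed
      show "a powr p < b powr p" using ab p by (intro powr_less_mono2) auto
    qed
    have r: "(a powr p) powr (1 / p) = a" "(b powr p) powr (1 / p) = b" using p ab by (simp_all add: powr_powr)
    have "geo p (1 / 2) a b = ((a powr p + b powr p) / 2) powr (1 / p)"
      by (simp add: geo_def add_divide_distrib)
    then obtain q where q: "q = G (geo p (1 / 2) a b)" "q = G (((a powr p + b powr p) / 2) powr (1 / p))" by simp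
    have "- q < (- G a + - G b) / 2" using k unfolding r q(2)[symmetric] .
    then have "(G a + G b) / 2 < q" by (simp add: field_simps)
    then show ?thesis unfolding q(1) .
  qed
  show ?thesis
  proof (cases "a < b")
    case True
    then show ?thesis using * ab by blast
  next
    case False
    then have "b < a" using ab by simp
    from *[OF ab(2) this] show ?thesis by (simp add: geo_def add.commute)
  qed
qed

lemma primitive_convex:
  fixes H h :: "real \<Rightarrow> real"
  assumes H: "\<And>t. (H has_real_derivative h (max 0 t)) (at t)" and h: "mono_on {0..} h"
    and t: "0 \<le> t" "t \<le> 1"
  shows "H ((1 - t) * a + t * b) \<le> (1 - t) * H a + t * H b"
proof -
  have "convex_on UNIV H"
  proof (rule convex_on_realI[OF _ H])
    show "h (max 0 x) \<le> h (max 0 y)" if "x \<le> y" for x y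
      using that by (intro mono_onD[OF h]) auto
  qed auto
  then show ?thesis using convex_onD[of UNIV H t a b] t by simp
qed

lemma primitive_strictly_convex:
  fixes H h :: "real \<Rightarrow> real"
  assumes H: "\<And>t. (H has_real_derivative h (max 0 t)) (at t)" and h: "strict_mono_on {0..} h"
    and ab: "0 \<le> a" "0 \<le> b" "a \<noteq> b"
  shows "H ((a + b) / 2) < (H a + H b) / 2"
proof -
  have *: "H ((a + b) / 2) < (H a + H b) / 2" if "0 \<le> a" "a < b" for a b
  proof (rule midpoint_strictly_convex[OF H _ that(2)])
    show "h (max 0 x) < h (max 0 y)" if "a < x" "x < y" "y < b" for x y
      using that \<open>0 \<le> a\<close> by (intro strict_mono_onD[OF h]) auto
  qed
  show ?thesis
  proof (cases "a < b")
    case True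
    then show ?thesis using * ab by blast
  next
    case False
    then have "b < a" using ab by simp
    from *[OF ab(2) this] show ?thesis by (simp add: add.commute)
  qed
qed

lemma primitive_mono:
  fixes H h :: "real \<Rightarrow> real"
  assumes H: "\<And>t. (H has_real_derivative h (max 0 t)) (at t)" and h: "\<And>t. 0 \<le> t \<Longrightarrow> 0 \<le> h t" and "a \<le> b"
  shows "H a \<le> H b"
  by (rule DERIV_nonneg_imp_nondecreasing[OF \<open>a \<le> b\<close>]) (use H h in \<open>auto intro!: exI\<close>)

lemma primitive_strict_mono:
  fixes H h :: "real \<Rightarrow> real"
  assumes H: "\<And>t. (H has_real_derivative h (max 0 t)) (at t)" and h: "\<And>t. 0 < t \<Longrightarrow> 0 < h t" and ab: "0 \<le> a" "a < b"
  shows "H a < H b"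
proof -
  have "\<exists>z. a < z \<and> z < b \<and> H b - H a = (b - a) * h (max 0 z)"
    using ab by (intro MVT2 H) auto
  then obtain z where z: "a < z" "z < b" "H b - H a = (b - a) * h (max 0 z)" by metis
  have "0 < (b - a) * h (max 0 z)" using ab z h[of z] by simp
  then show ?thesis using z(3) by simp
qed

lemma powr_le_imp_le:
  fixes x y p :: real
  assumes "0 < p" "0 \<le> x" "0 \<le> y" "x powr p \<le> y powr p"
  shows "x \<le> y"
  using powr_less_mono2[OF assms(1,3), of x] assms(4) by (meson not_le)

section \<open>Convexity of the functional along the curve\<close>

locale p_functional =
  fixes \<Omega> :: "'a::euclidean_space set"
    and p r C\<^sub>h C \<sigma> :: real
    and h H :: "real \<Rightarrow> real"
    and g G :: "'a \<Rightarrow> real \<Rightarrow> real"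
    and X A :: "('a \<Rightarrow> real) set"
    and I :: "('a \<Rightarrow> real) \<Rightarrow> real"
  assumes opn: "open \<Omega>" and bdd: "bounded \<Omega>" and conn: "connected \<Omega>"
    and p: "1 < p" and pr: "p < r"
    and h_nonneg: "\<And>t. 0 \<le> t \<Longrightarrow> 0 \<le> h t"
    and h_cont: "continuous_on {0..} h"
    and h_mono: "mono_on {0..} h"
    and C\<^sub>h: "0 < C\<^sub>h" and h_growth: "\<And>t. 0 \<le> t \<Longrightarrow> h t \<le> C\<^sub>h * (1 + t powr (r / p - 1))"
    and X: "X = W1 \<Omega> r \<or> X = W1_0 \<Omega> r"
    and g_car: "caratheodory \<Omega> g"
    and H: "H = (\<lambda>t. LBINT s=0..ereal t. h s)"
    and G: "G = (\<lambda>x t. LBINT s=0..ereal t. g x s)"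
    and I: "I = (\<lambda>u. LINT x|lebesgue_on \<Omega>. 1 / p * H (norm (weak_gradient \<Omega> u x) powr p) - G x (u x))"
    and C: "0 < C" and \<sigma>: "0 < \<sigma>" and g_growth: "\<And>x t. x \<in> \<Omega> \<Longrightarrow> \<bar>g x t\<bar> \<le> C * (1 + \<bar>t\<bar> powr \<sigma>)"
    and g_anti: "\<And>x. x \<in> \<Omega> \<Longrightarrow> antimono_on {0<..} (\<lambda>t. g x t / t powr (p - 1))"
    and A: "A = {u. critical_point \<Omega> r X I u \<and> ae_nonneg \<Omega> u \<and> \<not> ae_eq \<Omega> u (\<lambda>_. 0)}"
    and rep: "\<And>u. critical_point \<Omega> r X I u \<Longrightarrow> ae_nonneg \<Omega> u \<Longrightarrow> \<exists>w. continuous_on (closure \<Omega>) w \<and> ae_eq \<Omega> u w"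
    and comp: "\<And>u v. u \<in> A \<Longrightarrow> v \<in> A \<Longrightarrow> continuous_on (closure \<Omega>) u \<Longrightarrow> continuous_on (closure \<Omega>) v \<Longrightarrow>
      \<exists>\<delta>. 0 < \<delta> \<and> \<delta> < 1 \<and> (\<forall>x\<in>\<Omega>. 0 < \<delta> * v x \<and> \<delta> * v x \<le> u x \<and> u x \<le> inverse \<delta> * v x)"
begin

abbreviation "M \<equiv> lebesgue_on \<Omega>"
abbreviation grad :: "('a \<Rightarrow> real) \<Rightarrow> 'a \<Rightarrow> 'a" where "grad \<equiv> weak_gradient \<Omega>"

lemma S: "\<Omega> \<in> sets lebesgue" by (rule sets_lebesgue_open[OF opn])

lemma r: "0 < r" "1 < r" using p pr by auto

text \<open>Nothing is known about \<open>h\<close> on the negative axis. Extending it there by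
  \<open>h 0\<close> gives a continuous integrand on the line and a primitive differentiable also at
  0, equal to \<open>H\<close> on the half-line where \<open>H\<close> is evaluated.\<close>

definition H' :: "real \<Rightarrow> real" where "H' t = (LBINT s=0..ereal t. h (max 0 s))"

lemma H_eq: "0 \<le> t \<Longrightarrow> H t = H' t"
  unfolding H H'_def by (rule interval_integral_cong) (auto simp: einterval_def min_def max_def)

lemma H'_deriv: "(H' has_real_derivative h (max 0 t)) (at t)"
  unfolding H'_def[abs_def]
  by (rule interval_integral_has_real_derivative) (auto intro!: continuous_on_compose2[OF h_cont] continuous_intros)

lemma H'_0: "H' 0 = 0"
  by (simp add: H'_def flip: zero_ereal_def)

lemma H'_nonneg: "0 \<le> s \<Longrightarrow> 0 \<le> H' s"
  using primitive_mono[OF H'_deriv h_nonneg, of 0 s] by (simp add: H'_0)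

text \<open>The mean value theorem and monotonicity give H'(s) \<le> s h(s), which the growth bound
  turns into a multiple of s + s^(r/p); with s = y^p both terms are at most 1 + y^r.\<close>

lemma H'_growth: "0 \<le> y \<Longrightarrow> H' (y powr p) \<le> C\<^sub>h * (1 + 2 * y powr r)"
proof (cases "y = 0")
  case True
  then show ?thesis using C\<^sub>h by (simp add: H'_0)
next
  case False
  assume "0 \<le> y"
  define s where "s = y powr p"
  have s: "0 < s" "0 < y" using False \<open>0 \<le> y\<close> by (simp_all add: s_def)
  have "\<exists>z. 0 < z \<and> z < s \<and> H' s - H' 0 = (s - 0) * h (max 0 z)"
    using s by (intro MVT2 H'_deriv) auto
  then obtain z where z: "0 < z" "z < s" "H' s = s * h z" by (auto simp: H'_0)
  have "h z \<le> h s" using z by (intro mono_onD[OF h_mono]) auto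
  also have "\<dots> \<le> C\<^sub>h * (1 + s powr (r / p - 1))" using s by (intro h_growth) simp
  finally have "H' s \<le> s * (C\<^sub>h * (1 + s powr (r / p - 1)))" unfolding z(3) using s by (intro mult_left_mono) auto
  also have "\<dots> = C\<^sub>h * (s + s powr (r / p))" using s powr_add[of s 1 "r / p - 1"] by (simp add: algebra_simps)
  also have "s powr (r / p) = y powr r" using p s by (simp add: s_def powr_powr)
  also have "s \<le> 1 + y powr r"
  proof (cases "y \<le> 1")
    case True
    then have "s \<le> 1" using p s by (simp add: s_def powr_le1)
    then show ?thesis using powr_ge_zero[of y r] by linarith
  next
    case False
    then have "s \<le> y powr r" using pr by (simp add: s_def powr_mono)
    then show ?thesis by simp
  qed
  finally show ?thesis using C\<^sub>h by (simp add: s_def add.commute)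
qed

lemma H'_measurable:
  assumes V: "V \<in> borel_measurable M"
  shows "(\<lambda>x. H' (norm (V x) powr p)) \<in> borel_measurable M"
proof -
  have "continuous_on UNIV H'"
    by (meson H'_deriv DERIV_isCont continuous_at_imp_continuous_on)
  moreover have "(\<lambda>x. norm (V x) powr p) \<in> borel_measurable M" using V by measurable
  ultimately show ?thesis by (rule borel_measurable_continuous_on)
qed

lemma H'_integrable:
  assumes "in_Lp \<Omega> r V" shows "integrable M (\<lambda>x. H' (norm (V x) powr p))"
proof (rule Bochner_Integration.integrable_bound)
  have "integrable M (\<lambda>x. 1::real)"
    by (rule integrable_bounded_lebesgue_on[OF opn bdd, of _ 1]) auto
  then show "integrable M (\<lambda>x. C\<^sub>h * (1 + 2 * norm (V x) powr r))"
    using assms by (intro integrable_mult_right Bochner_Integration.integrable_add) (auto simp: in_Lp_def)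
  show "(\<lambda>x. H' (norm (V x) powr p)) \<in> borel_measurable M"
    using assms by (intro H'_measurable) (simp add: in_Lp_def)
  show "AE x in M. norm (H' (norm (V x) powr p)) \<le> norm (C\<^sub>h * (1 + 2 * norm (V x) powr r))"
  proof (rule AE_I2)
    fix x
    have "0 \<le> H' (norm (V x) powr p)" by (rule H'_nonneg) simp
    moreover have "H' (norm (V x) powr p) \<le> C\<^sub>h * (1 + 2 * norm (V x) powr r)" by (rule H'_growth) simp
    ultimately show "norm (H' (norm (V x) powr p)) \<le> norm (C\<^sub>h * (1 + 2 * norm (V x) powr r))" by simp
  qed
qed

lemma G_deriv: "AE x in M. (\<forall>t. (G x has_real_derivative g x t) (at t)) \<and> G x 0 = 0"
proof -
  have "AE x in M. continuous_on UNIV (g x)" using g_car by (simp add: caratheodory_def)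
  then show ?thesis
  proof eventually_elim
    case (elim x)
    have "(G x has_real_derivative g x t) (at t)" for t
      unfolding G by (rule interval_integral_has_real_derivative[OF elim])
    then show ?case by (simp add: G flip: zero_ereal_def)
  qed
qed

text \<open>Since \<open>w\<close> is bounded, the growth condition makes \<open>G x (w x)\<close>
  bounded, and the domain has finite measure.\<close>

lemma G_integrable:
  assumes w: "pos_W1 \<Omega> r w" shows "integrable M (\<lambda>x. G x (w x))"
proof -
  obtain B where B: "\<forall>x\<in>\<Omega>. w x \<le> B" using w by (auto simp: pos_W1_def)
  show ?thesis
  proof (rule integrable_bounded_lebesgue_on[OF opn bdd])
    show "(\<lambda>x. G x (w x)) \<in> borel_measurable M"
      unfolding G using w pos_W1_measurable(1)[OF opn w]
      by (intro borel_measurable_primitive[OF S g_car]) (auto simp: pos_W1_def)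
    show "AE x in M. norm (G x (w x)) \<le> B * (C * (1 + B powr \<sigma>))"
      using G_deriv AE_space
    proof eventually_elim
      case (elim x)
      then have x: "x \<in> \<Omega>" by simp
      have "\<bar>G x (w x)\<bar> \<le> B * (C * (1 + B powr \<sigma>))"
      proof (rule primitive_growth[where G="G x" and g="g x" and a="w x"])
        show "(G x has_real_derivative g x t) (at t)" for t using elim by blast
        show "G x 0 = 0" using elim by blast
        show "0 < w x" "w x \<le> B" using w B x by (auto simp: pos_W1_def)
        show "\<bar>g x t\<bar> \<le> C * (1 + \<bar>t\<bar> powr \<sigma>)" for t by (rule g_growth[OF x])
      qed (rule C \<sigma>)+
      then show ?case by simp
    qed
  qed
qed

text \<open>Any weak gradient may stand in for the chosen one, so \<open>geo_grad\<close> computes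
  \<open>I\<close> on the curve. Integrability is recorded alongside: the default value 0 of a
  non-integrable integrand could not be compared.\<close>

lemma I_eq:
  assumes w: "pos_W1 \<Omega> r w" and Z: "is_weak_gradient \<Omega> w Z"
  shows "integrable M (\<lambda>x. 1 / p * H' (norm (Z x) powr p) - G x (w x))"
    "I w = (LINT x|M. 1 / p * H' (norm (Z x) powr p) - G x (w x))"
proof -
  have W: "w \<in> W1 \<Omega> r" using w by (simp add: pos_W1_def)
  have ae: "AE x in M. grad w x = Z x" by (rule weak_gradient_AE[OF opn Z])
  have "in_Lp \<Omega> r Z" by (rule in_Lp_cong_AE[OF opn W1_weak_gradient(2)[OF opn W] ae])
  then show "integrable M (\<lambda>x. 1 / p * H' (norm (Z x) powr p) - G x (w x))"
    by (intro Bochner_Integration.integrable_diff integrable_mult_right H'_integrable G_integrable[OF w])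
  have "AE x in M. 1 / p * H (norm (grad w x) powr p) - G x (w x) = 1 / p * H' (norm (Z x) powr p) - G x (w x)"
    using ae by eventually_elim (simp add: H_eq)
  then show "I w = (LINT x|M. 1 / p * H' (norm (Z x) powr p) - G x (w x))"
    unfolding I by (rule integral_lebesgue_on_cong_AE(1)[OF S])
qed

lemma is_weak_gradient_curve:
  assumes u: "pos_W1 \<Omega> r u" and v: "pos_W1 \<Omega> r v" and t: "0 \<le> t" "t \<le> 1"
  shows "continuous_on \<Omega> (\<lambda>x. geo p t (u x) (v x))"
    "is_weak_gradient \<Omega> (\<lambda>x. geo p t (u x) (v x)) (\<lambda>x. geo_grad p t (u x) (v x) (grad u x) (grad v x))"
  using is_weak_gradient_geo[OF opn p t, of u "grad u" v "grad v"] u v W1_weak_gradient(1)[OF opn]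
  by (auto simp: pos_W1_def)

lemma pos_W1_geo:
  assumes u: "pos_W1 \<Omega> r u" and v: "pos_W1 \<Omega> r v" and t: "0 \<le> t" "t \<le> 1"
    and \<delta>: "0 < \<delta>" "\<delta> < 1" "comparable_on \<delta> \<Omega> u v"
  shows "pos_W1 \<Omega> r (\<lambda>x. geo p t (u x) (v x))"
  unfolding pos_W1_def
proof (intro conjI ballI)
  show "continuous_on \<Omega> (\<lambda>x. geo p t (u x) (v x))" by (rule is_weak_gradient_curve(1)[OF u v t])
  show pos: "0 < geo p t (u x) (v x)" if "x \<in> \<Omega>" for x
    using u v that t by (intro geo_pos) (auto simp: pos_W1_def)
  obtain B B' where B: "\<forall>x\<in>\<Omega>. u x \<le> B" "\<forall>x\<in>\<Omega>. v x \<le> B'" using u v by (auto simp: pos_W1_def)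
  have "geo p t (u x) (v x) \<le> max B B'" if x: "x \<in> \<Omega>" for x
  proof -
    let ?m = "max B B'"
    have uv: "0 < u x" "0 < v x" "u x \<le> ?m" "v x \<le> ?m" using u v B x by (auto simp: pos_W1_def)
    have "(1 - t) * u x powr p + t * v x powr p \<le> (1 - t) * ?m powr p + t * ?m powr p"
      using uv t p by (intro add_mono mult_left_mono powr_mono2) auto
    also have "\<dots> = ?m powr p" by (simp add: algebra_simps)
    finally have "geo p t (u x) (v x) \<le> (?m powr p) powr (1 / p)"
      unfolding geo_def using geo_radicand_pos[OF uv(1,2) t, of p] p by (intro powr_mono2) auto
    also have "\<dots> = ?m" using uv p by (simp add: powr_powr)
    finally show ?thesis .
  qed
  then show "\<exists>M. \<forall>x\<in>\<Omega>. geo p t (u x) (v x) \<le> M" by blast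
  have "(\<lambda>x. geo p t (u x) (v x) - u x) \<in> W1 \<Omega> r"
    using geo_diff_W1[OF opn bdd p r(1) u v \<delta>] t by blast
  from W1_combine[OF opn r(1) this, of u 1 1]
  show "(\<lambda>x. geo p t (u x) (v x)) \<in> W1 \<Omega> r" using u by (simp add: pos_W1_def)
qed

text \<open>The inequalities stay separate because their equality cases are used for different
  conclusions: the first for proportionality, the second for equal gradient norms, the third for
  equality of the functions.\<close>

lemma convexity_AE:
  assumes u: "pos_W1 \<Omega> r u" and v: "pos_W1 \<Omega> r v" and t: "0 \<le> t" "t \<le> 1"
  shows "AE x in M. H' (norm (geo_grad p t (u x) (v x) (grad u x) (grad v x)) powr p)
      \<le> H' ((1 - t) * norm (grad u x) powr p + t * norm (grad v x) powr p)
    \<and> H' ((1 - t) * norm (grad u x) powr p + t * norm (grad v x) powr p)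
      \<le> (1 - t) * H' (norm (grad u x) powr p) + t * H' (norm (grad v x) powr p)
    \<and> (1 - t) * G x (u x) + t * G x (v x) \<le> G x (geo p t (u x) (v x))"
  using G_deriv AE_space
proof eventually_elim
  case (elim x)
  then have x: "x \<in> \<Omega>" by simp
  have uv: "0 < u x" "0 < v x" using u v x by (auto simp: pos_W1_def)
  show ?case
  proof (intro conjI)
    show "H' (norm (geo_grad p t (u x) (v x) (grad u x) (grad v x)) powr p)
      \<le> H' ((1 - t) * norm (grad u x) powr p + t * norm (grad v x) powr p)"
      by (intro primitive_mono[OF H'_deriv h_nonneg] norm_geo_grad(1)[OF p uv t])
    show "H' ((1 - t) * norm (grad u x) powr p + t * norm (grad v x) powr p)
      \<le> (1 - t) * H' (norm (grad u x) powr p) + t * H' (norm (grad v x) powr p)"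
      by (rule primitive_convex[OF H'_deriv h_mono t])
    show "(1 - t) * G x (u x) + t * G x (v x) \<le> G x (geo p t (u x) (v x))"
      by (rule primitive_geo_concave[OF p _ g_anti[OF x] uv t]) (use elim in blast)
  qed
qed

lemma chord:
  assumes u: "pos_W1 \<Omega> r u" and v: "pos_W1 \<Omega> r v" and t: "0 \<le> t" "t \<le> 1"
    and \<delta>: "0 < \<delta>" "\<delta> < 1" "comparable_on \<delta> \<Omega> u v"
  shows "I (\<lambda>x. geo p t (u x) (v x)) \<le> (1 - t) * I u + t * I v"
proof -
  note wu = W1_weak_gradient(1)[OF opn, of u r] and wv = W1_weak_gradient(1)[OF opn, of v r]
  note iu = I_eq[OF u wu] and iv = I_eq[OF v wv]
  note ig = I_eq[OF pos_W1_geo[OF u v t \<delta>] is_weak_gradient_curve(2)[OF u v t]]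
  have uW: "u \<in> W1 \<Omega> r" "v \<in> W1 \<Omega> r" using u v by (auto simp: pos_W1_def)
  let ?e = "\<lambda>w x. 1 / p * H' (norm (grad w x) powr p) - G x (w x)"
  have "I (\<lambda>x. geo p t (u x) (v x)) \<le> (LINT x|M. (1 - t) * ?e u x + t * ?e v x)"
    unfolding ig(2)
  proof (rule integral_mono_AE[OF ig(1)])
    show "integrable M (\<lambda>x. (1 - t) * ?e u x + t * ?e v x)"
      by (intro Bochner_Integration.integrable_add integrable_mult_right iu(1)[OF uW(1)] iv(1)[OF uW(2)])
    show "AE x in M. 1 / p * H' (norm (geo_grad p t (u x) (v x) (grad u x) (grad v x)) powr p) - G x (geo p t (u x) (v x))
        \<le> (1 - t) * ?e u x + t * ?e v x"
      using convexity_AE[OF u v t]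
    proof eventually_elim
      case (elim x)
      then have "H' (norm (geo_grad p t (u x) (v x) (grad u x) (grad v x)) powr p)
          \<le> (1 - t) * H' (norm (grad u x) powr p) + t * H' (norm (grad v x) powr p)" by linarith
      then have "1 / p * H' (norm (geo_grad p t (u x) (v x) (grad u x) (grad v x)) powr p)
          \<le> 1 / p * ((1 - t) * H' (norm (grad u x) powr p) + t * H' (norm (grad v x) powr p))"
        using p by (intro mult_left_mono) auto
      moreover have "(1 - t) * G x (u x) + t * G x (v x) \<le> G x (geo p t (u x) (v x))" using elim by blast
      moreover have "(1 - t) * ?e u x + t * ?e v x =
          1 / p * ((1 - t) * H' (norm (grad u x) powr p) + t * H' (norm (grad v x) powr p))
          - ((1 - t) * G x (u x) + t * G x (v x))"
        by (simp add: distrib_left right_diff_distrib)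
      ultimately show ?case by linarith
    qed
  qed
  also have "\<dots> = (1 - t) * I u + t * I v"
    unfolding iu(2)[OF uW(1)] iv(2)[OF uW(2)]
    by (subst Bochner_Integration.integral_add)
       (use iu(1)[OF uW(1)] iv(1)[OF uW(2)] in \<open>auto intro!: integrable_mult_right\<close>)
  finally show ?thesis .
qed

text \<open>Along the curve the increment of \<open>I\<close> is \<open>o(t)\<close> at a critical point, while the chord inequality
  would force a linear decrease if \<open>I\<close> were smaller further along.\<close>

lemma critical_point_minimizes:
  assumes cr: "critical_point \<Omega> r X I u" and u: "pos_W1 \<Omega> r u" and v: "pos_W1 \<Omega> r v" "v \<in> X"
    and \<tau>: "0 \<le> \<tau>" "\<tau> \<le> 1" and \<delta>: "0 < \<delta>" "\<delta> < 1" "comparable_on \<delta> \<Omega> u v"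
  shows "I u \<le> I (\<lambda>x. geo p \<tau> (u x) (v x))"
proof (rule ccontr)
  define m where "m x = geo p \<tau> (u x) (v x)" for x
  assume "\<not> I u \<le> I (\<lambda>x. geo p \<tau> (u x) (v x))"
  then have less: "I m < I u" by (simp add: m_def[abs_def])
  have uX: "u \<in> X" using cr by (simp add: critical_point_def)
  have m: "pos_W1 \<Omega> r m" unfolding m_def[abs_def] by (rule pos_W1_geo[OF u v(1) \<tau> \<delta>])
  obtain K where K: "0 \<le> K" "\<And>t. 0 \<le> t \<Longrightarrow> t \<le> 1 \<Longrightarrow> (\<lambda>x. geo p t (u x) (v x) - u x) \<in> W1 \<Omega> r \<and>
      sobolev_norm \<Omega> r (\<lambda>x. geo p t (u x) (v x) - u x) \<le> K * t"
    using geo_diff_W1[OF opn bdd p r(1) u v(1) \<delta>] by blast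
  have inX: "(\<lambda>x. geo p t (u x) (v x) - u x) \<in> X" if t: "0 \<le> t" "t \<le> 1" for t
    using X
  proof
    assume "X = W1_0 \<Omega> r"
    then show ?thesis
      using geo_diff_W1_0[OF opn bdd p r(1) u _ v(1) _ t] K(2)[OF t] uX v(2) by blast
  qed (use K(2)[OF t] in blast)
  \<comment> \<open>Calibrated against the chord: it forces a drop of at least
    \<open>s * (2 * (K + 1) * \<eta>)\<close> after a step \<open>s\<close>, while criticality
    permits at most \<open>s * (K * \<eta>)\<close>.\<close>
  define \<eta> where "\<eta> = (I u - I m) / (2 * (K + 1))"
  have \<eta>: "0 < \<eta>" using less K(1) by (simp add: \<eta>_def)
  obtain d where d: "0 < d" "\<forall>w\<in>X. sobolev_norm \<Omega> r w < d \<longrightarrow> \<bar>I (\<lambda>x. u x + w x) - I u - 0\<bar> \<le> \<eta> * sobolev_norm \<Omega> r w"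
    using cr \<eta> unfolding critical_point_def has_frechet_derivative_on_def by blast
  define s where "s = min 1 (d / (2 * (K + 1)))"
  have s: "0 < s" "s \<le> 1" using d(1) K(1) by (auto simp: s_def)
  have s\<tau>: "0 \<le> s * \<tau>" "s * \<tau> \<le> 1" "s * \<tau> \<le> s" using s \<tau> by (auto intro: mult_le_one mult_left_le)
  define w where "w x = geo p (s * \<tau>) (u x) (v x) - u x" for x
  have wX: "w \<in> X" unfolding w_def[abs_def] by (rule inX[OF s\<tau>(1,2)])
  have wn: "sobolev_norm \<Omega> r w \<le> K * s"
    using K(2)[OF s\<tau>(1,2)] mult_left_mono[OF s\<tau>(3) K(1)] unfolding w_def[abs_def] by linarith
  have "K * s < d"
  proof -
    have "K * s \<le> K * (d / (2 * (K + 1)))" using K(1) by (intro mult_left_mono) (auto simp: s_def)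
    also have "\<dots> < d" using K(1) d(1) by (simp add: field_simps add_nonneg_pos)
    finally show ?thesis .
  qed
  then have "\<bar>I (\<lambda>x. u x + w x) - I u - 0\<bar> \<le> \<eta> * sobolev_norm \<Omega> r w" using d(2) wX wn by auto
  also have "\<dots> \<le> \<eta> * (K * s)" using wn \<eta> by (intro mult_left_mono) auto
  finally have 1: "I u - I (\<lambda>x. u x + w x) \<le> \<eta> * (K * s)" by linarith
  \<comment> \<open>The chord inequality will join \<open>u\<close> to \<open>m\<close>, so these
    have to be comparable too. In p-th powers \<open>m\<close> is a weighted mean of
    \<open>u\<close> and \<open>v\<close>, so the same \<open>\<delta>\<close> serves.\<close>
  have cm: "\<exists>\<delta>. 0 < \<delta> \<and> \<delta> < 1 \<and> comparable_on \<delta> \<Omega> u m"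
  proof -
    have "\<delta> * m x \<le> u x \<and> \<delta> * u x \<le> m x" if x: "x \<in> \<Omega>" for x
    proof -
      have h: "0 < u x" "0 < v x" "\<delta> * v x \<le> u x" "\<delta> * u x \<le> v x"
        using u v(1) \<delta>(3) x by (auto simp: pos_W1_def comparable_on_def)
      have mp: "0 < m x" "m x powr p = (1 - \<tau>) * u x powr p + \<tau> * v x powr p"
        unfolding m_def using geo_pos[OF h(1,2) \<tau>] geo_powr[OF p \<tau>] by auto
      have \<delta>le: "\<delta> * u x \<le> u x" using \<delta> h by simp
      have "(\<delta> * u x) powr p = (1 - \<tau>) * (\<delta> * u x) powr p + \<tau> * (\<delta> * u x) powr p" by (simp add: algebra_simps)
      also have "\<dots> \<le> m x powr p"
        unfolding mp(2) using h \<delta> \<delta>le \<tau> p by (intro add_mono mult_left_mono powr_mono2) auto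
      finally have a: "\<delta> * u x \<le> m x"
        by (rule powr_le_imp_le[rotated 3]) (use h \<delta> mp p in auto)
      have "(\<delta> * m x) powr p = (1 - \<tau>) * (\<delta> * u x) powr p + \<tau> * (\<delta> * v x) powr p"
        using \<delta> mp h by (simp add: powr_mult distrib_left mult.left_commute)
      also have "\<dots> \<le> (1 - \<tau>) * u x powr p + \<tau> * u x powr p"
        using h \<delta> \<delta>le \<tau> p by (intro add_mono mult_left_mono powr_mono2) auto
      also have "\<dots> = u x powr p" by (simp add: algebra_simps)
      finally have b: "\<delta> * m x \<le> u x"
        by (rule powr_le_imp_le[rotated 3]) (use h \<delta> mp p in auto)
      show ?thesis using a b by blast
    qed
    then show ?thesis using \<delta> by (auto simp: comparable_on_def)
  qed
  then obtain \<delta>' where \<delta>': "0 < \<delta>'" "\<delta>' < 1" "comparable_on \<delta>' \<Omega> u m" by blast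
  \<comment> \<open>In p-th powers the curve is a segment: going the fraction \<open>s\<close> of
    the way to its point at \<tau> reaches its point at \<open>s * \<tau>\<close>.\<close>
  have eqI: "I (\<lambda>x. geo p s (u x) (m x)) = I (\<lambda>x. u x + w x)"
  proof -
    have "(\<lambda>x. u x + w x) = (\<lambda>x. geo p (s * \<tau>) (u x) (v x))" by (simp add: w_def)
    moreover have "(\<lambda>x. geo p s (u x) (m x)) = (\<lambda>x. geo p (s * \<tau>) (u x) (v x))"
      unfolding m_def geo_def[of p s] geo_def[of p "s * \<tau>"] geo_powr[OF p \<tau>] by (simp add: algebra_simps)
    ultimately show ?thesis by simp
  qed
  have "I (\<lambda>x. geo p s (u x) (m x)) \<le> (1 - s) * I u + s * I m"
    using s by (intro chord[OF u m _ _ \<delta>']) auto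
  then have 2: "s * (I u - I m) \<le> I u - I (\<lambda>x. u x + w x)" unfolding eqI by (simp add: algebra_simps)
  have "s * (I u - I m) = s * (2 * (K + 1) * \<eta>)" using K(1) by (simp add: \<eta>_def)
  with 1 2 have "s * (2 * (K + 1) * \<eta>) \<le> s * (K * \<eta>)" by (simp add: ac_simps)
  then have "2 * (K + 1) * \<eta> \<le> K * \<eta>" using s(1) by (simp add: mult_le_cancel_left_pos)
  then show False using \<eta> K(1) by (simp add: mult_le_cancel_right_pos)
qed

end

section \<open>The cases of equality\<close>

context p_functional
begin

lemma pos_W1_representative:
  assumes "u \<in> A" "continuous_on (closure \<Omega>) u"
  shows "pos_W1 \<Omega> r u" "u \<in> X" "critical_point \<Omega> r X I u"
proof -
  show cr: "critical_point \<Omega> r X I u" using assms(1) by (simp add: A)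
  then show "u \<in> X" by (simp add: critical_point_def)
  then have "u \<in> W1 \<Omega> r" using X by (auto simp: W1_0_def)
  moreover have "0 < u x" if x: "x \<in> \<Omega>" for x
  proof -
    \<comment> \<open>Positivity comes from comparing \<open>u\<close> with itself.\<close>
    obtain \<delta> where d: "0 < \<delta>" "\<forall>x\<in>\<Omega>. 0 < \<delta> * u x \<and> \<delta> * u x \<le> u x \<and> u x \<le> inverse \<delta> * u x"
      using comp[OF assms(1,1,2,2)] by (elim exE conjE) (rule that)
    then have "0 < \<delta> * u x" using x by simp
    then show ?thesis using d(1) by (rule zero_less_mult_pos)
  qed
  moreover have "\<exists>M. \<forall>x\<in>\<Omega>. u x \<le> M"
  proof -
    have "compact (closure \<Omega>)" using bdd by simp
    then have "bounded (u ` closure \<Omega>)" using assms(2) by (intro compact_imp_bounded compact_continuous_image)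
    then obtain B where "\<forall>y\<in>u ` closure \<Omega>. \<bar>y\<bar> \<le> B" unfolding bounded_iff by auto
    then show ?thesis using closure_subset[of \<Omega>] by (intro exI[of _ B]) force
  qed
  moreover have "continuous_on \<Omega> u" using assms(2) closure_subset by (rule continuous_on_subset)
  ultimately show "pos_W1 \<Omega> r u" by (simp add: pos_W1_def)
qed

lemma comparable_representatives:
  assumes "u \<in> A" "v \<in> A" "continuous_on (closure \<Omega>) u" "continuous_on (closure \<Omega>) v"
  obtains \<delta> where "0 < \<delta>" "\<delta> < 1" "comparable_on \<delta> \<Omega> u v" "comparable_on \<delta> \<Omega> v u"
proof -
  obtain \<delta> where \<delta>: "0 < \<delta>" "\<delta> < 1" "\<forall>x\<in>\<Omega>. 0 < \<delta> * v x \<and> \<delta> * v x \<le> u x \<and> u x \<le> inverse \<delta> * v x"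
    using comp[OF assms] by (elim exE conjE) (rule that)
  have "\<delta> * u x \<le> v x" if "x \<in> \<Omega>" for x
  proof -
    have "\<delta> * u x \<le> \<delta> * (inverse \<delta> * v x)" using \<delta> that by (intro mult_left_mono) auto
    also have "\<dots> = v x" using \<delta>(1) by simp
    finally show ?thesis .
  qed
  then show ?thesis using \<delta> by (intro that[of \<delta>]) (auto simp: comparable_on_def)
qed

text \<open>Minimality from both ends gives I u = I v, and the midpoint cannot lie below. So the
  convexity deficit is nonnegative with integral at most zero, hence zero almost everywhere, and
  with it each of its nonnegative parts.\<close>

lemma equality_AE:
  assumes A': "u \<in> A" "v \<in> A" and c: "continuous_on (closure \<Omega>) u" "continuous_on (closure \<Omega>) v"
  shows "AE x in M. H' (norm (geo_grad p (1 / 2) (u x) (v x) (grad u x) (grad v x)) powr p)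
        = H' ((norm (grad u x) powr p + norm (grad v x) powr p) / 2)
    \<and> H' ((norm (grad u x) powr p + norm (grad v x) powr p) / 2)
        = (H' (norm (grad u x) powr p) + H' (norm (grad v x) powr p)) / 2
    \<and> G x (geo p (1 / 2) (u x) (v x)) = (G x (u x) + G x (v x)) / 2"
proof -
  note u = pos_W1_representative[OF A'(1) c(1)] and v = pos_W1_representative[OF A'(2) c(2)]
  obtain \<delta> where \<delta>: "0 < \<delta>" "\<delta> < 1" "comparable_on \<delta> \<Omega> u v" "comparable_on \<delta> \<Omega> v u"
    using comparable_representatives[OF A' c] by metis
  have half: "0 \<le> (1::real) / 2" "(1::real) / 2 \<le> 1" by simp_all
  let ?m = "\<lambda>x. geo p (1 / 2) (u x) (v x)"
  let ?Z = "\<lambda>x. geo_grad p (1 / 2) (u x) (v x) (grad u x) (grad v x)"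
  have le: "I u' \<le> I v'"
    if "critical_point \<Omega> r X I u'" "pos_W1 \<Omega> r u'" "pos_W1 \<Omega> r v'" "v' \<in> X" "comparable_on \<delta> \<Omega> u' v'" for u' v'
  proof -
    have "I u' \<le> I (\<lambda>x. geo p 1 (u' x) (v' x))"
      by (rule critical_point_minimizes[OF that(1-4) _ _ \<delta>(1,2) that(5)]) auto
    \<comment> \<open>The endpoint of the curve equals \<open>v'\<close> where \<open>v'\<close> is
      positive, that is in \<open>\<Omega>\<close>; outside it the representatives may differ, so
      the identity passes through \<open>ae_eq\<close>.\<close>
    moreover have "I (\<lambda>x. geo p 1 (u' x) (v' x)) = I v'"
    proof -
      have "geo p 1 (u' x) (v' x) = v' x" if "x \<in> \<Omega>" for x
      proof -
        have "0 < v' x" using \<open>pos_W1 \<Omega> r v'\<close> that by (simp add: pos_W1_def)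
        then show ?thesis using p by (simp add: geo_def powr_powr)
      qed
      then have ae: "ae_eq \<Omega> (\<lambda>x. geo p 1 (u' x) (v' x)) v'"
        unfolding ae_eq_def by (intro AE_I2) simp
      have "AE x in M. 1 / p * H (norm (grad (\<lambda>x. geo p 1 (u' x) (v' x)) x) powr p) - G x (geo p 1 (u' x) (v' x))
          = 1 / p * H (norm (grad v' x) powr p) - G x (v' x)"
        using ae unfolding ae_eq_def weak_gradient_cong(2)[OF opn ae] by eventually_elim simp
      then show ?thesis unfolding I by (rule integral_lebesgue_on_cong_AE(1)[OF S])
    qed
    ultimately show ?thesis by simp
  qed
  have eq: "I u = I v"
    using le[OF u(3,1) v(1,2) \<delta>(3)] le[OF v(3,1) u(1,2) \<delta>(4)] by simp
  have Im: "I u \<le> I ?m"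
    by (rule critical_point_minimizes[OF u(3,1) v(1,2) half \<delta>(1-3)])
  have uW: "u \<in> W1 \<Omega> r" "v \<in> W1 \<Omega> r" using u v by (auto simp: pos_W1_def)
  note iu = I_eq[OF u(1) W1_weak_gradient(1)[OF opn uW(1)]] and iv = I_eq[OF v(1) W1_weak_gradient(1)[OF opn uW(2)]]
  note ig = I_eq[OF pos_W1_geo[OF u(1) v(1) half \<delta>(1-3)] is_weak_gradient_curve(2)[OF u(1) v(1) half]]
  let ?e = "\<lambda>w x. 1 / p * H' (norm (grad w x) powr p) - G x (w x)"
  let ?em = "\<lambda>x. 1 / p * H' (norm (?Z x) powr p) - G x (?m x)"
  let ?D = "\<lambda>x. (1 / 2 * ?e u x + 1 / 2 * ?e v x) - ?em x"
  note conv = convexity_AE[OF u(1) v(1) half]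
  have nn: "AE x in M. 0 \<le> 1 / p * (1 / 2 * H' (norm (grad u x) powr p) + 1 / 2 * H' (norm (grad v x) powr p) - H' (norm (?Z x) powr p))
      \<and> 0 \<le> G x (?m x) - (1 / 2 * G x (u x) + 1 / 2 * G x (v x))"
    using conv
  proof eventually_elim
    case (elim x)
    then have "0 \<le> 1 / 2 * H' (norm (grad u x) powr p) + 1 / 2 * H' (norm (grad v x) powr p) - H' (norm (?Z x) powr p)"
      by simp
    then show ?case using elim p by simp
  qed
  \<comment> \<open>The deficit is separated into its gradient part and its \<open>G\<close> part,
    whose signs are known individually.\<close>
  have split: "?D x = 1 / p * (1 / 2 * H' (norm (grad u x) powr p) + 1 / 2 * H' (norm (grad v x) powr p) - H' (norm (?Z x) powr p))
      + (G x (?m x) - (1 / 2 * G x (u x) + 1 / 2 * G x (v x)))" for x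
    by (simp add: right_diff_distrib distrib_left)
  have Di: "integrable M ?D"
    by (intro Bochner_Integration.integrable_diff Bochner_Integration.integrable_add integrable_mult_right iu(1) iv(1) ig(1))
  have D0: "AE x in M. 0 \<le> ?D x"
    using nn unfolding split by eventually_elim linarith
  have "(LINT x|M. ?D x) = (1 / 2 * I u + 1 / 2 * I v) - I ?m"
  proof -
    have "(LINT x|M. ?D x) = (LINT x|M. 1 / 2 * ?e u x + 1 / 2 * ?e v x) - (LINT x|M. ?em x)"
      by (rule Bochner_Integration.integral_diff[OF Bochner_Integration.integrable_add[OF integrable_mult_right integrable_mult_right] ig(1)])
         (use iu(1) iv(1) in auto)
    also have "(LINT x|M. 1 / 2 * ?e u x + 1 / 2 * ?e v x) = (LINT x|M. 1 / 2 * ?e u x) + (LINT x|M. 1 / 2 * ?e v x)"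
      by (rule Bochner_Integration.integral_add[OF integrable_mult_right integrable_mult_right]) (use iu(1) iv(1) in auto)
    finally show ?thesis unfolding iu(2) iv(2) ig(2) by (simp only: integral_mult_right_zero)
  qed
  also have "\<dots> \<le> 0" using Im eq by simp
  finally have "(LINT x|M. ?D x) = 0" using integral_nonneg_AE[OF D0] by linarith
  then have "AE x in M. ?D x = 0" using integral_nonneg_eq_0_iff_AE[OF Di D0] by blast
  then show ?thesis
    using nn conv
  proof eventually_elim
    case (elim x)
    have hz: "1 / p * (1 / 2 * H' (norm (grad u x) powr p) + 1 / 2 * H' (norm (grad v x) powr p) - H' (norm (?Z x) powr p)) = 0"
      and gz: "G x (?m x) - (1 / 2 * G x (u x) + 1 / 2 * G x (v x)) = 0"
      using elim(1,2) unfolding split by linarith+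
    have 1: "1 / 2 * H' (norm (grad u x) powr p) + 1 / 2 * H' (norm (grad v x) powr p) - H' (norm (?Z x) powr p) = 0"
      using hz p by simp
    have e: "(1 - 1 / 2) * norm (grad u x) powr p + 1 / 2 * norm (grad v x) powr p = (norm (grad u x) powr p + norm (grad v x) powr p) / 2"
      by simp
    have 2: "H' (norm (?Z x) powr p) \<le> H' ((norm (grad u x) powr p + norm (grad v x) powr p) / 2)"
      "H' ((norm (grad u x) powr p + norm (grad v x) powr p) / 2)
        \<le> (1 - 1 / 2) * H' (norm (grad u x) powr p) + 1 / 2 * H' (norm (grad v x) powr p)"
      using elim(3) unfolding e by blast+
    show ?case using 1 2 gz by (intro conjI) (simp_all add: field_simps)
  qed
qed

text \<open>Positivity of \<open>h\<close> makes \<open>H'\<close> strictly increasing on the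
  half-line, so equal values of \<open>H'\<close> force equality in Picone's inequality, and the
  logarithms of the two functions differ by a constant.\<close>

lemma proportional:
  assumes A': "u \<in> A" "v \<in> A" and c: "continuous_on (closure \<Omega>) u" "continuous_on (closure \<Omega>) v"
    and hp: "\<And>t. 0 < t \<Longrightarrow> 0 < h t"
  obtains \<alpha> where "0 < \<alpha>" "\<And>x. x \<in> \<Omega> \<Longrightarrow> u x = \<alpha> * v x"
proof (cases "\<Omega> = {}")
  case True
  then show ?thesis using that[of 1] by simp
next
  case False
  note u = pos_W1_representative[OF A'(1) c(1)] and v = pos_W1_representative[OF A'(2) c(2)]
  have pos: "0 < u x" "0 < v x" if "x \<in> \<Omega>" for x using u(1) v(1) that by (auto simp: pos_W1_def)
  have cts: "continuous_on \<Omega> u" "continuous_on \<Omega> v" using u(1) v(1) by (auto simp: pos_W1_def)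
  have uW: "u \<in> W1 \<Omega> r" "v \<in> W1 \<Omega> r" using u v by (auto simp: pos_W1_def)
  have VW: "AE x in M. grad u x /\<^sub>R u x = grad v x /\<^sub>R v x"
    using equality_AE[OF A' c] AE_space
  proof eventually_elim
    case (elim x)
    then have x: "x \<in> \<Omega>" by simp
    let ?N = "norm (geo_grad p (1 / 2) (u x) (v x) (grad u x) (grad v x)) powr p"
    let ?Q = "(norm (grad u x) powr p + norm (grad v x) powr p) / 2"
    have "?N \<le> ?Q"
      using norm_geo_grad(1)[OF p pos[OF x], of "1 / 2" "grad u x" "grad v x"] by simp
    moreover have "\<not> ?N < ?Q"
    proof
      assume "?N < ?Q"
      then have "H' ?N < H' ?Q" by (intro primitive_strict_mono[OF H'_deriv hp]) auto
      then show False using elim by simp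
    qed
    ultimately have N: "?N = (1 - 1 / 2) * norm (grad u x) powr p + 1 / 2 * norm (grad v x) powr p" by simp
    show ?case by (rule norm_geo_grad(2)[OF p pos[OF x] _ _ N]) auto
  qed
  have lnw: "is_weak_gradient \<Omega> (\<lambda>x. ln (w x)) (\<lambda>x. inverse (w x) *\<^sub>R grad w x)"
    if "pos_W1 \<Omega> r w" for w
    using that W1_weak_gradient(1)[OF opn, of w r]
    by (intro is_weak_gradient_chain[OF opn, where F'=inverse])
       (auto simp: pos_W1_def intro!: derivative_eq_intros continuous_intros simp: divide_inverse)
  have "is_weak_gradient \<Omega> (\<lambda>x. ln (u x) - ln (v x)) (\<lambda>x. 0)"
  proof (rule is_weak_gradient_cong_AE[OF opn is_weak_gradient_combine[OF opn lnw[OF u(1)] lnw[OF v(1)], of 1 "-1"]])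
    show "AE x in M. 1 *\<^sub>R inverse (u x) *\<^sub>R grad u x + -1 *\<^sub>R inverse (v x) *\<^sub>R grad v x = 0"
      using VW by eventually_elim simp
  qed simp
  moreover have "continuous_on \<Omega> (\<lambda>x. ln (u x) - ln (v x))"
    using pos by (intro continuous_intros cts) force+
  ultimately have const: "ln (u x) - ln (v x) = ln (u y) - ln (v y)" if "x \<in> \<Omega>" "y \<in> \<Omega>" for x y
    using weak_gradient_zero_imp_constant[OF opn conn, of "\<lambda>x. ln (u x) - ln (v x)" x y] that by blast
  obtain y where y: "y \<in> \<Omega>" using False by blast
  show ?thesis
  proof (rule that[of "u y / v y"])
    show "0 < u y / v y" using pos[OF y] by simp
    show "u x = u y / v y * v x" if x: "x \<in> \<Omega>" for x
    proof -
      have "ln (u x / v x) = ln (u y / v y)"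
        using const[OF x y] pos[OF x] pos[OF y] by (simp add: ln_div)
      then have "u x / v x = u y / v y" using pos[OF x] pos[OF y] by (simp add: ln_inj_iff)
      then show ?thesis using pos[OF x] by (simp add: field_simps)
    qed
  qed
qed

lemma equal_of_strict_antimono:
  assumes A': "u \<in> A" "v \<in> A" and c: "continuous_on (closure \<Omega>) u" "continuous_on (closure \<Omega>) v"
    and g: "\<And>x. x \<in> \<Omega> \<Longrightarrow> strict_antimono_on {0<..} (\<lambda>t. g x t / t powr (p - 1))"
  shows "ae_eq \<Omega> u v"
  unfolding ae_eq_def using equality_AE[OF A' c] G_deriv AE_space
proof eventually_elim
  case (elim x)
  then have x: "x \<in> \<Omega>" by simp
  note u = pos_W1_representative(1)[OF A'(1) c(1)] and v = pos_W1_representative(1)[OF A'(2) c(2)]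
  have pos: "0 < u x" "0 < v x" using u v x by (auto simp: pos_W1_def)
  show ?case
  proof (rule ccontr)
    assume "u x \<noteq> v x"
    then have "(G x (u x) + G x (v x)) / 2 < G x (geo p (1 / 2) (u x) (v x))"
      using elim by (intro primitive_geo_strictly_concave[OF p _ g[OF x] pos]) auto
    then show False using elim(1) by simp
  qed
qed

text \<open>An increasing nonnegative \<open>h\<close> is positive away from 0, so u is \<alpha>
  times v. Strict convexity of \<open>H'\<close> makes the gradient norms equal, and a factor other
  than 1 would then force both gradients to vanish and \<open>u\<close> to be constant.\<close>

lemma equal_of_strict_mono:
  assumes A': "u \<in> A" "v \<in> A" and c: "continuous_on (closure \<Omega>) u" "continuous_on (closure \<Omega>) v"
    and h: "strict_mono_on {0..} h" and nc: "\<And>k. \<not> ae_eq \<Omega> u (\<lambda>_. k)"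
  shows "ae_eq \<Omega> u v"
proof -
  have hp: "0 < h t" if "0 < t" for t
    using strict_mono_onD[OF h, of 0 t] h_nonneg[of 0] that by simp
  obtain \<alpha> where \<alpha>: "0 < \<alpha>" "\<And>x. x \<in> \<Omega> \<Longrightarrow> u x = \<alpha> * v x"
    using proportional[OF A' c hp] by metis
  note u = pos_W1_representative[OF A'(1) c(1)] and v = pos_W1_representative[OF A'(2) c(2)]
  have cts: "continuous_on \<Omega> u" using u(1) by (auto simp: pos_W1_def)
  have uW: "u \<in> W1 \<Omega> r" "v \<in> W1 \<Omega> r" using u v by (auto simp: pos_W1_def)
  note wu = W1_weak_gradient(1)[OF opn uW(1)] and wv = W1_weak_gradient(1)[OF opn uW(2)]
  have uv: "ae_eq \<Omega> (\<lambda>x. \<alpha> * v x + 0 * v x) u"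
    unfolding ae_eq_def using \<alpha>(2) by (intro AE_I2) simp
  have "is_weak_gradient \<Omega> u (\<lambda>x. \<alpha> *\<^sub>R grad v x + 0 *\<^sub>R grad v x)"
    using is_weak_gradient_combine[OF opn wv wv, of \<alpha> 0] unfolding weak_gradient_cong(1)[OF opn uv] .
  from is_weak_gradient_unique[OF opn wu this]
  have gr: "AE x in M. grad u x = \<alpha> *\<^sub>R grad v x" by simp
  have nn: "AE x in M. norm (grad u x) = norm (grad v x)"
    using equality_AE[OF A' c]
  proof eventually_elim
    case (elim x)
    show ?case
    proof (rule ccontr)
      assume "norm (grad u x) \<noteq> norm (grad v x)"
      then have "norm (grad u x) powr p \<noteq> norm (grad v x) powr p"
        using powr_less_mono2[of p "norm (grad u x)" "norm (grad v x)"] powr_less_mono2[of p "norm (grad v x)" "norm (grad u x)"] p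
        by (cases "norm (grad u x) < norm (grad v x)") auto
      then have "H' ((norm (grad u x) powr p + norm (grad v x) powr p) / 2) < (H' (norm (grad u x) powr p) + H' (norm (grad v x) powr p)) / 2"
        by (intro primitive_strictly_convex[OF H'_deriv h]) auto
      then show False using elim by simp
    qed
  qed
  have "\<alpha> = 1"
  proof (rule ccontr)
    assume "\<alpha> \<noteq> 1"
    have "AE x in M. grad u x = 0"
      using gr nn
    proof eventually_elim
      case (elim x)
      then have "\<alpha> * norm (grad v x) = norm (grad v x)" using \<alpha>(1) by simp
      then have "grad v x = 0" using \<open>\<alpha> \<noteq> 1\<close> by simp
      then show ?case using elim(1) by simp
    qed
    then have "is_weak_gradient \<Omega> u (\<lambda>x. 0)"
      by (intro is_weak_gradient_cong_AE[OF opn wu]) auto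
    then have const: "u x = u y" if "x \<in> \<Omega>" "y \<in> \<Omega>" for x y
      using weak_gradient_zero_imp_constant[OF opn conn cts _ that] by blast
    have "ae_eq \<Omega> u (\<lambda>_. u (SOME y. y \<in> \<Omega>))"
      unfolding ae_eq_def
    proof (rule AE_I2)
      fix x assume "x \<in> space M"
      then have x: "x \<in> \<Omega>" by simp
      then show "u x = u (SOME y. y \<in> \<Omega>)" by (intro const someI[of "\<lambda>y. y \<in> \<Omega>"])
    qed
    then show False using nc by blast
  qed
  then show ?thesis using \<alpha>(2) by (auto simp: ae_eq_def)
qed

text \<open>The continuous representative supplied by (iii) is a different function in general. It
  is again critical because \<open>I\<close>, the norm and membership in \<open>X\<close> depend
  only on the class modulo null sets.\<close>

lemma critical_point_cong:
  assumes ae: "ae_eq \<Omega> u w" and u: "critical_point \<Omega> r X I u"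
  shows "critical_point \<Omega> r X I w"
proof -
  have I_cong: "I f = I k" if "ae_eq \<Omega> f k" for f k
  proof -
    have "AE x in M. 1 / p * H (norm (grad f x) powr p) - G x (f x) = 1 / p * H (norm (grad k x) powr p) - G x (k x)"
      using that unfolding ae_eq_def weak_gradient_cong(2)[OF opn that] by eventually_elim simp
    then show ?thesis unfolding I by (rule integral_lebesgue_on_cong_AE(1)[OF S])
  qed
  have shift: "ae_eq \<Omega> (\<lambda>x. u x + v x) (\<lambda>x. w x + v x)" "ae_eq \<Omega> (\<lambda>x. u x - v x) (\<lambda>x. w x - v x)" for v
    using ae unfolding ae_eq_def by (auto elim: eventually_mono)
  have norm_cong: "sobolev_norm \<Omega> r f = sobolev_norm \<Omega> r k" if "ae_eq \<Omega> f k" for f k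
  proof -
    have "AE x in M. \<bar>f x\<bar> powr r + norm (grad f x) powr r = \<bar>k x\<bar> powr r + norm (grad k x) powr r"
      using that unfolding ae_eq_def weak_gradient_cong(2)[OF opn that] by eventually_elim simp
    from integral_lebesgue_on_cong_AE(1)[OF S this] show ?thesis by (simp add: sobolev_norm_def)
  qed
  have uX: "u \<in> X" using u by (simp add: critical_point_def)
  then have uW: "u \<in> W1 \<Omega> r" using X by (auto simp: W1_0_def)
  have wW: "w \<in> W1 \<Omega> r"
  proof (rule W1I)
    show "in_Lp \<Omega> r w"
      using in_Lp_cong_AE[OF opn W1_weak_gradient(3)[OF opn uW]] ae by (simp add: ae_eq_def)
    show "is_weak_gradient \<Omega> w (grad u)"
      using W1_weak_gradient(1)[OF opn uW] unfolding weak_gradient_cong(1)[OF opn ae] .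
    show "in_Lp \<Omega> r (grad u)" by (rule W1_weak_gradient(2)[OF opn uW])
  qed
  have wX: "w \<in> X"
    using X
  proof
    assume X0: "X = W1_0 \<Omega> r"
    have "\<exists>\<phi>\<in>test_functions \<Omega>. sobolev_norm \<Omega> r (\<lambda>x. w x - \<phi> x) < \<epsilon>" if \<epsilon>: "0 < \<epsilon>" for \<epsilon>
    proof -
      obtain \<phi> where "\<phi> \<in> test_functions \<Omega>" "sobolev_norm \<Omega> r (\<lambda>x. u x - \<phi> x) < \<epsilon>"
        using uX \<epsilon> unfolding X0 W1_0_def by blast
      then show ?thesis using norm_cong[OF shift(2)[of \<phi>]] by auto
    qed
    then show ?thesis using wW by (simp add: X0 W1_0_def)
  qed (use wW in simp)
  have "has_frechet_derivative_on X (sobolev_norm \<Omega> r) I w (\<lambda>_. 0)"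
    using u unfolding critical_point_def has_frechet_derivative_on_def I_cong[OF ae] I_cong[OF shift(1)] by blast
  then show ?thesis using wX by (simp add: critical_point_def)
qed

lemma continuous_representative:
  assumes "u \<in> A" obtains w where "w \<in> A" "continuous_on (closure \<Omega>) w" "ae_eq \<Omega> u w"
proof -
  have u: "critical_point \<Omega> r X I u" "ae_nonneg \<Omega> u" "\<not> ae_eq \<Omega> u (\<lambda>_. 0)" using assms by (auto simp: A)
  obtain w where w: "continuous_on (closure \<Omega>) w" "ae_eq \<Omega> u w" using rep[OF u(1,2)] by blast
  have "critical_point \<Omega> r X I w" by (rule critical_point_cong[OF w(2) u(1)])
  moreover have "ae_nonneg \<Omega> w"
    using u(2) w(2) unfolding ae_nonneg_def ae_eq_def by eventually_elim simp
  moreover have "\<not> ae_eq \<Omega> w (\<lambda>_. 0)"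
  proof
    assume "ae_eq \<Omega> w (\<lambda>_. 0)"
    with w(2) have "ae_eq \<Omega> u (\<lambda>_. 0)" unfolding ae_eq_def by eventually_elim simp
    then show False using u(3) by simp
  qed
  ultimately show ?thesis using w by (intro that[of w]) (simp add: A)
qed

end

section \<open>From continuous representatives to the classes in \<open>A\<close>\<close>

lemma ae_eq_sym:
  assumes "ae_eq \<Omega> u v" shows "ae_eq \<Omega> v u"
  using assms unfolding ae_eq_def by eventually_elim simp

lemma ae_eq_trans:
  assumes "ae_eq \<Omega> u v" "ae_eq \<Omega> v w" shows "ae_eq \<Omega> u w"
  using assms unfolding ae_eq_def by eventually_elim simp

theorem theorem1p5:
  fixes \<Omega> :: "'a::euclidean_space set"
    and p r :: real
    and h H :: "real \<Rightarrow> real"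
    and g G :: "'a \<Rightarrow> real \<Rightarrow> real"
    and X A :: "('a \<Rightarrow> real) set"
    and I :: "('a \<Rightarrow> real) \<Rightarrow> real"
  assumes domain: "smooth_bounded_domain \<Omega>"
    and exponents: "1 < p" "p < r"
    and h_nonneg: "\<forall>t\<ge>0. 0 \<le> h t"
    and h_cont: "continuous_on {0..} h"
    and h_mono: "mono_on {0..} h"
    and h_growth: "\<exists>C>0. \<forall>t\<ge>0. h t \<le> C * (1 + t powr (r / p - 1))"
    and X: "X = W1 \<Omega> r \<or> X = W1_0 \<Omega> r"
    and g_car: "caratheodory \<Omega> g"
    and H: "H = (\<lambda>t. LBINT s=0..ereal t. h s)"
    and G: "G = (\<lambda>x t. LBINT s=0..ereal t. g x s)"
    and I: "I = (\<lambda>u. LINT x|lebesgue_on \<Omega>.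
                  1 / p * H (norm (weak_gradient \<Omega> u x) powr p) - G x (u x))"
    and i: "\<exists>C>0. \<exists>\<sigma>>0.
              \<sigma> * (real DIM('a) - r) \<le> (r - 1) * real DIM('a) + r \<and>
              (\<forall>x\<in>\<Omega>. \<forall>t. \<bar>g x t\<bar> \<le> C * (1 + \<bar>t\<bar> powr \<sigma>))"
    and ii: "\<forall>x\<in>\<Omega>. antimono_on {0<..} (\<lambda>t. g x t / t powr (p - 1))"
    and A: "A = {u. critical_point \<Omega> r X I u \<and> ae_nonneg \<Omega> u \<and> \<not> ae_eq \<Omega> u (\<lambda>_. 0)}"
    and iii_cont: "\<forall>u. critical_point \<Omega> r X I u \<and> ae_nonneg \<Omega> u \<longrightarrow>
              (\<exists>w. continuous_on (closure \<Omega>) w \<and> ae_eq \<Omega> u w)"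
    and iii_comp: "\<forall>u\<in>A. \<forall>v\<in>A.
              continuous_on (closure \<Omega>) u \<and> continuous_on (closure \<Omega>) v \<longrightarrow>
              (\<exists>\<delta>. 0 < \<delta> \<and> \<delta> < 1 \<and>
                 (\<forall>x\<in>\<Omega>. 0 < \<delta> * v x \<and> \<delta> * v x \<le> u x \<and> u x \<le> inverse \<delta> * v x))"
  shows "((\<forall>t>0. 0 < h t) \<and> A \<noteq> {} \<longrightarrow>
            (\<exists>u\<^sub>0\<in>A. \<forall>u\<in>A. \<exists>\<alpha>\<ge>0. ae_eq \<Omega> u (\<lambda>x. \<alpha> * u\<^sub>0 x))) \<and>
         ((\<forall>x\<in>\<Omega>. strict_antimono_on {0<..} (\<lambda>t. g x t / t powr (p - 1))) \<longrightarrow>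
            (\<forall>u\<in>A. \<forall>v\<in>A. ae_eq \<Omega> u v)) \<and>
         (strict_mono_on {0..} h \<and> (\<exists>u\<in>A. \<forall>c. \<not> ae_eq \<Omega> u (\<lambda>_. c)) \<longrightarrow>
            (\<exists>u\<in>A. \<forall>v\<in>A. ae_eq \<Omega> u v))"
proof -
  obtain C\<^sub>h where C\<^sub>h: "0 < C\<^sub>h" "\<forall>t\<ge>0. h t \<le> C\<^sub>h * (1 + t powr (r / p - 1))"
    using h_growth by blast
  obtain C \<sigma> where C: "0 < C" "0 < \<sigma>" "\<forall>x\<in>\<Omega>. \<forall>t. \<bar>g x t\<bar> \<le> C * (1 + \<bar>t\<bar> powr \<sigma>)"
    using i by blast
  have \<Omega>: "open \<Omega>" "bounded \<Omega>" "connected \<Omega>"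
    using domain by (simp_all add: smooth_bounded_domain_def)
  interpret p_functional \<Omega> p r C\<^sub>h C \<sigma> h H g G X A I
  proof unfold_locales
    show "0 \<le> h t" if "0 \<le> t" for t using h_nonneg that by blast
    show "h t \<le> C\<^sub>h * (1 + t powr (r / p - 1))" if "0 \<le> t" for t using C\<^sub>h(2) that by blast
    show "\<bar>g x t\<bar> \<le> C * (1 + \<bar>t\<bar> powr \<sigma>)" if "x \<in> \<Omega>" for x t using C(3) that by blast
    show "antimono_on {0<..} (\<lambda>t. g x t / t powr (p - 1))" if "x \<in> \<Omega>" for x using ii that by blast
    show "\<exists>w. continuous_on (closure \<Omega>) w \<and> ae_eq \<Omega> u w"
      if "critical_point \<Omega> r X I u" "ae_nonneg \<Omega> u" for u
      using iii_cont that by blast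
    show "\<exists>\<delta>. 0 < \<delta> \<and> \<delta> < 1 \<and> (\<forall>x\<in>\<Omega>. 0 < \<delta> * v x \<and> \<delta> * v x \<le> u x \<and> u x \<le> inverse \<delta> * v x)"
      if "u \<in> A" "v \<in> A" "continuous_on (closure \<Omega>) u" "continuous_on (closure \<Omega>) v" for u v
      using iii_comp that by blast
  qed (fact \<Omega> exponents h_cont h_mono C\<^sub>h(1) X g_car H G I C(1) C(2) A)+
  show ?thesis
  proof (intro conjI impI ballI)
    assume h: "(\<forall>t>0. 0 < h t) \<and> A \<noteq> {}"
    then obtain u\<^sub>0 where u0: "u\<^sub>0 \<in> A" by blast
    obtain w\<^sub>0 where w0: "w\<^sub>0 \<in> A" "continuous_on (closure \<Omega>) w\<^sub>0" "ae_eq \<Omega> u\<^sub>0 w\<^sub>0"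
      using continuous_representative[OF u0] by metis
    \<comment> \<open>The pointwise proportionality holds between continuous representatives; almost
      everywhere it passes to the given elements, so the ray is spanned by the original
      \<open>u\<^sub>0\<close>.\<close>
    have "\<exists>\<alpha>\<ge>0. ae_eq \<Omega> u (\<lambda>x. \<alpha> * u\<^sub>0 x)" if u: "u \<in> A" for u
    proof -
      obtain w where w: "w \<in> A" "continuous_on (closure \<Omega>) w" "ae_eq \<Omega> u w"
        using continuous_representative[OF u] by metis
      obtain \<alpha> where \<alpha>: "0 < \<alpha>" "\<And>x. x \<in> \<Omega> \<Longrightarrow> w x = \<alpha> * w\<^sub>0 x"
        using proportional[OF w(1) w0(1) w(2) w0(2)] h by metis
      have "AE x in lebesgue_on \<Omega>. u x = \<alpha> * u\<^sub>0 x"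
        using w(3) w0(3) AE_space unfolding ae_eq_def by eventually_elim (simp add: \<alpha>(2))
      then show ?thesis using \<alpha>(1) by (intro exI[of _ \<alpha>]) (simp add: ae_eq_def)
    qed
    then show "\<exists>u\<^sub>0\<in>A. \<forall>u\<in>A. \<exists>\<alpha>\<ge>0. ae_eq \<Omega> u (\<lambda>x. \<alpha> * u\<^sub>0 x)" using u0 by blast
  next
    fix u v
    assume g: "\<forall>x\<in>\<Omega>. strict_antimono_on {0<..} (\<lambda>t. g x t / t powr (p - 1))" and uv: "u \<in> A" "v \<in> A"
    obtain w where w: "w \<in> A" "continuous_on (closure \<Omega>) w" "ae_eq \<Omega> u w"
      using continuous_representative[OF uv(1)] by metis
    obtain w' where w': "w' \<in> A" "continuous_on (closure \<Omega>) w'" "ae_eq \<Omega> v w'"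
      using continuous_representative[OF uv(2)] by metis
    have "ae_eq \<Omega> w w'"
      by (rule equal_of_strict_antimono[OF w(1) w'(1) w(2) w'(2)]) (use g in blast)
    then show "ae_eq \<Omega> u v" using w(3) w'(3) ae_eq_trans ae_eq_sym by blast
  next
    assume h: "strict_mono_on {0..} h \<and> (\<exists>u\<in>A. \<forall>c. \<not> ae_eq \<Omega> u (\<lambda>_. c))"
    then obtain u where u: "u \<in> A" "\<forall>c. \<not> ae_eq \<Omega> u (\<lambda>_. c)" by blast
    obtain w where w: "w \<in> A" "continuous_on (closure \<Omega>) w" "ae_eq \<Omega> u w"
      using continuous_representative[OF u(1)] by metis
    have nc: "\<not> ae_eq \<Omega> w (\<lambda>_. c)" for c using u(2) ae_eq_trans[OF w(3)] by blast
    have "ae_eq \<Omega> u v" if v: "v \<in> A" for v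
    proof -
      obtain w' where w': "w' \<in> A" "continuous_on (closure \<Omega>) w'" "ae_eq \<Omega> v w'"
        using continuous_representative[OF v] by metis
      have "ae_eq \<Omega> w w'"
        by (rule equal_of_strict_mono[OF w(1) w'(1) w(2) w'(2) _ nc]) (use h in blast)
      then show ?thesis using w(3) w'(3) ae_eq_trans ae_eq_sym by blast
    qed
    then show "\<exists>u\<in>A. \<forall>v\<in>A. ae_eq \<Omega> u v" using u(1) by blast
  qed
qed

end
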